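(* Let $G$ be a group definable in a monster model $\mathfrak{C}$ of a strong$^2$ complete theory, let $\varphi(x,y)$ be a formula and $C$ a set of parameters such that $\{\varphi(\mathfrak{C},a):a\in C\}$ is a family of (not necessarily normal) definable subgroups of $G$. Then there is some $k\in\omega$ such that for every finite $C'\subseteq C$ there is some $C_0\subseteq C'$ with $|C_0|\le k$ and $$\Big[\bigcap_{a\in C_0}\varphi(\mathfrak{C},a)\;:\;\bigcap_{a\in C'}\varphi(\mathfrak{C},a)\Big]<\infty.$$
   Context: An inp$^2$-pattern of depth $\kappa$ consists of $(\bar a_\alpha,b_\alpha,\phi_\alpha(x,y_\alpha,z_\alpha))_{\alpha<\kappa}$ with $\phi_\alpha$ formulas, $\bar a_\alpha=(a_{\alpha,i})_{i<\omega}$, and $b_\alpha\subseteq\bigcup\{\bar a_\beta:\beta<\alpha\}$, such that the sequences $(\bar a_\alpha)_{\alpha<\kappa}$ are mutually indiscernible, $\{\phi_\alpha(x,a_{\alpha,i},b_\alpha):i<\omega\}$ is inconsistent for each $\alpha$, and $\{\phi_\alpha(x,a_{\alpha,0},b_\alpha):\alpha<\kappa\}$ is consistent. A theory is strong$^2$ if there is no inp$^2$-pattern of depth $\aleph_0$ with $x$ a single variable. *)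

theory Defs
  imports "HOL-Algebra.Coset"
begin

unbundle cardinal_syntax

section \<open>First-order logic\<close>

text \<open>A non-logical symbol is a name together with an arity. Symbol sets may be empty, and no
  bound is put on the number of symbols.\<close>

record ('f, 'r) language =
  fun_syms :: "('f \<times> nat) set"
  rel_syms :: "('r \<times> nat) set"

text \<open>Formulas are in de Bruijn notation: \<open>Var i\<close> is the \<open>i\<close>-th entry of the current list of
  values and \<open>Ex\<close> puts the quantified value in front of it. The other connectives and the
  universal quantifier are definable from the ones below.\<close>

datatype 'f tm = Var nat | Fn 'f "'f tm list"

datatype ('f, 'r) fm =
    Eq "'f tm" "'f tm"
  | Rl 'r "'f tm list"
  | Neg "('f, 'r) fm"
  | And "('f, 'r) fm" "('f, 'r) fm"
  | Ex "('f, 'r) fm"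

primrec is_term :: "('f, 'r) language \<Rightarrow> nat \<Rightarrow> 'f tm \<Rightarrow> bool" where
  "is_term L k (Var i) \<longleftrightarrow> i < k"
| "is_term L k (Fn f ts) \<longleftrightarrow> (f, length ts) \<in> fun_syms L \<and> list_all (is_term L k) ts"

text \<open>\<open>is_formula L k \<phi>\<close>: \<open>\<phi>\<close> is an \<open>L\<close>-formula whose free variables are among the first \<open>k\<close>.\<close>

primrec is_formula :: "('f, 'r) language \<Rightarrow> nat \<Rightarrow> ('f, 'r) fm \<Rightarrow> bool" where
  "is_formula L k (Eq s t) \<longleftrightarrow> is_term L k s \<and> is_term L k t"
| "is_formula L k (Rl r ts) \<longleftrightarrow> (r, length ts) \<in> rel_syms L \<and> list_all (is_term L k) ts"
| "is_formula L k (Neg \<phi>) \<longleftrightarrow> is_formula L k \<phi>"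
| "is_formula L k (And \<phi> \<psi>) \<longleftrightarrow> is_formula L k \<phi> \<and> is_formula L k \<psi>"
| "is_formula L k (Ex \<phi>) \<longleftrightarrow> is_formula L (Suc k) \<phi>"

text \<open>The universe of a structure is the whole (arbitrary) type \<open>'a\<close>; interpretations of names at
  arities outside the language are irrelevant.\<close>

record ('f, 'r, 'a) struct =
  fun_interp :: "'f \<Rightarrow> 'a list \<Rightarrow> 'a"
  rel_interp :: "'r \<Rightarrow> 'a list \<Rightarrow> bool"

primrec eval_tm :: "('f, 'r, 'a) struct \<Rightarrow> 'a list \<Rightarrow> 'f tm \<Rightarrow> 'a" where
  "eval_tm M vs (Var i) = vs ! i"
| "eval_tm M vs (Fn f ts) = fun_interp M f (map (eval_tm M vs) ts)"

primrec sat :: "('f, 'r, 'a) struct \<Rightarrow> 'a list \<Rightarrow> ('f, 'r) fm \<Rightarrow> bool" where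
  "sat M vs (Eq s t) \<longleftrightarrow> eval_tm M vs s = eval_tm M vs t"
| "sat M vs (Rl r ts) \<longleftrightarrow> rel_interp M r (map (eval_tm M vs) ts)"
| "sat M vs (Neg \<phi>) \<longleftrightarrow> \<not> sat M vs \<phi>"
| "sat M vs (And \<phi> \<psi>) \<longleftrightarrow> sat M vs \<phi> \<and> sat M vs \<psi>"
| "sat M vs (Ex \<phi>) \<longleftrightarrow> (\<exists>a. sat M (a # vs) \<phi>)"

abbreviation is_sentence :: "('f, 'r) language \<Rightarrow> ('f, 'r) fm \<Rightarrow> bool" where
  "is_sentence L \<sigma> \<equiv> is_formula L 0 \<sigma>"

definition models :: "('f, 'r, 'a) struct \<Rightarrow> ('f, 'r) fm set \<Rightarrow> bool" where
  "models M T \<longleftrightarrow> (\<forall>\<sigma>\<in>T. sat M [] \<sigma>)"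

text \<open>Complete theories are identified with their deductive closure; consistency is supplied by
  the presence of a model.\<close>

definition complete_theory :: "('f, 'r) language \<Rightarrow> ('f, 'r) fm set \<Rightarrow> bool" where
  "complete_theory L T \<longleftrightarrow>
     (\<forall>\<sigma>\<in>T. is_sentence L \<sigma>) \<and> (\<forall>\<sigma>. is_sentence L \<sigma> \<longrightarrow> \<sigma> \<in> T \<or> Neg \<sigma> \<in> T)"


section \<open>Types and monster models\<close>

text \<open>A formula with parameters \<open>\<phi>(x, ps)\<close> in the variables \<open>x = (x\<^sub>0, \<dots>, x\<^sub>n\<^sub>-\<^sub>1)\<close> is the pair
  \<open>(\<phi>, ps)\<close>, the tuple \<open>ps\<close> being substituted for the variables after the first \<open>n\<close>.\<close>

definition pformulas ::
  "('f, 'r) language \<Rightarrow> nat \<Rightarrow> 'a set \<Rightarrow> (('f, 'r) fm \<times> 'a list) set" where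
  "pformulas L n A = {(\<phi>, ps). set ps \<subseteq> A \<and> is_formula L (n + length ps) \<phi>}"

definition solutions :: "('f, 'r, 'a) struct \<Rightarrow> nat \<Rightarrow> ('f, 'r) fm \<Rightarrow> 'a list \<Rightarrow> 'a list set" where
  "solutions M n \<phi> ps = {xs. length xs = n \<and> sat M (xs @ ps) \<phi>}"

text \<open>A set of formulas in \<open>n\<close> variables over \<open>M\<close> is consistent (with the elementary diagram of
  \<open>M\<close>) if it is finitely satisfiable in \<open>M\<close>. If \<open>M\<close> is a monster model, then for sets of formulas
  over a small set this means having a common solution in \<open>M\<close>.\<close>

definition consistent ::
  "('f, 'r, 'a) struct \<Rightarrow> nat \<Rightarrow> (('f, 'r) fm \<times> 'a list) set \<Rightarrow> bool" where
  "consistent M n P \<longleftrightarrow>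
     (\<forall>F\<subseteq>P. finite F \<longrightarrow> (\<exists>xs. length xs = n \<and> (\<forall>(\<phi>, ps)\<in>F. xs \<in> solutions M n \<phi> ps)))"

definition same_type ::
  "('f, 'r) language \<Rightarrow> ('f, 'r, 'a) struct \<Rightarrow> 'a set \<Rightarrow> 'a list \<Rightarrow> 'a list \<Rightarrow> bool" where
  "same_type L M A us vs \<longleftrightarrow>
     length us = length vs \<and>
     (\<forall>(\<phi>, ps)\<in>pformulas L (length us) A. sat M (us @ ps) \<phi> \<longleftrightarrow> sat M (vs @ ps) \<phi>)"

definition saturated ::
  "('f, 'r) language \<Rightarrow> ('f, 'r, 'a) struct \<Rightarrow> 'k rel \<Rightarrow> bool" where
  "saturated L M \<kappa> \<longleftrightarrow>
     (\<forall>A P. |A| <o \<kappa> \<longrightarrow> P \<subseteq> pformulas L 1 A \<longrightarrow> consistent M 1 P \<longrightarrow>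
        (\<exists>x. \<forall>(\<phi>, ps)\<in>P. [x] \<in> solutions M 1 \<phi> ps))"

definition automorphism ::
  "('f, 'r) language \<Rightarrow> ('f, 'r, 'a) struct \<Rightarrow> ('a \<Rightarrow> 'a) \<Rightarrow> bool" where
  "automorphism L M h \<longleftrightarrow>
     bij h \<and>
     (\<forall>f vs. (f, length vs) \<in> fun_syms L \<longrightarrow> h (fun_interp M f vs) = fun_interp M f (map h vs)) \<and>
     (\<forall>r vs. (r, length vs) \<in> rel_syms L \<longrightarrow> rel_interp M r vs = rel_interp M r (map h vs))"

definition elementary_on ::
  "('f, 'r) language \<Rightarrow> ('f, 'r, 'a) struct \<Rightarrow> 'a set \<Rightarrow> ('a \<Rightarrow> 'a) \<Rightarrow> bool" where
  "elementary_on L M A h \<longleftrightarrow>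
     (\<forall>vs \<phi>. set vs \<subseteq> A \<longrightarrow> is_formula L (length vs) \<phi> \<longrightarrow> sat M vs \<phi> = sat M (map h vs) \<phi>)"

definition strongly_homogeneous ::
  "('f, 'r) language \<Rightarrow> ('f, 'r, 'a) struct \<Rightarrow> 'k rel \<Rightarrow> bool" where
  "strongly_homogeneous L M \<kappa> \<longleftrightarrow>
     (\<forall>A h. |A| <o \<kappa> \<longrightarrow> elementary_on L M A h \<longrightarrow>
        (\<exists>g. automorphism L M g \<and> (\<forall>a\<in>A. g a = h a)))"

text \<open>\<open>\<kappa>\<close> is the cardinal below which sets count as small. It exceeds the number of
  \<open>L\<close>-formulas, so it is uncountable.\<close>

definition monster_model ::
  "('f, 'r) language \<Rightarrow> ('f, 'r) fm set \<Rightarrow> 'k rel \<Rightarrow> ('f, 'r, 'a) struct \<Rightarrow> bool" where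
  "monster_model L T \<kappa> M \<longleftrightarrow>
     models M T \<and> Card_order \<kappa> \<and> |{\<phi>. \<exists>k. is_formula L k \<phi>}| <o \<kappa> \<and>
     saturated L M \<kappa> \<and> strongly_homogeneous L M \<kappa>"


section \<open>Strong-squared theories\<close>

definition indiscernible ::
  "('f, 'r) language \<Rightarrow> ('f, 'r, 'a) struct \<Rightarrow> 'a set \<Rightarrow> (nat \<Rightarrow> 'a list) \<Rightarrow> bool" where
  "indiscernible L M A a \<longleftrightarrow>
     (\<forall>is js. sorted_wrt (<) is \<longrightarrow> sorted_wrt (<) js \<longrightarrow> length is = length js \<longrightarrow>
        same_type L M A (concat (map a is)) (concat (map a js)))"

definition mutually_indiscernible ::
  "('f, 'r) language \<Rightarrow> ('f, 'r, 'a) struct \<Rightarrow> ('k \<Rightarrow> nat \<Rightarrow> 'a list) \<Rightarrow> bool" where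
  "mutually_indiscernible L M a \<longleftrightarrow>
     (\<forall>\<alpha>. indiscernible L M (\<Union>\<beta>\<in>- {\<alpha>}. \<Union>i. set (a \<beta> i)) (a \<alpha>))"

text \<open>Patterns in an \<open>n\<close>-tuple of variables \<open>x\<close>. The rows are indexed by a well-ordered type, which
  represents the depth; depth \<open>\<aleph>\<^sub>0\<close> is the index type \<^typ>\<open>nat\<close>. In \<open>\<phi> \<alpha>\<close> the variables are ordered
  as \<open>x\<close>, \<open>y\<^sub>\<alpha>\<close>, \<open>z\<^sub>\<alpha>\<close>. The inclusion for \<open>b \<alpha>\<close> is one of sets of entries of tuples.\<close>

definition inp2_pattern ::
  "('f, 'r) language \<Rightarrow> ('f, 'r, 'a) struct \<Rightarrow> nat \<Rightarrow>
   ('k::wellorder \<Rightarrow> nat \<Rightarrow> 'a list) \<Rightarrow> ('k \<Rightarrow> 'a list) \<Rightarrow> ('k \<Rightarrow> ('f, 'r) fm) \<Rightarrow> bool" where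
  "inp2_pattern L M n a b \<phi> \<longleftrightarrow>
     (\<forall>\<alpha>. is_formula L (n + length (a \<alpha> 0) + length (b \<alpha>)) (\<phi> \<alpha>)) \<and>
     (\<forall>\<alpha>. set (b \<alpha>) \<subseteq> (\<Union>\<beta>\<in>{..<\<alpha>}. \<Union>i. set (a \<beta> i))) \<and>
     mutually_indiscernible L M a \<and>
     (\<forall>\<alpha>. \<not> consistent M n (range (\<lambda>i. (\<phi> \<alpha>, a \<alpha> i @ b \<alpha>)))) \<and>
     consistent M n (range (\<lambda>\<alpha>. (\<phi> \<alpha>, a \<alpha> 0 @ b \<alpha>)))"

text \<open>Strength of the theory of \<open>M\<close>, for \<open>M\<close> a monster model: as usual, patterns are sought in the
  monster model.\<close>

definition strong2 :: "('f, 'r) language \<Rightarrow> ('f, 'r, 'a) struct \<Rightarrow> bool" where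
  "strong2 L M \<longleftrightarrow>
     \<not> (\<exists>(a :: nat \<Rightarrow> nat \<Rightarrow> 'a list) b \<phi>. inp2_pattern L M 1 a b \<phi>)"


section \<open>Definable groups\<close>

text \<open>Definable means definable with parameters.\<close>

definition definable ::
  "('f, 'r) language \<Rightarrow> ('f, 'r, 'a) struct \<Rightarrow> nat \<Rightarrow> 'a list set \<Rightarrow> bool" where
  "definable L M n X \<longleftrightarrow> (\<exists>(\<phi>, ps)\<in>pformulas L n UNIV. X = solutions M n \<phi> ps)"

definition definable_group ::
  "('f, 'r) language \<Rightarrow> ('f, 'r, 'a) struct \<Rightarrow> nat \<Rightarrow> 'a list monoid \<Rightarrow> bool" where
  "definable_group L M n G \<longleftrightarrow>
     group G \<and> definable L M n (carrier G) \<and>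
     definable L M (n + n + n)
       {x @ y @ (x \<otimes>\<^bsub>G\<^esub> y) | x y. x \<in> carrier G \<and> y \<in> carrier G}"

text \<open>The intersection of a family of subgroups of \<open>G\<close>, that of the empty family being \<open>G\<close>.\<close>

definition inter_in :: "'g monoid \<Rightarrow> ('i \<Rightarrow> 'g set) \<Rightarrow> 'i set \<Rightarrow> 'g set" where
  "inter_in G H I = carrier G \<inter> (\<Inter>i\<in>I. H i)"

text \<open>\<open>[H : K] < \<infinity>\<close>, for subgroups \<open>K \<subseteq> H\<close> of \<open>G\<close>.\<close>

definition finite_index :: "'g monoid \<Rightarrow> 'g set \<Rightarrow> 'g set \<Rightarrow> bool" where
  "finite_index G H K \<longleftrightarrow> finite (rcosets\<^bsub>G\<lparr>carrier := H\<rparr>\<^esub> K)"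

end

theory Submission
  imports Defs "HOL-Library.Countable_Set" "HOL-Library.Product_Lexorder"
begin

text \<open>
  Suppose no bound \<open>k\<close> works. Irredundant finite subfamilies give arbitrarily many subgroups \<open>H\<^sub>\<alpha>\<close>
  and, for each \<open>\<alpha>\<close>, elements \<open>c\<^sub>\<alpha>\<^sub>,\<^sub>i\<close> of all \<open>H\<^sub>\<beta>\<close> with \<open>\<beta> \<noteq> \<alpha>\<close> that lie in distinct right cosets of
  \<open>H\<^sub>\<alpha>\<close>. For every choice \<open>\<eta>\<close> of columns, the product \<open>\<cdots> c\<^sub>1\<^sub>,\<^sub>\<eta>\<^sub>1 c\<^sub>0\<^sub>,\<^sub>\<eta>\<^sub>0\<close> lies in the cosets
  \<open>H\<^sub>\<alpha> c\<^sub>\<alpha>\<^sub>,\<^sub>\<eta>\<^sub>\<alpha> \<cdots> c\<^sub>0\<^sub>,\<^sub>\<eta>\<^sub>0\<close>, while two such cosets differing only in the factor \<open>c\<^sub>\<alpha>\<^sub>,\<^sub>i\<close> are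
  disjoint. By compactness and extraction of mutually indiscernible rows this is an
  \<open>inp\<^sup>2\<close>-pattern of depth \<open>\<aleph>\<^sub>0\<close>, but in the \<open>n\<close> variables of the group.

  To reach a single variable, let \<open>d\<close> realise the first column and consider one coordinate \<open>x\<close>
  of \<open>d\<close>. Call \<open>x\<close> movable above \<open>N\<close> if some \<open>y\<close> has, together with every choice of columns in the
  rows from \<open>N\<close> on, the type that \<open>x\<close> has with the first column, over all rows below \<open>N\<close>. If a
  conjugate of \<open>x\<close> is movable, then the rows from \<open>N\<close> on can be replaced by rows that are mutually
  indiscernible over \<open>y\<close>, and the pattern survives in the remaining coordinates with \<open>y\<close> as a
  parameter. If none is, each failure is due to one row and one formula with parameters in
  finitely many other rows. Collecting such rows one after the other, and treating the rows
  skipped as constants, produces a pattern in the single variable \<open>x\<close>. Induction on the number of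
  coordinates not yet fixed ends with a pattern in no variables, which is absurd.
\<close>

subsection \<open>Renaming variables\<close>

primrec ren_tm :: "(nat \<Rightarrow> nat) \<Rightarrow> 'f tm \<Rightarrow> 'f tm" where
  "ren_tm r (Var i) = Var (r i)"
| "ren_tm r (Fn f ts) = Fn f (map (ren_tm r) ts)"

primrec ren_fm :: "(nat \<Rightarrow> nat) \<Rightarrow> ('f, 'r) fm \<Rightarrow> ('f, 'r) fm" where
  "ren_fm r (Eq s t) = Eq (ren_tm r s) (ren_tm r t)"
| "ren_fm r (Rl R ts) = Rl R (map (ren_tm r) ts)"
| "ren_fm r (Neg \<phi>) = Neg (ren_fm r \<phi>)"
| "ren_fm r (And \<phi> \<psi>) = And (ren_fm r \<phi>) (ren_fm r \<psi>)"
| "ren_fm r (Ex \<phi>) = Ex (ren_fm (case_nat 0 (Suc \<circ> r)) \<phi>)"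

lemma is_term_ren_tm:
  "is_term L k t \<Longrightarrow> (\<And>i. i < k \<Longrightarrow> r i < k') \<Longrightarrow> is_term L k' (ren_tm r t)"
  by (induction t) (auto simp: list_all_iff)

lemma is_formula_ren_fm:
  "is_formula L k \<phi> \<Longrightarrow> (\<And>i. i < k \<Longrightarrow> r i < k') \<Longrightarrow> is_formula L k' (ren_fm r \<phi>)"
proof (induction \<phi> arbitrary: k k' r)
  case (Eq s t)
  then show ?case by (auto intro: is_term_ren_tm)
next
  case (Rl R ts)
  then show ?case by (auto simp: list_all_iff intro: is_term_ren_tm)
next
  case (Ex \<phi>)
  have "is_formula L (Suc k') (ren_fm (case_nat 0 (Suc \<circ> r)) \<phi>)"
    by (rule Ex.IH[of "Suc k"]) (use Ex.prems in \<open>auto split: nat.split\<close>)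
  then show ?case by simp
qed auto

lemma eval_ren_tm:
  "is_term L k t \<Longrightarrow> (\<And>i. i < k \<Longrightarrow> vs' ! i = vs ! r i) \<Longrightarrow>
    eval_tm M vs (ren_tm r t) = eval_tm M vs' t"
  by (induction t) (auto simp: list_all_iff intro!: arg_cong[where f = "fun_interp M _"])

lemma sat_ren_fm:
  "is_formula L k \<phi> \<Longrightarrow> (\<And>i. i < k \<Longrightarrow> vs' ! i = vs ! r i) \<Longrightarrow>
    sat M vs (ren_fm r \<phi>) = sat M vs' \<phi>"
proof (induction \<phi> arbitrary: k r vs vs')
  case (Eq s t)
  then show ?case using eval_ren_tm[of L k _ vs' vs r M] by simp
next
  case (Rl R ts)
  then have "map (eval_tm M vs \<circ> ren_tm r) ts = map (eval_tm M vs') ts"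
    by (auto simp: list_all_iff intro: eval_ren_tm)
  then show ?case by (simp only: ren_fm.simps sat.simps map_map)
next
  case (Neg \<phi>)
  from Neg.IH[of k vs' vs r] Neg.prems show ?case by simp
next
  case (And \<phi> \<psi>)
  from And.IH(1)[of k vs' vs r] And.IH(2)[of k vs' vs r] And.prems show ?case by simp
next
  case (Ex \<phi>)
  have "sat M (a # vs) (ren_fm (case_nat 0 (Suc \<circ> r)) \<phi>) = sat M (a # vs') \<phi>" for a
    by (rule Ex.IH[of "Suc k"]) (use Ex.prems in \<open>auto split: nat.split\<close>)
  then show ?case by simp
qed

text \<open>The entries are formal labels, not values: every label of \<open>ws\<close> occurs in
  \<open>vs\<close>, so renaming positions gives one formula that works for all assignments
  \<open>h\<close>.\<close>

lemma ex_formula_select: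
  assumes "is_formula L (length ws) \<phi>" and "set ws \<subseteq> set vs"
  obtains \<phi>' where "is_formula L (length vs) \<phi>'"
    and "\<forall>h. sat M (map h vs) \<phi>' = sat M (map h ws) \<phi>"
proof -
  have "\<exists>j < length vs. vs ! j = ws ! i" if "i < length ws" for i
    using assms(2) that by (metis in_set_conv_nth nth_mem subsetD)
  then obtain r where r: "\<And>i. i < length ws \<Longrightarrow> r i < length vs \<and> vs ! r i = ws ! i"
    by metis
  show ?thesis
  proof (rule that[of "ren_fm r \<phi>"])
    show "is_formula L (length vs) (ren_fm r \<phi>)"
      using assms(1) r by (blast intro: is_formula_ren_fm)
    show "\<forall>h. sat M (map h vs) (ren_fm r \<phi>) = sat M (map h ws) \<phi>"
      by (intro allI sat_ren_fm[OF assms(1)]) (use r in auto)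
  qed
qed


subsection \<open>Definable conditions on assignments\<close>

text \<open>Model theory is done with predicates on assignments \<open>'v \<Rightarrow> 'a\<close> instead of formulas:
  the index type \<open>'v\<close> can be chosen to suit the configuration at hand.
  A variable of a formula is either assigned (\<open>Inl v\<close>) or a parameter (\<open>Inr b\<close>).\<close>

locale fo_structure =
  fixes L :: "('f, 'r) language" and M :: "('f, 'r, 'a) struct"
begin

definition Def :: "'a set \<Rightarrow> (('v \<Rightarrow> 'a) \<Rightarrow> bool) \<Rightarrow> bool" where
  "Def B P \<longleftrightarrow> (\<exists>ws \<phi>. (\<forall>c. Inr c \<in> set ws \<longrightarrow> c \<in> B) \<and> is_formula L (length ws) \<phi> \<and>
     P = (\<lambda>e. sat M (map (case_sum e id) ws) \<phi>))"

lemma DefI: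
  "(\<And>c. Inr c \<in> set ws \<Longrightarrow> c \<in> B) \<Longrightarrow> is_formula L (length ws) \<phi> \<Longrightarrow>
    (\<And>e. P e = sat M (map (case_sum e id) ws) \<phi>) \<Longrightarrow> Def B P"
  unfolding Def_def by blast

lemma DefE:
  assumes "Def B P"
  obtains ws \<phi> where "\<forall>c. Inr c \<in> set ws \<longrightarrow> c \<in> B" "is_formula L (length ws) \<phi>"
    "P = (\<lambda>e. sat M (map (case_sum e id) ws) \<phi>)"
  using assms unfolding Def_def by blast

text \<open>The map \<open>g\<close> turns each variable into another variable or a parameter, which
  the underlying list of labels absorbs. Reindexing, fixing variables and enlarging \<open>B\<close>
  are all instances.\<close>

lemma Def_subst:
  assumes "Def B P" and "B \<subseteq> C" and "\<And>w c. g w = Inr c \<Longrightarrow> c \<in> C"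
  shows "Def C (\<lambda>e. P (\<lambda>w. case_sum e id (g w)))"
proof -
  from assms(1) obtain ws \<phi> where ws: "\<forall>c. Inr c \<in> set ws \<longrightarrow> c \<in> B" "is_formula L (length ws) \<phi>"
    "P = (\<lambda>e. sat M (map (case_sum e id) ws) \<phi>)" by (rule DefE)
  show ?thesis
  proof (rule DefI)
    show "c \<in> C" if "Inr c \<in> set (map (case_sum g Inr) ws)" for c
    proof -
      from that obtain w where w: "w \<in> set ws" "case_sum g Inr w = Inr c" by auto
      show ?thesis by (cases w) (use w ws(1) assms(2,3) in auto)
    qed
    show "is_formula L (length (map (case_sum g Inr) ws)) \<phi>" using ws(2) by simp
    have "map (case_sum (\<lambda>w. case_sum e id (g w)) id) ws
      = map (case_sum e id) (map (case_sum g Inr) ws)" for e :: "'c \<Rightarrow> 'a"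
      by (auto split: sum.splits)
    then show "P (\<lambda>w. case_sum e id (g w)) = sat M (map (case_sum e id) (map (case_sum g Inr) ws)) \<phi>"
      for e :: "'c \<Rightarrow> 'a" unfolding ws(3) by (simp only:)
  qed
qed

lemma Def_mono: "Def B P \<Longrightarrow> B \<subseteq> C \<Longrightarrow> Def C P"
  using Def_subst[of B P C Inl] by simp

lemma Def_reindex: "Def B P \<Longrightarrow> Def B (\<lambda>e. P (\<lambda>w. e (g w)))"
  using Def_subst[of B P B "Inl \<circ> g"] by simp

lemma Def_fixed_left:
  fixes P :: "('v + 'w \<Rightarrow> 'a) \<Rightarrow> bool"
  assumes *: "Def B P" "B \<subseteq> C" "range u \<subseteq> C"
  shows "Def C (\<lambda>e. P (case_sum u e))"
proof -
  have "Def C (\<lambda>e. P (\<lambda>w. case_sum e id (case_sum (Inr \<circ> u) Inl w)))"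
    by (rule Def_subst[OF *(1,2)]) (use *(3) in \<open>auto split: sum.splits\<close>)
  moreover have "(\<lambda>w. case_sum e id (case_sum (Inr \<circ> u) Inl w)) = case_sum u e" for e :: "'w \<Rightarrow> 'a"
    by (auto split: sum.splits)
  ultimately show ?thesis by (simp only:)
qed

lemma Def_fixed_right:
  fixes P :: "('v + 'w \<Rightarrow> 'a) \<Rightarrow> bool"
  assumes *: "Def B P" "B \<subseteq> C" "range u \<subseteq> C"
  shows "Def C (\<lambda>e. P (case_sum e u))"
proof -
  have "Def C (\<lambda>e. P (\<lambda>w. case_sum e id (case_sum Inl (Inr \<circ> u) w)))"
    by (rule Def_subst[OF *(1,2)]) (use *(3) in \<open>auto split: sum.splits\<close>)
  moreover have "(\<lambda>w. case_sum e id (case_sum Inl (Inr \<circ> u) w)) = case_sum e u" for e :: "'v \<Rightarrow> 'a"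
    by (auto split: sum.splits)
  ultimately show ?thesis by (simp only:)
qed

text \<open>Inverse to fixing variables: each parameter of \<open>C\<close> outside \<open>B\<close>
  is replaced by a variable \<open>Inr (s c)\<close> with \<open>u (s c) = c\<close>. The last
  clause records that values outside \<open>W\<close> are not read and may be chosen at
  will.\<close>

lemma Def_abstract:
  fixes P :: "('v \<Rightarrow> 'a) \<Rightarrow> bool" and u :: "'w \<Rightarrow> 'a"
  assumes "Def (B \<union> C) P" and "C \<subseteq> u ` W"
  shows "\<exists>P'. Def B P' \<and> (\<forall>e u'. (\<forall>w\<in>W. u' w = u w) \<longrightarrow> P' (case_sum e u') = P e) \<and>
    (\<forall>e u1 u2. (\<forall>w\<in>W. u1 w = u2 w) \<longrightarrow> P' (case_sum e u1) = P' (case_sum e u2))"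
proof -
  from assms(1) obtain ws \<phi> where ws: "\<forall>c. Inr c \<in> set ws \<longrightarrow> c \<in> B \<union> C" "is_formula L (length ws) \<phi>"
    "P = (\<lambda>e. sat M (map (case_sum e id) ws) \<phi>)" by (rule DefE)
  have "\<forall>c\<in>C. \<exists>w\<in>W. u w = c" using assms(2) by blast
  then obtain s where s: "\<And>c. c \<in> C \<Longrightarrow> s c \<in> W \<and> u (s c) = c" by metis
  define t :: "'v + 'a \<Rightarrow> ('v + 'w) + 'a" where "t = case_sum (\<lambda>v. Inl (Inl v)) (\<lambda>c. if c \<in> B then Inr c else Inl (Inr (s c)))"
  let ?P' = "\<lambda>e. sat M (map (case_sum e id) (map t ws)) \<phi>"
  show ?thesis
  proof (intro exI[of _ ?P'] conjI allI impI)
    show "Def B ?P'"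
      by (rule DefI[OF _ _ refl]) (use ws in \<open>auto simp: t_def split: sum.splits if_splits\<close>)
    show "?P' (case_sum e u') = P e" if "\<forall>w\<in>W. u' w = u w" for e :: "'v \<Rightarrow> 'a" and u'
    proof -
      have "map (case_sum (case_sum e u') id) (map t ws) = map (case_sum e id) ws"
        using ws(1) s that by (auto simp: t_def split: sum.splits)
      then show ?thesis by (simp only: ws(3))
    qed
    show "?P' (case_sum e u1) = ?P' (case_sum e u2)" if "\<forall>w\<in>W. u1 w = u2 w"
      for e :: "'v \<Rightarrow> 'a" and u1 u2
    proof -
      have "map (case_sum (case_sum e u1) id) (map t ws) = map (case_sum (case_sum e u2) id) (map t ws)"
        using ws(1) s that by (auto simp: t_def split: sum.splits)
      then show ?thesis by (simp only:)
    qed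
  qed
qed

text \<open>The way back to formulas. Order and repetition of variables and parameters can be
  prescribed as long as the finitely many needed ones occur, so the result fits the shape demanded
  by \<open>pformulas\<close> and \<open>inp2_pattern\<close>.\<close>

lemma Def_formula:
  assumes "Def B P"
  shows "\<exists>V C. finite V \<and> finite C \<and> C \<subseteq> B \<and> (\<forall>vs ps. V \<subseteq> set vs \<longrightarrow> C \<subseteq> set ps \<longrightarrow>
    (\<exists>\<phi>. is_formula L (length vs + length ps) \<phi> \<and> (\<forall>e. P e \<longleftrightarrow> sat M (map e vs @ ps) \<phi>)))"
proof -
  from assms obtain ws \<phi> where ws: "\<forall>c. Inr c \<in> set ws \<longrightarrow> c \<in> B" "is_formula L (length ws) \<phi>"
    "P = (\<lambda>e. sat M (map (case_sum e id) ws) \<phi>)" by (rule DefE)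
  show ?thesis
  proof (intro exI[of _ "{v. Inl v \<in> set ws}"] exI[of _ "{c. Inr c \<in> set ws}"] conjI allI impI)
    show "finite {v. Inl v \<in> set ws}" "finite {c. Inr c \<in> set ws}"
      using finite_vimageI[of "set ws" Inl] finite_vimageI[of "set ws" Inr] by (simp_all add: vimage_def)
    show "{c. Inr c \<in> set ws} \<subseteq> B" using ws(1) by auto
    fix vs ps assume sub: "{v. Inl v \<in> set ws} \<subseteq> set vs" "{c. Inr c \<in> set ws} \<subseteq> set ps"
    let ?vs = "map Inl vs @ map Inr ps"
    have "set ws \<subseteq> set ?vs"
    proof
      fix w assume w: "w \<in> set ws"
      show "w \<in> set ?vs" by (cases w) (use w sub in auto)
    qed
    then obtain \<phi>' where \<phi>': "is_formula L (length ?vs) \<phi>'"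
      "\<forall>h. sat M (map h ?vs) \<phi>' = sat M (map h ws) \<phi>"
      by (rule ex_formula_select[OF ws(2)])
    have "P e \<longleftrightarrow> sat M (map e vs @ ps) \<phi>'" for e
      using spec[OF \<phi>'(2), of "case_sum e id"] by (simp add: ws(3) comp_def)
    then show "\<exists>\<phi>. is_formula L (length vs + length ps) \<phi> \<and> (\<forall>e. P e \<longleftrightarrow> sat M (map e vs @ ps) \<phi>)"
      using \<phi>'(1) by auto
  qed
qed

lemma Def_sat:
  "is_formula L (length vs + length ps) \<phi> \<Longrightarrow> set ps \<subseteq> B \<Longrightarrow> Def B (\<lambda>e. sat M (map e vs @ ps) \<phi>)"
  by (rule DefI[of "map Inl vs @ map Inr ps"]) (auto simp: comp_def)

definition depends :: "'v set \<Rightarrow> (('v \<Rightarrow> 'a) \<Rightarrow> bool) \<Rightarrow> bool" where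
  "depends V P \<longleftrightarrow> (\<forall>e e'. (\<forall>v\<in>V. e v = e' v) \<longrightarrow> P e = P e')"

lemma dependsD: "depends V P \<Longrightarrow> (\<And>v. v \<in> V \<Longrightarrow> e v = e' v) \<Longrightarrow> P e = P e'"
  by (auto simp: depends_def)

lemma Def_depends:
  assumes "Def B P"
  obtains V where "finite V" "depends V P"
proof -
  from assms obtain ws \<phi> where ws: "\<forall>c. Inr c \<in> set ws \<longrightarrow> c \<in> B" "is_formula L (length ws) \<phi>"
    "P = (\<lambda>e. sat M (map (case_sum e id) ws) \<phi>)" by (rule DefE)
  have "P e = P e'" if "\<forall>v\<in>{v. Inl v \<in> set ws}. e v = e' v" for e e'
  proof -
    have "map (case_sum e id) ws = map (case_sum e' id) ws"
      using that by (auto split: sum.splits)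
    then show ?thesis by (simp only: ws(3))
  qed
  moreover have "finite {v. Inl v \<in> set ws}"
    using finite_vimageI[of "set ws" Inl] by (simp add: vimage_def)
  ultimately show ?thesis using that by (auto simp: depends_def)
qed

section \<open>Closure of definable conditions under connectives and quantifiers\<close>

lemma Def_not:
  assumes "Def B P"
  shows "Def B (\<lambda>e. \<not> P e)"
proof -
  from assms obtain ws \<phi> where ws: "\<forall>c. Inr c \<in> set ws \<longrightarrow> c \<in> B" "is_formula L (length ws) \<phi>"
    "P = (\<lambda>e. sat M (map (case_sum e id) ws) \<phi>)" by (rule DefE)
  show ?thesis
    by (rule DefI[of ws _ "Neg \<phi>"]) (use ws in simp_all)
qed

lemma Def_and:
  assumes "Def B P" "Def B Q"
  shows "Def B (\<lambda>e. P e \<and> Q e)"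
proof -
  from assms(1) obtain ws \<phi> where ws: "\<forall>c. Inr c \<in> set ws \<longrightarrow> c \<in> B" "is_formula L (length ws) \<phi>"
    "P = (\<lambda>e. sat M (map (case_sum e id) ws) \<phi>)" by (rule DefE)
  from assms(2) obtain vs \<psi> where vs: "\<forall>c. Inr c \<in> set vs \<longrightarrow> c \<in> B" "is_formula L (length vs) \<psi>"
    "Q = (\<lambda>e. sat M (map (case_sum e id) vs) \<psi>)" by (rule DefE)
  obtain \<phi>' where \<phi>': "is_formula L (length (ws @ vs)) \<phi>'"
    "\<forall>h. sat M (map h (ws @ vs)) \<phi>' = sat M (map h ws) \<phi>"
    by (rule ex_formula_select[OF ws(2), of "ws @ vs" M]) simp
  obtain \<psi>' where \<psi>': "is_formula L (length (ws @ vs)) \<psi>'"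
    "\<forall>h. sat M (map h (ws @ vs)) \<psi>' = sat M (map h vs) \<psi>"
    by (rule ex_formula_select[OF vs(2), of "ws @ vs" M]) simp
  show ?thesis
    by (rule DefI[of "ws @ vs" _ "And \<phi>' \<psi>'"])
      (use ws(1) vs(1) \<phi>' \<psi>' in \<open>auto simp: ws(3) vs(3) simp del: map_append\<close>)
qed

lemma Def_eq: "Def B (\<lambda>e. e v = e w)"
  by (rule DefI[of "[Inl v, Inl w]" _ "Eq (Var 0) (Var 1)"]) auto

lemma Def_eq_const: "b \<in> B \<Longrightarrow> Def B (\<lambda>e. e v = b)"
  by (rule DefI[of "[Inl v, Inr b]" _ "Eq (Var 0) (Var 1)"]) auto

lemma Def_True: "Def B (\<lambda>_ :: 'v \<Rightarrow> 'a. True)"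
  using Def_eq[of B "undefined :: 'v" undefined] by simp

lemma Def_ball: "finite I \<Longrightarrow> (\<And>i. i \<in> I \<Longrightarrow> Def B (P i)) \<Longrightarrow> Def B (\<lambda>e. \<forall>i\<in>I. P i e)"
  by (induction I rule: finite_induct) (auto simp: Def_True intro: Def_and)

lemma Def_ex1:
  assumes "Def B P"
  shows "Def B (\<lambda>e. \<exists>a. P (e(x := a)))"
proof -
  from assms(1) obtain ws \<phi> where ws: "\<forall>c. Inr c \<in> set ws \<longrightarrow> c \<in> B" "is_formula L (length ws) \<phi>"
    "P = (\<lambda>e. sat M (map (case_sum e id) ws) \<phi>)" by (rule DefE)
  \<comment> \<open>Occurrences of \<open>x\<close> are sent to the quantified variable in front;
    every other label is shifted past it.\<close>
  define r where "r i = (if ws ! i = Inl x then 0 else Suc i)" for i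
  have "sat M (a # map (case_sum e id) ws) (ren_fm r \<phi>) = P (e(x := a))" for e a
    unfolding ws(3)
    by (rule sat_ren_fm[OF ws(2)]) (auto simp: r_def split: sum.splits)
  moreover have "is_formula L (Suc (length ws)) (ren_fm r \<phi>)"
    by (rule is_formula_ren_fm[OF ws(2)]) (auto simp: r_def)
  ultimately show ?thesis
    by (intro DefI[of ws _ "Ex (ren_fm r \<phi>)"]) (use ws(1) in auto)
qed

text \<open>If \<open>P\<close> depends on the finite set \<open>V\<close>, only the variables in
  \<open>V - U\<close> matter, and these are quantified one at a time.\<close>

lemma Def_ex_off:
  assumes "Def B P"
  shows "Def B (\<lambda>e. \<exists>e'. (\<forall>u\<in>U. e' u = e u) \<and> P e')"
proof -
  have fin: "Def B (\<lambda>e. \<exists>e'. (\<forall>u. u \<notin> X \<longrightarrow> e' u = e u) \<and> P e')" if "finite X" for X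
    using that
  proof (induction X rule: finite_induct)
    case empty
    have "(\<lambda>e. \<exists>e'. (\<forall>u. u \<notin> {} \<longrightarrow> e' u = e u) \<and> P e') = P"
      by (auto simp: fun_eq_iff) (metis ext)
    then show ?case using assms by simp
  next
    case (insert x X)
    have "(\<exists>e'. (\<forall>u. u \<notin> insert x X \<longrightarrow> e' u = e u) \<and> P e') \<longleftrightarrow>
      (\<exists>a e'. (\<forall>u. u \<notin> X \<longrightarrow> e' u = (e(x := a)) u) \<and> P e')" for e
    proof
      assume "\<exists>e'. (\<forall>u. u \<notin> insert x X \<longrightarrow> e' u = e u) \<and> P e'"
      then obtain e' where "\<forall>u. u \<notin> insert x X \<longrightarrow> e' u = e u" "P e'" by blast
      then show "\<exists>a e'. (\<forall>u. u \<notin> X \<longrightarrow> e' u = (e(x := a)) u) \<and> P e'"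
        by (intro exI[of _ "e' x"] exI[of _ e']) auto
    next
      assume "\<exists>a e'. (\<forall>u. u \<notin> X \<longrightarrow> e' u = (e(x := a)) u) \<and> P e'"
      then obtain a e' where "\<forall>u. u \<notin> X \<longrightarrow> e' u = (e(x := a)) u" "P e'" by blast
      then show "\<exists>e'. (\<forall>u. u \<notin> insert x X \<longrightarrow> e' u = e u) \<and> P e'"
        by (intro exI[of _ e']) auto
    qed
    with Def_ex1[OF insert.IH, of x] show ?case by simp
  qed
  obtain V where V: "finite V" "depends V P" using assms by (rule Def_depends)
  have "(\<exists>e'. (\<forall>u\<in>U. e' u = e u) \<and> P e') \<longleftrightarrow> (\<exists>e'. (\<forall>u. u \<notin> V - U \<longrightarrow> e' u = e u) \<and> P e')" for e
  proof
    assume "\<exists>e'. (\<forall>u\<in>U. e' u = e u) \<and> P e'"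
    then obtain e' where e': "\<forall>u\<in>U. e' u = e u" "P e'" by blast
    let ?e = "\<lambda>u. if u \<in> V - U then e' u else e u"
    have "P ?e = P e'" by (rule dependsD[OF V(2)]) (use e' in auto)
    then show "\<exists>e'. (\<forall>u. u \<notin> V - U \<longrightarrow> e' u = e u) \<and> P e'"
      using e' by (intro exI[of _ ?e]) auto
  qed blast
  then show ?thesis using fin[of "V - U"] V(1) by simp
qed

lemma Def_ex:
  fixes P :: "('v + 'w \<Rightarrow> 'a) \<Rightarrow> bool"
  assumes "Def B P"
  shows "Def B (\<lambda>e. \<exists>z. P (case_sum e z))"
proof -
  \<comment> \<open>\<open>case_sum id undefined\<close> reads the label \<open>Inl v\<close> as
    \<open>v\<close>; its value on \<open>Inr\<close> is immaterial, since only
    \<open>range Inl\<close> is kept fixed.\<close>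
  have "Def B (\<lambda>e. \<exists>e'. (\<forall>u\<in>range Inl. e' u = e (case_sum id undefined u)) \<and> P e')"
    by (rule Def_reindex[OF Def_ex_off[OF assms]])
  moreover have "(\<exists>e'. (\<forall>u\<in>range Inl. e' u = e (case_sum id undefined u)) \<and> P e') \<longleftrightarrow>
      (\<exists>z. P (case_sum e z))" for e :: "'v \<Rightarrow> 'a"
  proof
    assume "\<exists>e'. (\<forall>u\<in>range Inl. e' u = e (case_sum id undefined u)) \<and> P e'"
    then obtain e' where e': "\<forall>u\<in>range Inl. e' u = e (case_sum id undefined u)" "P e'" by blast
    have "case_sum e (e' \<circ> Inr) = e'" using e'(1) by (auto simp: fun_eq_iff split: sum.splits)
    then have "P (case_sum e (e' \<circ> Inr))" using e'(2) by (simp only:)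
    then show "\<exists>z. P (case_sum e z)" by (rule exI[where x = "e' \<circ> Inr"])
  next
    assume "\<exists>z. P (case_sum e z)"
    then obtain z where "P (case_sum e z)" by (elim exE)
    then show "\<exists>e'. (\<forall>u\<in>range Inl. e' u = e (case_sum id undefined u)) \<and> P e'"
      by (intro exI[where x = "case_sum e z"]) simp
  qed
  ultimately show ?thesis by simp
qed

section \<open>Equality of types over a set of parameters\<close>

definition eqv :: "'a set \<Rightarrow> ('v \<Rightarrow> 'a) \<Rightarrow> ('v \<Rightarrow> 'a) \<Rightarrow> bool" where
  "eqv B u v \<longleftrightarrow> (\<forall>P. Def B P \<longrightarrow> P u \<longrightarrow> P v)"

lemma eqvI: "(\<And>P. Def B P \<Longrightarrow> P u \<Longrightarrow> P v) \<Longrightarrow> eqv B u v"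
  unfolding eqv_def by (intro allI impI)

lemma eqvD: "eqv B u v \<Longrightarrow> Def B P \<Longrightarrow> P u \<Longrightarrow> P v"
  unfolding eqv_def by (drule spec[of _ P]) (drule mp, assumption, drule mp)

text \<open>Closure under negation turns the one-sided definition into an equivalence.\<close>

lemma eqv_iff: "eqv B u v \<Longrightarrow> Def B P \<Longrightarrow> P u \<longleftrightarrow> P v"
  using eqvD[of B u v P] eqvD[of B u v "\<lambda>e. \<not> P e"] Def_not[of B P] by argo

lemma eqv_refl: "eqv B u u"
  by (rule eqvI)

lemma eqv_sym: "eqv B u v \<Longrightarrow> eqv B v u"
  by (rule eqvI) (simp only: eqv_iff)

lemma eqv_trans:
  assumes "eqv B u v" "eqv B v w"
  shows "eqv B u w"
proof (rule eqvI)
  fix P assume "Def B P" "P u"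
  with assms show "P w" by (simp add: eqv_iff)
qed

lemma eqv_mono:
  assumes "eqv C u v" "B \<subseteq> C"
  shows "eqv B u v"
proof (rule eqvI)
  fix P assume P: "Def B P" "P u"
  show "P v" by (rule eqvD[OF assms(1) Def_mono[OF P(1) assms(2)] P(2)])
qed

lemma eqv_reindex:
  assumes "eqv B u v"
  shows "eqv B (\<lambda>w. u (g w)) (\<lambda>w. v (g w))"
proof (rule eqvI)
  fix P assume P: "Def B P" "P (\<lambda>w. u (g w))"
  show "P (\<lambda>w. v (g w))" by (rule eqvD[OF assms Def_reindex[OF P(1)] P(2)])
qed

end

subsection \<open>Realising types\<close>

locale countably_saturated = fo_structure L M
  for L :: "('f, 'r) language" and M :: "('f, 'r, 'a) struct" +
  assumes saturation: "countable A \<Longrightarrow> P \<subseteq> pformulas L 1 A \<Longrightarrow> consistent M 1 P \<Longrightarrow>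
    \<exists>x. \<forall>(\<phi>, ps)\<in>P. [x] \<in> solutions M 1 \<phi> ps"
begin

lemma realize_single:
  fixes \<P> :: "((unit \<Rightarrow> 'a) \<Rightarrow> bool) set"
  assumes "countable B" and "\<And>P. P \<in> \<P> \<Longrightarrow> Def B P"
    and fin: "\<And>F. finite F \<Longrightarrow> F \<subseteq> \<P> \<Longrightarrow> \<exists>a. \<forall>P\<in>F. P (\<lambda>_. a)"
  obtains a where "\<forall>P\<in>\<P>. P (\<lambda>_. a)"
proof -
  have "\<exists>q\<in>pformulas L 1 B. \<forall>x. P (\<lambda>_. x) \<longleftrightarrow> [x] \<in> solutions M 1 (fst q) (snd q)"
    if "P \<in> \<P>" for P
  proof -
    from assms(2)[OF that] obtain V C where VC: "finite V" "finite C" "C \<subseteq> B"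
      "\<forall>vs ps. V \<subseteq> set vs \<longrightarrow> C \<subseteq> set ps \<longrightarrow>
        (\<exists>\<phi>. is_formula L (length vs + length ps) \<phi> \<and> (\<forall>e. P e \<longleftrightarrow> sat M (map e vs @ ps) \<phi>))"
      by (elim Def_formula[THEN exE] exE conjE)
    obtain ps where ps: "set ps = C" using VC(2) finite_list by blast
    obtain \<phi> where "is_formula L (length [()] + length ps) \<phi>"
      "\<forall>e. P e \<longleftrightarrow> sat M (map e [()] @ ps) \<phi>"
      using VC(4)[rule_format, of "[()]" ps] ps by (auto simp: UNIV_unit[symmetric])
    then show ?thesis using ps VC(3)
      by (intro bexI[of _ "(\<phi>, ps)"]) (auto simp: pformulas_def solutions_def)
  qed
  then obtain f where f: "\<And>P. P \<in> \<P> \<Longrightarrow> f P \<in> pformulas L 1 B"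
    "\<And>P x. P \<in> \<P> \<Longrightarrow> P (\<lambda>_. x) \<longleftrightarrow> [x] \<in> solutions M 1 (fst (f P)) (snd (f P))"
    by metis
  have "consistent M 1 (f ` \<P>)"
    unfolding consistent_def
  proof (intro allI impI)
    fix F assume F: "F \<subseteq> f ` \<P>" "finite F"
    then obtain F' where F': "F' \<subseteq> \<P>" "finite F'" "F = f ` F'"
      using finite_subset_image by meson
    from fin[OF F'(2,1)] obtain a where "\<forall>P\<in>F'. P (\<lambda>_. a)" ..
    then have "\<forall>q\<in>F. [a] \<in> solutions M 1 (fst q) (snd q)"
      using f(2) F'(1) unfolding F'(3) by blast
    then show "\<exists>xs. length xs = 1 \<and> (\<forall>(\<phi>, ps)\<in>F. xs \<in> solutions M 1 \<phi> ps)"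
      by (intro exI[of _ "[a]"]) (auto simp: case_prod_beta)
  qed
  moreover have "f ` \<P> \<subseteq> pformulas L 1 B" using f(1) by blast
  ultimately obtain x where "\<forall>(\<phi>, ps)\<in>f ` \<P>. [x] \<in> solutions M 1 \<phi> ps"
    using saturation[OF assms(1)] by blast
  then have "P (\<lambda>_. x)" if "P \<in> \<P>" for P
    using f(2)[OF that, of x] that by (simp add: case_prod_beta)
  then show ?thesis by (intro that[of x] ballI)
qed

text \<open>The countably many variables receive their values one after the other, each by
  saturation in one variable over the values already chosen.\<close>

theorem realize:
  fixes \<P> :: "(('v::countable \<Rightarrow> 'a) \<Rightarrow> bool) set"
  assumes B: "countable B" and Def: "\<And>P. P \<in> \<P> \<Longrightarrow> Def B P"
    and fin: "\<And>F. finite F \<Longrightarrow> F \<subseteq> \<P> \<Longrightarrow> \<exists>e. \<forall>P\<in>F. P e"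
  obtains e where "\<forall>P\<in>\<P>. P e"
proof -
  \<comment> \<open>\<open>FS n e\<close>: the values of \<open>e\<close> at the first
    \<open>n\<close> variables extend to a solution of every finite part of \<open>\<P>\<close>; the
    other values of \<open>e\<close> do not count.\<close>
  define FS :: "nat \<Rightarrow> ('v \<Rightarrow> 'a) \<Rightarrow> bool" where "FS n e \<longleftrightarrow>
    (\<forall>F. finite F \<longrightarrow> F \<subseteq> \<P> \<longrightarrow> (\<exists>e'. (\<forall>v. to_nat v < n \<longrightarrow> e' v = e v) \<and> (\<forall>P\<in>F. P e')))" for n e
  have step: "\<exists>e1. FS (Suc n) e1 \<and> (\<forall>v. to_nat v < n \<longrightarrow> e1 v = e v)" if FS: "FS n e" for n e
  proof (cases "\<exists>v0 :: 'v. to_nat v0 = n")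
    case False
    then have "to_nat v < Suc n \<longleftrightarrow> to_nat v < n" for v :: 'v using less_Suc_eq by auto
    then have "FS (Suc n) e" using FS unfolding FS_def by simp
    then show ?thesis by blast
  next
    case True
    then obtain v0 :: 'v where v0: "to_nat v0 = n" by blast
    define U where "U = {v :: 'v. to_nat v < n}"
    have Suc_n: "to_nat v < Suc n \<longleftrightarrow> v \<in> insert v0 U" for v
      using v0 by (auto simp: U_def less_Suc_eq)
    have "v0 \<notin> U" using v0 by (simp add: U_def)
    \<comment> \<open>\<open>R F\<close> asks of a new value at \<open>v0\<close> that
      \<open>F\<close> remain solvable with the earlier values as parameters; there is one such
      condition for each finite \<open>F\<close>.\<close>
    define R where "R F = (\<lambda>x :: unit \<Rightarrow> 'a.
      \<exists>e'. (\<forall>v\<in>insert v0 U. e' v = (e(v0 := x ())) v) \<and> (\<forall>P\<in>F. P e'))" for F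
    have R_Def: "Def (B \<union> e ` U) (R F)" if "finite F" "F \<subseteq> \<P>" for F
    proof -
      define g where "g w = (if w \<in> U then Inr (e w) else Inl ())" for w
      have "Def B (\<lambda>E. \<forall>P\<in>F. P E)" using that Def by (intro Def_ball) auto
      then have "Def B (\<lambda>E. \<exists>e'. (\<forall>v\<in>insert v0 U. e' v = E v) \<and> (\<forall>P\<in>F. P e'))"
        by (rule Def_ex_off)
      then have "Def (B \<union> e ` U)
        (\<lambda>x. \<exists>e'. (\<forall>v\<in>insert v0 U. e' v = case_sum x id (g v)) \<and> (\<forall>P\<in>F. P e'))"
        by (rule Def_subst) (auto simp: g_def split: if_splits)
      moreover have "case_sum x id (g v) = (e(v0 := x ())) v" if "v \<in> insert v0 U" for x v
        using that \<open>v0 \<notin> U\<close> by (auto simp: g_def)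
      ultimately show ?thesis unfolding R_def by simp
    qed
    have R_fin: "\<exists>a. \<forall>Q\<in>G. Q (\<lambda>_. a)"
      if G: "finite G" "G \<subseteq> R ` {F. finite F \<and> F \<subseteq> \<P>}" for G
    proof -
      from finite_subset_image[OF G] obtain \<F> where
        \<F>: "finite \<F>" "\<F> \<subseteq> {F. finite F \<and> F \<subseteq> \<P>}" "G = R ` \<F>" by blast
      then have "finite (\<Union>\<F>)" "\<Union>\<F> \<subseteq> \<P>" by auto
      with FS obtain e' where e': "\<forall>v. to_nat v < n \<longrightarrow> e' v = e v" "\<forall>P\<in>\<Union>\<F>. P e'"
        unfolding FS_def by blast
      have "R F (\<lambda>_. e' v0)" if "F \<in> \<F>" for F
        unfolding R_def using e' that \<open>v0 \<notin> U\<close> by (intro exI[of _ e']) (auto simp: U_def)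
      then show ?thesis unfolding \<F>(3) by blast
    qed
    have "countable (B \<union> e ` U)" using B by simp
    moreover have "Def (B \<union> e ` U) Q" if "Q \<in> R ` {F. finite F \<and> F \<subseteq> \<P>}" for Q
      using that R_Def by (auto simp only: image_iff mem_Collect_eq)
    ultimately obtain a where a: "\<forall>Q\<in>R ` {F. finite F \<and> F \<subseteq> \<P>}. Q (\<lambda>_. a)"
      using R_fin by (rule realize_single)
    have "FS (Suc n) (e(v0 := a))"
      unfolding FS_def Suc_n
    proof (intro allI impI)
      fix F assume "finite F" "F \<subseteq> \<P>"
      with a have "R F (\<lambda>_. a)" by blast
      then show "\<exists>e'. (\<forall>v. v \<in> insert v0 U \<longrightarrow> e' v = (e(v0 := a)) v) \<and> (\<forall>P\<in>F. P e')"
        unfolding R_def Ball_def[of "insert v0 U"] .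
    qed
    moreover have "\<forall>v. to_nat v < n \<longrightarrow> (e(v0 := a)) v = e v" using v0 by auto
    ultimately show ?thesis by blast
  qed
  have "FS 0 undefined" using fin by (auto simp: FS_def)
  then obtain E where E: "\<And>n. FS n (E n)" "\<And>n v. to_nat v < n \<Longrightarrow> E (Suc n) v = E n v"
    using dependent_nat_choice[of FS "\<lambda>n e e1. \<forall>v. to_nat v < n \<longrightarrow> e1 v = e v"] step by metis
  have E_stable: "E (Suc (to_nat v) + k) v = E (Suc (to_nat v)) v" for v :: 'v and k
    by (induction k) (simp_all add: E(2))
  \<comment> \<open>The value at \<open>v\<close> is settled at stage \<open>Suc (to_nat v)\<close>
    and kept afterwards, so the diagonal agrees with \<open>E n\<close> on any given finite set of
    variables once \<open>n\<close> is large.\<close>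
  define e where "e v = E (Suc (to_nat v)) v" for v
  have "P e" if "P \<in> \<P>" for P
  proof -
    from Def[OF that] obtain V where V: "finite V" "depends V P" by (rule Def_depends)
    obtain n where n: "\<And>v. v \<in> V \<Longrightarrow> to_nat v < n"
      using finite_nat_set_iff_bounded[of "to_nat ` V"] V(1) by auto
    from E(1)[of n] that obtain e' where e': "\<forall>v. to_nat v < n \<longrightarrow> e' v = E n v" "P e'"
      unfolding FS_def by (metis empty_subsetI finite.emptyI finite.insertI insert_subset singletonI)
    have "e v = e' v" if "v \<in> V" for v
      using n[OF that] e'(1) E_stable[of v "n - Suc (to_nat v)"] by (simp add: e_def)
    then have "P e = P e'" by (rule dependsD[OF V(2)])
    with e'(2) show ?thesis by simp
  qed
  then show ?thesis by (intro that[of e] ballI)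
qed

text \<open>The type that \<open>w\<close> has over \<open>v\<close> is finitely satisfiable when
  read over \<open>u\<close>, because solvability of finitely many conditions is itself a condition
  shared by \<open>u\<close> and \<open>v\<close>.\<close>

lemma eqv_extend:
  fixes u v :: "'v::countable \<Rightarrow> 'a" and w :: "'w::countable \<Rightarrow> 'a"
  assumes "countable B" and "eqv B u v"
  obtains w' where "eqv B (case_sum u w') (case_sum v w)"
proof -
  let ?I = "{P. Def B P \<and> P (case_sum v w)}"
  let ?f = "\<lambda>P e. P (case_sum u e)"
  have "countable (B \<union> range u)" using assms(1) by simp
  then obtain w' where w': "\<forall>Q\<in>?f ` ?I. Q w'"
  proof (rule realize)
    fix Q assume "Q \<in> ?f ` ?I"
    then show "Def (B \<union> range u) Q" by (auto intro: Def_fixed_left)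
  next
    fix G assume G: "finite G" "G \<subseteq> ?f ` ?I"
    from finite_subset_image[OF G] obtain F where F: "F \<subseteq> ?I" "finite F" "G = ?f ` F" by blast
    have "Def B (\<lambda>e. \<forall>P\<in>F. P e)" using F by (intro Def_ball) auto
    then have "Def B (\<lambda>e. \<exists>z. \<forall>P\<in>F. P (case_sum e z))" by (rule Def_ex)
    from eqv_iff[OF assms(2) this]
    have "(\<exists>z. \<forall>P\<in>F. P (case_sum u z)) \<longleftrightarrow> (\<exists>z. \<forall>P\<in>F. P (case_sum v z))" .
    moreover have "\<forall>P\<in>F. P (case_sum v w)" using F(1) by auto
    then have "\<exists>z. \<forall>P\<in>F. P (case_sum v z)" by (intro exI[where x = w])
    ultimately have "\<exists>z. \<forall>P\<in>F. P (case_sum u z)" by (rule iffD2)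
    then show "\<exists>e. \<forall>Q\<in>G. Q e" unfolding F(3) by simp
  qed
  have "eqv B (case_sum v w) (case_sum u w')"
  proof (rule eqvI)
    fix P assume "Def B P" "P (case_sum v w)"
    then have "?f P \<in> ?f ` ?I" by (intro imageI CollectI conjI)
    from bspec[OF w' this] show "P (case_sum u w')" .
  qed
  then show ?thesis using that eqv_sym by blast
qed

end

subsection \<open>Indiscernible arrays from iterated ultrafilter limits\<close>

text \<open>Zorn's lemma is applied to the families all of whose finite intersections are
  infinite.\<close>

lemma ex_nonprincipal_ultrafilter:
  obtains U :: "nat set set" where
    "\<And>A. - A \<in> U \<longleftrightarrow> A \<notin> U" "\<And>A B. A \<in> U \<Longrightarrow> B \<in> U \<Longrightarrow> A \<inter> B \<in> U" "\<And>A. A \<in> U \<Longrightarrow> infinite A"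
proof -
  define good where "good = {F :: nat set set. \<forall>X. finite X \<longrightarrow> X \<subseteq> F \<longrightarrow> infinite (\<Inter>X)}"
  have "\<exists>U\<in>good. \<forall>F\<in>good. U \<subseteq> F \<longrightarrow> F = U"
  proof (rule subset_Zorn')
    fix \<C> assume \<C>: "subset.chain good \<C>"
    show "\<Union>\<C> \<in> good"
      unfolding good_def
    proof (intro CollectI allI impI)
      fix X assume X: "finite X" "X \<subseteq> \<Union>\<C>"
      show "infinite (\<Inter>X)"
      proof (cases "X = {}")
        case False
        then have "\<C> \<noteq> {}" using X(2) by auto
        then obtain F where "F \<in> \<C>" "X \<subseteq> F"
          using finite_subset_Union_chain[OF X _ \<C>] by blast
        with \<C> X(1) show ?thesis by (auto simp: subset.chain_def good_def)
      qed auto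
    qed
  qed
  then obtain U where U: "U \<in> good" "\<forall>F\<in>good. U \<subseteq> F \<longrightarrow> F = U" by (elim bexE)
  from U(1) have inf: "infinite (\<Inter>X)" if "finite X" "X \<subseteq> U" for X
    using that by (simp add: good_def)
  from U(2) have max: "F = U" if "F \<in> good" "U \<subseteq> F" for F
    using that by (simp only:)
  \<comment> \<open>By maximality a set outside \<open>U\<close> meets some finite intersection from
    \<open>U\<close> in a finite set. If this held for both \<open>A\<close> and \<open>- A\<close>,
    a finite intersection from \<open>U\<close> would itself be finite.\<close>
  have ex: "\<exists>X. finite X \<and> X \<subseteq> U \<and> finite (A \<inter> \<Inter>X)" if "A \<notin> U" for A
  proof -
    have "insert A U \<notin> good"
      using max[of "insert A U"] that by (metis insertI1 subset_insertI)
    then obtain X where X: "finite X" "X \<subseteq> insert A U" "finite (\<Inter>X)"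
      unfolding good_def mem_Collect_eq not_all not_imp not_not by (elim exE conjE)
    have "A \<inter> \<Inter>(X - {A}) \<subseteq> \<Inter>X" by auto
    with X(3) have "finite (A \<inter> \<Inter>(X - {A}))" by (rule finite_subset[rotated])
    with X show ?thesis by (intro exI[of _ "X - {A}"]) auto
  qed
  have compl: "- A \<in> U \<longleftrightarrow> A \<notin> U" for A
  proof
    assume "- A \<in> U"
    then show "A \<notin> U" using inf[of "{A, - A}"] by auto
  next
    assume "A \<notin> U"
    show "- A \<in> U"
    proof (rule ccontr)
      assume "- A \<notin> U"
      with \<open>A \<notin> U\<close> ex obtain X Y where "finite X" "X \<subseteq> U" "finite (A \<inter> \<Inter>X)"
        "finite Y" "Y \<subseteq> U" "finite (- A \<inter> \<Inter>Y)" by metis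
      moreover have "\<Inter>(X \<union> Y) \<subseteq> (A \<inter> \<Inter>X) \<union> (- A \<inter> \<Inter>Y)" by auto
      ultimately show False
        using inf[of "X \<union> Y"] by (meson finite_Un finite_subset le_sup_iff)
    qed
  qed
  moreover have "A \<inter> B \<in> U" if "A \<in> U" "B \<in> U" for A B
  proof (rule ccontr)
    assume "A \<inter> B \<notin> U"
    then have "- (A \<inter> B) \<in> U" using compl by blast
    with that have "infinite (\<Inter>{A, B, - (A \<inter> B)})" by (intro inf) auto
    moreover have "\<Inter>{A, B, - (A \<inter> B)} = {}" by blast
    ultimately show False by simp
  qed
  moreover have "infinite A" if "A \<in> U" for A
    using inf[of "{A}"] that by simp
  ultimately show ?thesis by (rule that)
qed

locale nonprincipal_ultrafilter =
  fixes U :: "nat set set"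
  assumes compl: "- A \<in> U \<longleftrightarrow> A \<notin> U"
    and Int: "A \<in> U \<Longrightarrow> B \<in> U \<Longrightarrow> A \<inter> B \<in> U"
    and infinite: "A \<in> U \<Longrightarrow> infinite A"
begin

lemma empty_notin: "{} \<notin> U"
  using infinite by auto

lemma UNIV_in: "UNIV \<in> U"
  using compl[of "{}"] empty_notin by simp

lemma superset:
  assumes "A \<in> U" "A \<subseteq> B"
  shows "B \<in> U"
proof (rule ccontr)
  assume "B \<notin> U"
  with assms(1) have "A \<inter> - B \<in> U" by (simp add: Int compl)
  moreover have "A \<inter> - B = {}" using assms(2) by blast
  ultimately show False using empty_notin by simp
qed

lemma Int_iff: "A \<inter> B \<in> U \<longleftrightarrow> A \<in> U \<and> B \<in> U"
  using Int superset[of "A \<inter> B"] by blast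

lemma finite_notin: "finite A \<Longrightarrow> A \<notin> U"
  using infinite by blast

text \<open>Iterated ultrafilter limit. The head of the list is the outermost limit, so its value is
  chosen first and later values can be taken large relative to it.\<close>

primrec lim_along :: "'p list \<Rightarrow> (('p \<Rightarrow> nat) \<Rightarrow> bool) \<Rightarrow> ('p \<Rightarrow> nat) \<Rightarrow> bool" where
  "lim_along [] Q h = Q h"
| "lim_along (p # ps) Q h = ({j. lim_along ps Q (h(p := j))} \<in> U)"

lemma lim_along_not: "lim_along ps (\<lambda>h. \<not> Q h) h \<longleftrightarrow> \<not> lim_along ps Q h"
  by (induction ps arbitrary: h) (simp_all add: Collect_neg_eq compl)

lemma lim_along_and: "lim_along ps (\<lambda>h. Q h \<and> R h) h \<longleftrightarrow> lim_along ps Q h \<and> lim_along ps R h"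
  by (induction ps arbitrary: h) (simp_all add: Collect_conj_eq Int_iff)

lemma lim_along_const: "lim_along ps (\<lambda>h. c) h \<longleftrightarrow> c"
  by (induction ps arbitrary: h) (auto simp: UNIV_in empty_notin)

lemma lim_along_ball:
  "finite I \<Longrightarrow> lim_along ps (\<lambda>h. \<forall>i\<in>I. Q i h) h \<longleftrightarrow> (\<forall>i\<in>I. lim_along ps (Q i) h)"
  by (induction I rule: finite_induct) (simp_all add: lim_along_const lim_along_and)

lemma lim_along_filter:
  assumes "\<And>h h'. (\<And>p. p \<in> S \<Longrightarrow> h p = h' p) \<Longrightarrow> Q h = Q h'"
  shows "(\<And>p. p \<in> S \<Longrightarrow> p \<notin> set ps \<Longrightarrow> h p = h' p) \<Longrightarrow>
    lim_along ps Q h = lim_along (filter (\<lambda>p. p \<in> S) ps) Q h'"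
proof (induction ps arbitrary: h h')
  case Nil
  then show ?case using assms[of h h'] by simp
next
  case (Cons p ps)
  show ?case
  proof (cases "p \<in> S")
    case True
    have "lim_along ps Q (h(p := j)) = lim_along (filter (\<lambda>p. p \<in> S) ps) Q (h'(p := j))" for j
      by (rule Cons.IH) (use Cons.prems in auto)
    with True show ?thesis by simp
  next
    case False
    have "lim_along ps Q (h(p := j)) = lim_along (filter (\<lambda>p. p \<in> S) ps) Q h'" for j
      by (rule Cons.IH) (use Cons.prems False in auto)
    with False show ?thesis by (simp add: UNIV_in empty_notin)
  qed
qed

lemma lim_along_map:
  assumes "inj F"
  shows "lim_along (map F ps) (\<lambda>h. Q (\<lambda>p. h (F p))) h = lim_along ps Q (\<lambda>p. h (F p))"
proof (induction ps arbitrary: h)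
  case (Cons p ps)
  have "(\<lambda>q. (h(F p := j)) (F q)) = (\<lambda>q. h (F q))(p := j)" for j
    using assms by (auto simp: fun_eq_iff inj_eq)
  then have "lim_along (map F ps) (\<lambda>h. Q (\<lambda>p. h (F p))) (h(F p := j))
    = lim_along ps Q ((\<lambda>q. h (F q))(p := j))" for j
    using Cons.IH[of "h(F p := j)"] by (simp only:)
  then show ?case by (simp only: list.map lim_along.simps)
qed simp

text \<open>The limit variables are processed in lexicographic order, so within a row each new value
  can be taken above all earlier ones.\<close>

lemma lim_along_witness:
  fixes ps :: "(nat \<times> nat) list"
  assumes "sorted_wrt (<) ps" and "lim_along ps Q h"
  shows "\<exists>h'. Q h' \<and> (\<forall>p. p \<notin> set ps \<longrightarrow> h' p = h p) \<and>
    (\<forall>\<alpha> i i'. (\<alpha>, i) \<in> set ps \<longrightarrow> i' < i \<longrightarrow> h' (\<alpha>, i') < h' (\<alpha>, i))"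
  using assms
proof (induction ps arbitrary: h)
  case (Cons p ps)
  obtain \<alpha> i where p: "p = (\<alpha>, i)" by (cases p)
  \<comment> \<open>The sum bounds all earlier entries of the row, and excluding the finitely many
    \<open>j\<close> up to it leaves a set in the ultrafilter. In lexicographic order those entries
    no longer change.\<close>
  have "{j. j \<le> (\<Sum>i'<i. h (\<alpha>, i'))} \<notin> U" by (rule finite_notin) simp
  then have "- {j. j \<le> (\<Sum>i'<i. h (\<alpha>, i'))} \<in> U" by (simp add: compl)
  with Cons.prems(2) have "{j. lim_along ps Q (h(p := j))} \<inter> - {j. j \<le> (\<Sum>i'<i. h (\<alpha>, i'))} \<noteq> {}"
    using Int empty_notin by fastforce
  then obtain j where "j \<in> {j. lim_along ps Q (h(p := j))} \<inter> - {j. j \<le> (\<Sum>i'<i. h (\<alpha>, i'))}" by blast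
  then have j: "lim_along ps Q (h(p := j))" "(\<Sum>i'<i. h (\<alpha>, i')) < j" by auto
  from Cons.IH[OF _ j(1)] Cons.prems(1) obtain h' where h': "Q h'"
    "\<forall>q. q \<notin> set ps \<longrightarrow> h' q = (h(p := j)) q"
    "\<forall>\<alpha> i i'. (\<alpha>, i) \<in> set ps \<longrightarrow> i' < i \<longrightarrow> h' (\<alpha>, i') < h' (\<alpha>, i)" by auto
  have "h' (\<alpha>, i') < h' (\<alpha>, i)" if "i' < i" for i'
  proof -
    have "(\<alpha>, i) \<notin> set ps" "(\<alpha>, i') \<notin> set ps"
      using Cons.prems(1) that by (auto simp: p)
    then have "h' (\<alpha>, i') = h (\<alpha>, i')" "h' (\<alpha>, i) = j" using h'(2) that by (auto simp: p)
    moreover have "h (\<alpha>, i') \<le> (\<Sum>i'<i. h (\<alpha>, i'))" using that by (intro member_le_sum) auto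
    ultimately show ?thesis using j(2) by simp
  qed
  with h' show ?case by (intro exI[of _ h']) (auto simp: p)
qed auto

end

section \<open>Arrays and their thinnings\<close>

definition thin :: "(nat \<Rightarrow> nat \<Rightarrow> nat) \<Rightarrow> (nat \<times> nat \<times> nat \<Rightarrow> 'a) \<Rightarrow> nat \<times> nat \<times> nat \<Rightarrow> 'a" where
  "thin F a = (\<lambda>(\<alpha>, i, l). a (\<alpha>, F \<alpha> i, l))"

lemma thin_apply [simp]: "thin F a (\<alpha>, i, l) = a (\<alpha>, F \<alpha> i, l)"
  by (simp add: thin_def)

text \<open>An array has rows \<open>\<alpha>\<close>, columns \<open>i\<close>, and a tuple of entries \<open>l\<close> at each place.\<close>

definition (in fo_structure) mut_indisc :: "'a set \<Rightarrow> (nat \<times> nat \<times> nat \<Rightarrow> 'a) \<Rightarrow> bool" where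
  "mut_indisc B a \<longleftrightarrow> (\<forall>F. (\<forall>\<alpha>. strict_mono (F \<alpha>)) \<longrightarrow> eqv B (thin F a) a)"

lemma (in fo_structure) Def_thin: "Def B P \<Longrightarrow> Def B (\<lambda>e. P (thin F e))"
  using Def_reindex[of B P "\<lambda>(\<alpha>, i, l). (\<alpha>, F \<alpha> i, l)"]
  by (simp add: thin_def case_prod_unfold)

lemma sorted_list_of_subset:
  fixes S T :: "'p::linorder set"
  assumes "finite T" "S \<subseteq> T"
  shows "sorted_list_of_set S = filter (\<lambda>p. p \<in> S) (sorted_list_of_set T)"
  using assms by (intro sorted_distinct_set_unique) (auto simp: sorted_wrt_filter finite_subset)

text \<open>The new array realises the iterated limit type of \<open>a\<close>, with limits in
  lexicographic order of the places \<open>(\<alpha>, i)\<close>. Thinning relabels places in an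
  order-preserving way and leaves limits unchanged. A condition with true limit holds of some
  thinning of \<open>a\<close>, which gives both consistency and the second clause.\<close>

theorem (in countably_saturated) extract_mut_indisc:
  assumes "countable B"
  shows "\<exists>a'. mut_indisc B a' \<and>
    (\<forall>P. Def B P \<longrightarrow> (\<forall>F. (\<forall>\<alpha>. strict_mono (F \<alpha>)) \<longrightarrow> P (thin F a)) \<longrightarrow> P a')"
proof -
  obtain U :: "nat set set" where "nonprincipal_ultrafilter U"
    unfolding nonprincipal_ultrafilter_def using ex_nonprincipal_ultrafilter by metis
  then interpret nonprincipal_ultrafilter U .
  \<comment> \<open>\<open>pick P h\<close> evaluates \<open>P\<close> at the array whose place
    \<open>(\<alpha>, i)\<close> is filled from column \<open>h (\<alpha>, i)\<close> of
    \<open>a\<close>; below, \<open>on S P\<close> says that only the finitely many places in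
    \<open>S\<close> matter.\<close>
  define pick where "pick P h = P (\<lambda>(\<alpha>, i, l). a (\<alpha>, h (\<alpha>, i), l))"
    for P :: "(nat \<times> nat \<times> nat \<Rightarrow> 'a) \<Rightarrow> bool" and h :: "nat \<times> nat \<Rightarrow> nat"
  define on where "on S P \<longleftrightarrow> finite S \<and> (\<forall>h h'. (\<forall>p\<in>S. h p = h' p) \<longrightarrow> pick P h = pick P h')"
    for S P
  define lim where "lim P \<longleftrightarrow> (\<exists>S. on S P \<and> lim_along (sorted_list_of_set S) (pick P) (\<lambda>_. 0))" for P
  have on_mono: "on T P" if "on S P" "S \<subseteq> T" "finite T" for S T P
    using that unfolding on_def by blast
  have ex_on: "\<exists>S. on S P" if "Def B P" for P
  proof -
    from that obtain V where V: "finite V" "depends V P" by (rule Def_depends)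
    let ?S = "(\<lambda>(\<alpha>, i, l). (\<alpha>, i)) ` V"
    have "pick P h = pick P h'" if "\<forall>p\<in>?S. h p = h' p" for h h'
      unfolding pick_def by (rule dependsD[OF V(2)]) (use that in force)
    with V(1) show ?thesis unfolding on_def by blast
  qed
  have along_mono: "lim_along (sorted_list_of_set T) (pick P) h = lim_along (sorted_list_of_set S) (pick P) h'"
    if "on S P" "S \<subseteq> T" "finite T" for S T P h h'
    unfolding sorted_list_of_subset[OF that(3,2)]
    by (rule lim_along_filter) (use that in \<open>auto simp: on_def finite_subset\<close>)
  have lim_eq: "lim P = lim_along (sorted_list_of_set S) (pick P) h" if "on S P" for S P h
  proof -
    have "lim_along (sorted_list_of_set S') (pick P) (\<lambda>_. 0) = lim_along (sorted_list_of_set S) (pick P) h"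
      if "on S' P" for S'
      using along_mono[OF \<open>on S' P\<close>, of "S \<union> S'" h] along_mono[OF \<open>on S P\<close>, of "S \<union> S'" h]
        \<open>on S P\<close> \<open>on S' P\<close> unfolding on_def by auto
    then show ?thesis unfolding lim_def using that by blast
  qed
  have lim_not: "lim (\<lambda>e. \<not> P e) \<longleftrightarrow> \<not> lim P" if "Def B P" for P
  proof -
    from ex_on[OF that] obtain S where "on S P" by blast
    moreover have "pick (\<lambda>e. \<not> P e) = (\<lambda>h. \<not> pick P h)" by (rule ext) (simp only: pick_def)
    moreover from calculation have "on S (\<lambda>e. \<not> P e)" by (simp add: on_def)
    ultimately show ?thesis
      by (simp only: lim_eq[of S P "\<lambda>_. 0"] lim_eq[of S "\<lambda>e. \<not> P e" "\<lambda>_. 0"] lim_along_not)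
  qed
  have lim_witness: "\<exists>F. (\<forall>\<alpha>. strict_mono (F \<alpha>)) \<and> P (thin F a)" if "Def B P" "lim P" for P
  proof -
    from ex_on[OF that(1)] obtain S where S: "on S P" by blast
    then have "finite S" by (simp add: on_def)
    then have "finite (fst ` S \<union> snd ` S)" by simp
    then obtain K where K: "\<And>n. n \<in> fst ` S \<union> snd ` S \<Longrightarrow> n < K"
      using finite_nat_set_iff_bounded by metis
    \<comment> \<open>Enlarging the support to a square makes the witness increase along whole
      initial segments of rows, not only between the places that \<open>P\<close> reads.\<close>
    let ?T = "{..<K} \<times> {..<K}"
    have "S \<subseteq> ?T" using K by force
    with S have T: "on ?T P" by (rule on_mono) simp
    then have "lim_along (sorted_list_of_set ?T) (pick P) (\<lambda>_. 0)"
      using that(2) by (simp only: lim_eq[OF T, of "\<lambda>_. 0"])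
    from lim_along_witness[OF strict_sorted_list_of_set this] obtain h where h: "pick P h"
      "\<forall>\<alpha> i i'. (\<alpha>, i) \<in> set (sorted_list_of_set ?T) \<longrightarrow> i' < i \<longrightarrow> h (\<alpha>, i') < h (\<alpha>, i)"
      by (elim exE conjE)
    \<comment> \<open>Inside the square \<open>F\<close> follows \<open>h\<close>. Beyond it any
      strictly increasing continuation will do, here one starting above the sum of the row.\<close>
    define F where "F \<alpha> i = (if \<alpha> < K then if i < K then h (\<alpha>, i) else Suc (\<Sum>i'<K. h (\<alpha>, i')) + i else i)"
      for \<alpha> i
    have "strict_mono (F \<alpha>)" for \<alpha>
    proof (rule strict_monoI)
      fix i i' :: nat assume "i < i'"
      have "h (\<alpha>, i) \<le> (\<Sum>i'<K. h (\<alpha>, i'))" if "i < K" using that by (intro member_le_sum) auto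
      moreover have "h (\<alpha>, i) < h (\<alpha>, i')" if "\<alpha> < K" "i' < K" using h(2) that \<open>i < i'\<close> by simp
      ultimately show "F \<alpha> i < F \<alpha> i'" using \<open>i < i'\<close> by (auto simp: F_def)
    qed
    moreover have "pick P (\<lambda>(\<alpha>, i). F \<alpha> i)"
    proof -
      have "pick P h = pick P (\<lambda>(\<alpha>, i). F \<alpha> i)"
        using T unfolding on_def by (auto simp: F_def)
      with h(1) show ?thesis by blast
    qed
    moreover have "thin F a = (\<lambda>(\<alpha>, i, l). a (\<alpha>, (case (\<alpha>, i) of (\<alpha>, i) \<Rightarrow> F \<alpha> i), l))"
      by (simp add: thin_def)
    ultimately show ?thesis unfolding pick_def by (intro exI[of _ F]) simp
  qed
  have lim_thin: "lim (\<lambda>e. P (thin F e)) = lim P" if "Def B P" "\<And>\<alpha>. strict_mono (F \<alpha>)" for P F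
  proof -
    let ?F = "\<lambda>(\<alpha>, i). (\<alpha>, F \<alpha> i)"
    from ex_on[OF that(1)] obtain S where S: "on S P" by blast
    have inj: "inj ?F" using that(2) by (auto simp: inj_def strict_mono_eq)
    \<comment> \<open>Since lexicographic order is preserved, the sorted list of the image is the
      image of the sorted list, and the limits are taken in the same order.\<close>
    have mono: "p < q \<Longrightarrow> ?F p < ?F q" for p q
      using that(2) by (auto simp: less_prod_def strict_mono_less split: prod.splits)
    have pick: "pick (\<lambda>e. P (thin F e)) = (\<lambda>h. pick P (\<lambda>p. h (?F p)))"
      by (rule ext) (simp add: pick_def thin_def case_prod_beta)
    have "on (?F ` S) (\<lambda>e. P (thin F e))"
      using S unfolding on_def pick by auto
    moreover have "sorted_list_of_set (?F ` S) = map ?F (sorted_list_of_set S)"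
    proof (rule sorted_distinct_set_unique)
      show "sorted (map ?F (sorted_list_of_set S))"
        unfolding sorted_wrt_map
        by (rule sorted_wrt_mono_rel[OF _ strict_sorted_list_of_set]) (use mono in \<open>blast intro: less_imp_le\<close>)
      show "distinct (map ?F (sorted_list_of_set S))"
        by (simp add: distinct_map inj_on_subset[OF inj])
    qed (use S in \<open>auto simp: on_def\<close>)
    ultimately have "lim (\<lambda>e. P (thin F e)) = lim_along (map ?F (sorted_list_of_set S)) (\<lambda>h. pick P (\<lambda>p. h (?F p))) (\<lambda>_. 0)"
      by (simp only: lim_eq[of "?F ` S" "\<lambda>e. P (thin F e)" "\<lambda>_. 0"] pick)
    also have "\<dots> = lim_along (sorted_list_of_set S) (pick P) (\<lambda>_. 0)"
      by (rule lim_along_map[OF inj])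
    also have "\<dots> = lim P" by (rule lim_eq[OF S, symmetric])
    finally show ?thesis .
  qed
  obtain a' where a': "\<forall>P\<in>{P. Def B P \<and> lim P}. P a'"
  proof (rule realize[OF assms])
    show "Def B P" if "P \<in> {P. Def B P \<and> lim P}" for P using that by blast
    fix \<F> assume \<F>: "finite \<F>" "\<F> \<subseteq> {P. Def B P \<and> lim P}"
    have Def: "Def B (\<lambda>e. \<forall>P\<in>\<F>. P e)" using \<F> by (intro Def_ball) auto
    have "\<forall>P\<in>\<F>. \<exists>S. on S P" using \<F>(2) ex_on by blast
    then obtain S where S: "\<And>P. P \<in> \<F> \<Longrightarrow> on (S P) P" by metis
    let ?S = "\<Union>(S ` \<F>)"
    have "finite ?S" using \<F>(1) S by (auto simp: on_def)
    then have on: "on ?S P" if "P \<in> \<F>" for P using on_mono[OF S[OF that]] that by blast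
    have pick: "pick (\<lambda>e. \<forall>P\<in>\<F>. P e) = (\<lambda>h. \<forall>P\<in>\<F>. pick P h)" by (rule ext) (simp only: pick_def)
    have "on ?S (\<lambda>e. \<forall>P\<in>\<F>. P e)" using on \<open>finite ?S\<close> unfolding on_def pick by blast
    moreover have "lim_along (sorted_list_of_set ?S) (pick (\<lambda>e. \<forall>P\<in>\<F>. P e)) (\<lambda>_. 0)"
      unfolding pick lim_along_ball[OF \<F>(1)] using \<F>(2) by (auto simp flip: lim_eq[OF on])
    ultimately have "lim (\<lambda>e. \<forall>P\<in>\<F>. P e)" unfolding lim_def by (intro exI conjI)
    from lim_witness[OF Def this] obtain F where "\<forall>P\<in>\<F>. P (thin F a)" by (elim exE conjE)
    then show "\<exists>e. \<forall>P\<in>\<F>. P e" by (rule exI[where x = "thin F a"])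
  qed
  then have lim_iff: "P a' \<longleftrightarrow> lim P" if "Def B P" for P
  proof (cases "lim P")
    case True
    with that have "P \<in> {P. Def B P \<and> lim P}" by simp
    from bspec[OF a' this] True show ?thesis by simp
  next
    case False
    with that lim_not[OF that] have "(\<lambda>e. \<not> P e) \<in> {P. Def B P \<and> lim P}"
      by (simp add: Def_not)
    from bspec[OF a' this] False show ?thesis by simp
  qed
  show ?thesis
  proof (intro exI[of _ a'] conjI allI impI)
    show "mut_indisc B a'"
      unfolding mut_indisc_def
    proof (intro allI impI eqvI)
      fix F P assume F: "\<forall>\<alpha>. strict_mono (F \<alpha>)" and P: "Def B P" "P (thin F a')"
      from lim_iff[OF Def_thin[OF P(1)]] show "P a'"
        using lim_iff[OF P(1)] lim_thin[OF P(1)] F P(2) by simp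
    qed
    fix P assume P: "Def B P" "\<forall>F. (\<forall>\<alpha>. strict_mono (F \<alpha>)) \<longrightarrow> P (thin F a)"
    show "P a'"
    proof (rule ccontr)
      assume "\<not> P a'"
      then have "lim (\<lambda>e. \<not> P e)" using lim_iff[OF P(1)] lim_not[OF P(1)] by simp
      from lim_witness[OF Def_not[OF P(1)] this] obtain F
        where "\<forall>\<alpha>. strict_mono (F \<alpha>)" "\<not> P (thin F a)" by (elim exE conjE)
      with P(2) show False by simp
    qed
  qed
qed

subsection \<open>Mutually indiscernible arrays\<close>

lemma sorted_wrt_less_strict_mono:
  fixes xs :: "nat list"
  assumes "sorted_wrt (<) xs"
  obtains f where "strict_mono f" "xs = map f [0..<length xs]"
proof -
  define f where "f i = (if i < length xs then xs ! i else Suc (sum_list xs) + i)" for i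
  have "strict_mono f"
  proof (rule strict_monoI)
    fix i j :: nat assume "i < j"
    moreover have "xs ! i \<le> sum_list xs" if "i < length xs"
      using that by (intro member_le_sum_list) auto
    ultimately show "f i < f j"
      using sorted_wrt_nth_less[OF assms] by (fastforce simp: f_def)
  qed
  moreover have "xs = map f [0..<length xs]"
    by (intro nth_equalityI) (auto simp: f_def)
  ultimately show ?thesis by (rule that)
qed

context fo_structure
begin

text \<open>Array entries at places that \<open>F\<close> fixes may serve as parameters: once
  abstracted into variables, they read the same in \<open>a\<close> and in
  \<open>thin F a\<close>.\<close>

lemma mut_indisc_params:
  fixes P :: "('v \<Rightarrow> 'a) \<Rightarrow> bool" and r :: "'v \<Rightarrow> nat \<times> nat \<times> nat"
  assumes a: "mut_indisc B a" and F: "\<And>\<alpha>. strict_mono (F \<alpha>)"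
    and P: "Def (B \<union> a ` W) P" and W: "\<And>\<beta> i l. (\<beta>, i, l) \<in> W \<Longrightarrow> F \<beta> i = i"
  shows "P (\<lambda>v. thin F a (r v)) \<longleftrightarrow> P (\<lambda>v. a (r v))"
proof -
  obtain P' where P': "Def B P'"
    "\<forall>e u'. (\<forall>w\<in>W. u' w = a w) \<longrightarrow> P' (case_sum e u') = P e"
    using Def_abstract[OF P subset_refl] by (elim exE conjE)
  have "Def B (\<lambda>E. P' (\<lambda>w. E (case_sum r id w)))" by (rule Def_reindex[OF P'(1)])
  moreover have "(\<lambda>w. E (case_sum r id w)) = case_sum (\<lambda>v. E (r v)) E" for E :: "nat \<times> nat \<times> nat \<Rightarrow> 'a"
    by (auto split: sum.splits)
  ultimately have D: "Def B (\<lambda>E. P' (case_sum (\<lambda>v. E (r v)) E))" by (simp only:)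
  have "eqv B (thin F a) a" using a F by (simp add: mut_indisc_def)
  from eqv_iff[OF this D]
  have "P' (case_sum (\<lambda>v. thin F a (r v)) (thin F a)) \<longleftrightarrow> P' (case_sum (\<lambda>v. a (r v)) a)" .
  moreover have "thin F a w = a w" if "w \<in> W" for w
    using W that by (cases w) auto
  ultimately show ?thesis by (simp add: P'(2)[rule_format])
qed

definition rows_below :: "'a set \<Rightarrow> (nat \<times> nat \<times> nat \<Rightarrow> 'a) \<Rightarrow> nat \<Rightarrow> 'a set" where
  "rows_below B a N = B \<union> a ` {(\<beta>, i, l). \<beta> < N}"

lemma rows_below_mono: "N \<le> N' \<Longrightarrow> rows_below B a N \<subseteq> rows_below B a N'"
  by (auto simp: rows_below_def)

lemma base_subset_rows_below: "B \<subseteq> rows_below B a N"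
  by (simp add: rows_below_def)

lemma countable_rows_below: "countable B \<Longrightarrow> countable (rows_below B a N)"
  by (simp add: rows_below_def)

lemma mut_indisc_shift:
  assumes "mut_indisc B a"
  shows "mut_indisc (rows_below B a N) (\<lambda>(\<alpha>, i, l). a (N + \<alpha>, i, l))"
  unfolding mut_indisc_def
proof (intro allI impI eqvI)
  fix F P assume F: "\<forall>\<alpha>. strict_mono (F \<alpha>)"
    and P: "Def (rows_below B a N) P" "P (thin F (\<lambda>(\<alpha>, i, l). a (N + \<alpha>, i, l)))"
  let ?F = "\<lambda>\<beta>. if \<beta> < N then id else F (\<beta> - N)"
  let ?r = "\<lambda>(\<alpha>, i, l). (N + \<alpha>, i, l)"
  have "P (\<lambda>v. thin ?F a (?r v)) \<longleftrightarrow> P (\<lambda>v. a (?r v))"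
    by (rule mut_indisc_params[OF assms _ P(1)[unfolded rows_below_def]])
      (use F in \<open>auto simp: strict_mono_def\<close>)
  moreover have "(\<lambda>v. thin ?F a (?r v)) = thin F (\<lambda>(\<alpha>, i, l). a (N + \<alpha>, i, l))"
    "(\<lambda>v. a (?r v)) = (\<lambda>(\<alpha>, i, l). a (N + \<alpha>, i, l))"
    by (auto simp: fun_eq_iff)
  ultimately show "P (\<lambda>(\<alpha>, i, l). a (N + \<alpha>, i, l))" using P(2) by (simp only:)
qed

text \<open>Thinning the single row \<open>m k\<close> fixes all other rows, so their entries count
  as parameters. The constants \<open>cs k\<close> come from \<open>B\<close> and from rows outside
  the pattern, hence may be appended to every tuple of row \<open>k\<close>.\<close>

lemma mutually_indiscernible_rows:
  assumes a: "mut_indisc B a" and "inj m"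
    and cs: "\<And>k. set (cs k) \<subseteq> B \<union> a ` {(\<beta>, i, l). \<beta> \<notin> range m}"
  shows "mutually_indiscernible L M (\<lambda>k i. map (\<lambda>l. a (m k, i, l)) [0..<len k] @ cs k)"
proof -
  define row where "row k i = map (\<lambda>l. a (m k, i, l)) [0..<len k] @ cs k" for k i
  have sat_row: "sat M (concat (map (row k) (map f [0..<p])) @ ps) \<phi> \<longleftrightarrow>
      sat M (concat (map (row k) [0..<p]) @ ps) \<phi>"
    if f: "strict_mono f" and ps: "set ps \<subseteq> (\<Union>k'\<in>- {k}. \<Union>i. set (row k' i))"
      and \<phi>: "is_formula L (p * (len k + length (cs k)) + length ps) \<phi>" for k f p ps \<phi>
  proof -
    define ws where "ws = concat (map (\<lambda>t. map (\<lambda>l. Inl (t, l)) [0..<len k] @ map Inr (cs k)) [0..<p]) @ map Inr ps"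
    let ?W = "{(\<beta>, i, l :: nat). \<beta> \<noteq> m k}"
    have params: "set (cs k') \<subseteq> B \<union> a ` ?W" for k'
      using cs[of k'] by fastforce
    have "set (row k' i) \<subseteq> B \<union> a ` ?W" if "k' \<noteq> k" for k' i
      using params[of k'] that \<open>inj m\<close> by (auto simp: row_def inj_eq)
    with ps have "set ps \<subseteq> B \<union> a ` ?W" by blast
    moreover have "length ws = p * (len k + length (cs k)) + length ps"
      by (simp add: ws_def length_concat comp_def sum_list_triv)
    ultimately have D: "Def (B \<union> a ` ?W) (\<lambda>e. sat M (map (case_sum e id) ws) \<phi>)"
      using params[of k] \<phi> by (intro DefI[of ws]) (auto simp: ws_def split: if_splits)
    let ?F = "\<lambda>\<beta>. if \<beta> = m k then f else id" and ?r = "\<lambda>(t, l). (m k, t, l)"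
    have "sat M (map (case_sum (\<lambda>v. thin ?F a (?r v)) id) ws) \<phi> \<longleftrightarrow>
        sat M (map (case_sum (\<lambda>v. a (?r v)) id) ws) \<phi>"
      by (rule mut_indisc_params[OF a _ D]) (use f in \<open>auto simp: strict_mono_def\<close>)
    moreover have "(\<lambda>v. thin ?F a (?r v)) = (\<lambda>(t, l). a (m k, f t, l))"
      "(\<lambda>v. a (?r v)) = (\<lambda>(t, l). a (m k, t, l))"
      by auto
    ultimately have "sat M (map (case_sum (\<lambda>(t, l). a (m k, f t, l)) id) ws) \<phi> \<longleftrightarrow>
        sat M (map (case_sum (\<lambda>(t, l). a (m k, t, l)) id) ws) \<phi>" by (simp only:)
    then show ?thesis by (simp add: ws_def row_def[abs_def] map_concat comp_def)
  qed
  have len: "length (concat (map (row k) is)) = length is * (len k + length (cs k))" for k "is"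
    by (simp add: row_def length_concat comp_def sum_list_triv)
  have "mutually_indiscernible L M row"
    unfolding mutually_indiscernible_def indiscernible_def same_type_def
  proof (intro allI impI conjI ballI)
    fix k and "is" js :: "nat list" assume "is": "sorted_wrt (<) is" and js: "sorted_wrt (<) js" "length is = length js"
    show "length (concat (map (row k) is)) = length (concat (map (row k) js))"
      unfolding len by (simp add: js(2))
    fix q assume q: "q \<in> pformulas L (length (concat (map (row k) is))) (\<Union>k'\<in>- {k}. \<Union>i. set (row k' i))"
    obtain \<phi> ps where [simp]: "q = (\<phi>, ps)" by (cases q)
    obtain f where f: "strict_mono f" "is = map f [0..<length is]"
      using sorted_wrt_less_strict_mono[OF "is"] .
    obtain g where g: "strict_mono g" "js = map g [0..<length js]"
      using sorted_wrt_less_strict_mono[OF js(1)] .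
    have *: "set ps \<subseteq> (\<Union>k'\<in>- {k}. \<Union>i. set (row k' i))"
      "is_formula L (length is * (len k + length (cs k)) + length ps) \<phi>"
      using q unfolding pformulas_def len by auto
    from sat_row[OF f(1) *] sat_row[OF g(1) *]
    have "sat M (concat (map (row k) is) @ ps) \<phi> \<longleftrightarrow> sat M (concat (map (row k) js) @ ps) \<phi>"
      unfolding f(2)[symmetric] unfolding js(2) g(2)[symmetric] by blast
    then show "case q of (\<phi>, ps) \<Rightarrow> sat M (concat (map (row k) is) @ ps) \<phi> = sat M (concat (map (row k) js) @ ps) \<phi>"
      by simp
  qed
  then show ?thesis by (simp add: row_def[abs_def])
qed

text \<open>Joins an element and one column of each row in a single assignment, so that the type of
  \<open>x\<close> together with a path can be expressed by \<open>eqv\<close>.\<close>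

definition sel :: "'a \<Rightarrow> (nat \<times> nat \<times> nat \<Rightarrow> 'a) \<Rightarrow> (nat \<Rightarrow> nat) \<Rightarrow> (nat \<times> nat) option \<Rightarrow> 'a" where
  "sel x a \<eta> = case_option x (\<lambda>(\<alpha>, l). a (\<alpha>, \<eta> \<alpha>, l))"

lemma sel_simps [simp]: "sel x a \<eta> None = x" "sel x a \<eta> (Some (\<alpha>, l)) = a (\<alpha>, \<eta> \<alpha>, l)"
  by (simp_all add: sel_def)

lemma sel_eqI:
  "f None = x \<Longrightarrow> (\<And>\<alpha> l. f (Some (\<alpha>, l)) = a (\<alpha>, \<eta> \<alpha>, l)) \<Longrightarrow> f = sel x a \<eta>"
  by (auto simp: fun_eq_iff sel_def split: option.splits)

lemma Def_finitely_many_rows: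
  fixes P :: "((nat \<times> nat) option \<Rightarrow> 'a) \<Rightarrow> bool"
  assumes "Def B P"
  shows "\<exists>m. \<forall>e e'. e None = e' None \<longrightarrow>
    (\<forall>\<alpha> l. \<alpha> < m \<longrightarrow> e (Some (\<alpha>, l)) = e' (Some (\<alpha>, l))) \<longrightarrow> P e = P e'"
proof -
  from assms obtain V where V: "finite V" "depends V P" by (rule Def_depends)
  have "finite ((\<lambda>v. fst (the v)) ` V)" using V(1) by simp
  then obtain m where m: "\<And>v. v \<in> V \<Longrightarrow> fst (the v) < m"
    unfolding finite_nat_set_iff_bounded by auto
  show ?thesis
  proof (intro exI[of _ m] allI impI)
    fix e e' :: "(nat \<times> nat) option \<Rightarrow> 'a"
    assume e: "e None = e' None" "\<forall>\<alpha> l. \<alpha> < m \<longrightarrow> e (Some (\<alpha>, l)) = e' (Some (\<alpha>, l))"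
    show "P e = P e'"
    proof (rule dependsD[OF V(2)])
      fix v assume "v \<in> V"
      then show "e v = e' v" using m[of v] e by (cases v) auto
    qed
  qed
qed

end

subsection \<open>Patterns in one variable\<close>

context countably_saturated
begin

text \<open>Failure of movability is localised by two uses of compactness. Consider the first
  stretch of rows, from \<open>N\<close> to \<open>m - 1\<close>, along which a conjugate
  \<open>x'\<close> of \<open>x\<close> can be moved but which cannot be prolonged by row
  \<open>m\<close>. A finite part of the type that fails there is a single \<open>P\<close>,
  inconsistent along finitely many columns of row \<open>m\<close>.\<close>

lemma obstructing_row:
  assumes "countable B"
    and nex: "\<nexists>y. \<forall>\<eta>. (\<forall>\<beta><N. \<eta> \<beta> = 0) \<longrightarrow> eqv (rows_below B a N) (sel y a \<eta>) (sel x a (\<lambda>_. 0))"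
  obtains m N' x' P I where "N \<le> m" "m < N'"
    "eqv (rows_below B a N) (sel x' a (\<lambda>_. 0)) (sel x a (\<lambda>_. 0))"
    "Def (B \<union> a ` {(\<beta>, i, l). \<beta> < N' \<and> \<beta> \<noteq> m}) P"
    "P (case_option x' (\<lambda>l. a (m, 0, l)))" "finite I"
    "\<nexists>z. \<forall>i\<in>I. P (case_option z (\<lambda>l. a (m, i, l)))"
proof -
  let ?BN = "rows_below B a N"
  \<comment> \<open>\<open>R m y\<close>: moving columns in the rows from \<open>N\<close> to
    \<open>m - 1\<close> keeps the type that \<open>x\<close> has with the first column; all other
    rows stay in column \<open>0\<close>.\<close>
  define R where "R m y \<longleftrightarrow> (\<forall>\<eta>. (\<forall>\<beta>. \<beta> < N \<or> m \<le> \<beta> \<longrightarrow> \<eta> \<beta> = 0) \<longrightarrow>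
    eqv ?BN (sel y a \<eta>) (sel x a (\<lambda>_. 0)))" for m y
  have countable: "countable (rows_below B a n \<union> range a)" for n
    using countable_rows_below[OF assms(1)] by simp
  have Def_sel: "Def (C \<union> range a) (\<lambda>e. P (sel (e ()) a \<eta>))" if "Def C P" for C P \<eta>
  proof -
    let ?g = "case_option (Inl ()) (\<lambda>(\<alpha>, l). Inr (a (\<alpha>, \<eta> \<alpha>, l)))"
    have "Def (C \<union> range a) (\<lambda>e. P (\<lambda>w. case_sum e id (?g w)))"
      by (rule Def_subst[OF that]) (auto split: option.splits)
    moreover have "(\<lambda>w. case_sum e id (?g w)) = sel (e ()) a \<eta>" for e
      by (rule sel_eqI) auto
    ultimately show ?thesis by (simp only:)
  qed
  \<comment> \<open>Each condition reads finitely many rows, so solutions of all the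
    \<open>R m\<close> would give one \<open>y\<close> for all paths, against
    \<open>nex\<close>.\<close>
  have "\<exists>m. \<nexists>y. R m y"
  proof (rule ccontr)
    assume "\<not> ?thesis"
    then have R: "\<exists>y. R m y" for m by blast
    define K where "K = {(P, \<eta> :: nat \<Rightarrow> nat). Def ?BN P \<and> P (sel x a (\<lambda>_. 0)) \<and> (\<forall>\<beta><N. \<eta> \<beta> = 0)}"
    define f where "f = (\<lambda>(P, \<eta>) (e :: unit \<Rightarrow> 'a). P (sel (e ()) a \<eta>) :: bool)"
    obtain e where e: "\<forall>Q\<in>f ` K. Q e"
    proof (rule realize[OF countable])
      fix Q assume "Q \<in> f ` K"
      then show "Def (?BN \<union> range a) Q" by (auto simp: f_def K_def intro: Def_sel)
    next
      fix G assume G: "finite G" "G \<subseteq> f ` K"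
      from finite_subset_image[OF G] obtain K' where K': "K' \<subseteq> K" "finite K'" "G = f ` K'" by blast
      have "\<forall>k\<in>K'. \<exists>m. \<forall>e e'. e None = e' None \<longrightarrow>
        (\<forall>\<alpha> l. \<alpha> < m \<longrightarrow> e (Some (\<alpha>, l)) = e' (Some (\<alpha>, l))) \<longrightarrow> fst k e = fst k e'"
      proof
        fix k assume "k \<in> K'"
        with K'(1) have "Def ?BN (fst k)" by (auto simp: K_def)
        then show "\<exists>m. \<forall>e e'. e None = e' None \<longrightarrow>
          (\<forall>\<alpha> l. \<alpha> < m \<longrightarrow> e (Some (\<alpha>, l)) = e' (Some (\<alpha>, l))) \<longrightarrow> fst k e = fst k e'"
          by (rule Def_finitely_many_rows)
      qed
      then obtain mm where mm: "\<forall>k\<in>K'. \<forall>e e'. e None = e' None \<longrightarrow>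
          (\<forall>\<alpha> l. \<alpha> < mm k \<longrightarrow> e (Some (\<alpha>, l)) = e' (Some (\<alpha>, l))) \<longrightarrow> fst k e = fst k e'"
        by (rule bchoice[THEN exE])
      define m where "m = (\<Sum>k\<in>K'. mm k)"
      have m: "mm k \<le> m" if "k \<in> K'" for k
        unfolding m_def using that K'(2) by (intro member_le_sum) auto
      obtain y where y: "R m y" using R by blast
      have "f k (\<lambda>_. y)" if k: "k \<in> K'" for k
      proof -
        obtain P \<eta> where [simp]: "k = (P, \<eta>)" by (cases k)
        from K'(1) k have P: "Def ?BN P" "P (sel x a (\<lambda>_. 0))" "\<And>\<beta>. \<beta> < N \<Longrightarrow> \<eta> \<beta> = 0"
          by (auto simp: K_def)
        let ?\<eta> = "\<lambda>\<beta>. if \<beta> < m then \<eta> \<beta> else 0"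
        have "eqv ?BN (sel y a ?\<eta>) (sel x a (\<lambda>_. 0))"
          using y P(3) unfolding R_def by auto
        with P(1,2) have "P (sel y a ?\<eta>)" by (simp add: eqv_iff)
        moreover have "fst k (sel y a ?\<eta>) = fst k (sel y a \<eta>)"
          by (rule mm[rule_format, OF k]) (use m[OF k] in auto)
        ultimately show ?thesis by (simp add: f_def)
      qed
      then show "\<exists>e. \<forall>Q\<in>G. Q e" unfolding K'(3) by (intro exI[of _ "\<lambda>_. y"]) blast
    qed
    have "eqv ?BN (sel (e ()) a \<eta>) (sel x a (\<lambda>_. 0))" if "\<forall>\<beta><N. \<eta> \<beta> = 0" for \<eta>
    proof (rule eqv_sym, rule eqvI)
      fix P assume "Def ?BN P" "P (sel x a (\<lambda>_. 0))"
      with that have "(P, \<eta>) \<in> K" by (simp add: K_def)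
      with e have "f (P, \<eta>) e" by blast
      then show "P (sel (e ()) a \<eta>)" by (simp add: f_def)
    qed
    with nex show False by blast
  qed
  then obtain m' where m': "\<nexists>y. R m' y" by blast
  obtain k where k: "\<nexists>y. R k y" "\<And>i. i < k \<Longrightarrow> \<exists>y. R i y"
    using exists_least_iff[of "\<lambda>k. \<nexists>y. R k y"] m' by blast
  have R_small: "R i x" if "i \<le> N" for i
    unfolding R_def
  proof (intro allI impI)
    fix \<eta> :: "nat \<Rightarrow> nat" assume "\<forall>\<beta>. \<beta> < N \<or> i \<le> \<beta> \<longrightarrow> \<eta> \<beta> = 0"
    with that have "\<eta> = (\<lambda>_. 0)" by (metis le_trans not_less)
    then show "eqv ?BN (sel x a \<eta>) (sel x a (\<lambda>_. 0))" by (simp add: eqv_refl)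
  qed
  then have "N < k" using k(1) by (meson not_less)
  then obtain m where m: "k = Suc m" "N \<le> m" by (cases k) auto
  obtain y where y: "R m y" using k(2)[of m] m by blast
  let ?Bm = "rows_below B a m"
  let ?one = "\<lambda>i. (\<lambda>_. 0)(m := i)"
  \<comment> \<open>Such a \<open>y'\<close> would satisfy \<open>R (Suc m)\<close>: it follows
    \<open>y\<close> along every column of row \<open>m\<close>, and the columns chosen in lower
    rows can be substituted as parameters because the types are taken over all rows below
    \<open>m\<close>.\<close>
  have no_ext: "\<nexists>y'. \<forall>i. eqv ?Bm (sel y a (\<lambda>_. 0)) (sel y' a (?one i))"
  proof
    assume "\<exists>y'. \<forall>i. eqv ?Bm (sel y a (\<lambda>_. 0)) (sel y' a (?one i))"
    then obtain y' where y': "\<And>i. eqv ?Bm (sel y a (\<lambda>_. 0)) (sel y' a (?one i))" by blast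
    have "R (Suc m) y'"
      unfolding R_def
    proof (intro allI impI)
      fix \<eta> :: "nat \<Rightarrow> nat" assume \<eta>: "\<forall>\<beta>. \<beta> < N \<or> Suc m \<le> \<beta> \<longrightarrow> \<eta> \<beta> = 0"
      let ?\<eta> = "\<eta>(m := 0)"
      have "eqv ?BN (sel y a ?\<eta>) (sel y' a \<eta>)"
      proof (rule eqvI)
        fix P assume P: "Def ?BN P" "P (sel y a ?\<eta>)"
        let ?g = "case_option (Inl None) (\<lambda>(\<alpha>, l). if \<alpha> < m then Inr (a (\<alpha>, \<eta> \<alpha>, l)) else Inl (Some (\<alpha>, l)))"
        have D: "Def ?Bm (\<lambda>E. P (\<lambda>w. case_sum E id (?g w)))"
          by (rule Def_subst[OF P(1) rows_below_mono[OF m(2)]])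
            (auto simp: rows_below_def split: option.splits if_splits)
        have 1: "(\<lambda>w. case_sum (sel y a (\<lambda>_. 0)) id (?g w)) = sel y a ?\<eta>"
          by (rule sel_eqI) (use \<eta> in auto)
        have 2: "(\<lambda>w. case_sum (sel y' a (?one (\<eta> m))) id (?g w)) = sel y' a \<eta>"
          by (rule sel_eqI) (use \<eta> in auto)
        from eqv_iff[OF y'[of "\<eta> m"] D] P(2) show "P (sel y' a \<eta>)" unfolding 1 2 by blast
      qed
      moreover have "eqv ?BN (sel y a ?\<eta>) (sel x a (\<lambda>_. 0))"
        using y \<eta> unfolding R_def by auto
      ultimately show "eqv ?BN (sel y' a \<eta>) (sel x a (\<lambda>_. 0))"
        using eqv_sym eqv_trans by blast
    qed
    with k(1) show False unfolding m(1) by blast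
  qed
  define K where "K = {(P, i :: nat). Def ?Bm P \<and> P (sel y a (\<lambda>_. 0))}"
  define f where "f = (\<lambda>(P, i) (e :: unit \<Rightarrow> 'a). P (sel (e ()) a (?one i)) :: bool)"
  have "\<exists>K'. K' \<subseteq> K \<and> finite K' \<and> (\<nexists>z. \<forall>k\<in>K'. f k (\<lambda>_. z))"
  proof (rule ccontr)
    assume "\<not> ?thesis"
    then have fin: "\<exists>z. \<forall>k\<in>K'. f k (\<lambda>_. z)" if "K' \<subseteq> K" "finite K'" for K'
      using that by blast
    obtain e where e: "\<forall>Q\<in>f ` K. Q e"
    proof (rule realize[OF countable])
      fix Q assume "Q \<in> f ` K"
      then show "Def (?Bm \<union> range a) Q" by (auto simp: f_def K_def intro: Def_sel)
    next
      fix G assume G: "finite G" "G \<subseteq> f ` K"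
      from finite_subset_image[OF G] obtain K' where K': "K' \<subseteq> K" "finite K'" "G = f ` K'" by blast
      from fin[OF K'(1,2)] obtain z where "\<forall>k\<in>K'. f k (\<lambda>_. z)" ..
      then show "\<exists>e. \<forall>Q\<in>G. Q e" unfolding K'(3) by (intro exI[of _ "\<lambda>_. z"]) blast
    qed
    have "eqv ?Bm (sel y a (\<lambda>_. 0)) (sel (e ()) a (?one i))" for i
    proof (rule eqvI)
      fix P assume "Def ?Bm P" "P (sel y a (\<lambda>_. 0))"
      then have "(P, i) \<in> K" by (simp add: K_def)
      with e have "f (P, i) e" by blast
      then show "P (sel (e ()) a (?one i))" by (simp add: f_def)
    qed
    with no_ext show False by blast
  qed
  then obtain K' where K': "K' \<subseteq> K" "finite K'" "\<nexists>z. \<forall>k\<in>K'. f k (\<lambda>_. z)" by blast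
  \<comment> \<open>One conjunction for all columns, so that the same formula is used along the
    whole row; the columns occurring in \<open>K'\<close> already witness inconsistency.\<close>
  define P where "P = (\<lambda>e. \<forall>k\<in>K'. fst k e)"
  have P_Def: "Def ?Bm P" unfolding P_def using K'(1,2) by (intro Def_ball) (auto simp: K_def)
  have P_y: "P (sel y a (\<lambda>_. 0))" unfolding P_def using K'(1) by (auto simp: K_def)
  have P_incons: "\<nexists>z. \<forall>i\<in>snd ` K'. P (sel z a (?one i))"
  proof
    assume "\<exists>z. \<forall>i\<in>snd ` K'. P (sel z a (?one i))"
    then obtain z where "\<forall>i\<in>snd ` K'. P (sel z a (?one i))" by blast
    then have "fst k (sel z a (?one (snd k)))" if "k \<in> K'" for k
      using that unfolding P_def by simp
    then have "\<forall>k\<in>K'. f k (\<lambda>_. z)" by (simp add: f_def case_prod_unfold)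
    with K'(3) show False by blast
  qed
  from Def_finitely_many_rows[OF P_Def] obtain n where n: "\<forall>e e'. e None = e' None \<longrightarrow>
    (\<forall>\<alpha> l. \<alpha> < n \<longrightarrow> e (Some (\<alpha>, l)) = e' (Some (\<alpha>, l))) \<longrightarrow> P e = P e'" ..
  define N' where "N' = max (Suc m) n"
  \<comment> \<open>Row \<open>m\<close> stays variable, and the other rows below \<open>N'\<close>
    become parameters in column \<open>0\<close>. Rows from \<open>N'\<close> on are not read by
    \<open>P\<close>, so the dummy \<open>Inl None\<close> is harmless there.\<close>
  define g where "g = case_option (Inl None) (\<lambda>(\<alpha>, l). if \<alpha> = m then Inl (Some l)
    else if \<alpha> < N' then Inr (a (\<alpha>, 0, l)) else Inl None)"
  let ?P = "\<lambda>e. P (\<lambda>w. case_sum e id (g w))"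
  have P_sel: "?P (case_option z (\<lambda>l. a (m, i, l))) = P (sel z a (?one i))" for z i
    by (rule n[rule_format]) (auto simp: g_def N'_def)
  show ?thesis
  proof (rule that)
    show "N \<le> m" by fact
    show "m < N'" by (simp add: N'_def)
    show "eqv ?BN (sel y a (\<lambda>_. 0)) (sel x a (\<lambda>_. 0))" using y unfolding R_def by simp
    have "Def (?Bm \<union> a ` {(\<beta>, i, l). \<beta> < N' \<and> \<beta> \<noteq> m}) ?P"
      by (rule Def_subst[OF P_Def]) (auto simp: g_def split: option.splits if_splits)
    moreover have "?Bm \<union> a ` {(\<beta>, i, l). \<beta> < N' \<and> \<beta> \<noteq> m} = B \<union> a ` {(\<beta>, i, l). \<beta> < N' \<and> \<beta> \<noteq> m}"
      by (auto simp: rows_below_def N'_def)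
    ultimately show "Def (B \<union> a ` {(\<beta>, i, l). \<beta> < N' \<and> \<beta> \<noteq> m}) ?P" by (simp only:)
    have one: "?one 0 = (\<lambda>_ :: nat. 0 :: nat)" by auto
    show "?P (case_option y (\<lambda>l. a (m, 0, l)))" unfolding P_sel one by (rule P_y)
    show "finite (snd ` K')" using K'(2) by simp
    show "\<nexists>z. \<forall>i\<in>snd ` K'. ?P (case_option z (\<lambda>l. a (m, i, l)))"
      unfolding P_sel by (fact P_incons)
  qed
qed

end

context countably_saturated
begin

text \<open>Otherwise \<open>obstructing_row\<close> applies again and again, to the current
  conjugate and above the rows used so far. The obstructing rows form a one-variable pattern
  excluded by \<open>strong2\<close>.\<close>

theorem ex_movable:
  assumes "strong2 L M" and B: "countable B" and a: "mut_indisc B a"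
    and len: "\<And>\<alpha> i l. a (\<alpha>, i, l) = a (\<alpha>, i, min l lmax)"
  obtains N x' y where "eqv B (sel x' a (\<lambda>_. 0)) (sel x a (\<lambda>_. 0))"
    "\<forall>\<eta>. (\<forall>\<beta><N. \<eta> \<beta> = 0) \<longrightarrow> eqv (rows_below B a N) (sel y a \<eta>) (sel x' a (\<lambda>_. 0))"
proof (rule ccontr)
  assume "\<not> thesis"
  with that have nex: "\<nexists>y. \<forall>\<eta>. (\<forall>\<beta><N. \<eta> \<beta> = 0) \<longrightarrow>
      eqv (rows_below B a N) (sel y a \<eta>) (sel x' a (\<lambda>_. 0))"
    if "eqv B (sel x' a (\<lambda>_. 0)) (sel x a (\<lambda>_. 0))" for N x'
    using that by blast
  \<comment> \<open>A state consists of a bound on the rows used so far and the current conjugate of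
    \<open>x\<close>.\<close>
  define step where "step s s' m P I \<longleftrightarrow> fst s \<le> m \<and> m < fst s' \<and>
    eqv (rows_below B a (fst s)) (sel (snd s') a (\<lambda>_. 0)) (sel (snd s) a (\<lambda>_. 0)) \<and>
    Def (B \<union> a ` {(\<beta>, i, l). \<beta> < fst s' \<and> \<beta> \<noteq> m}) P \<and>
    P (case_option (snd s') (\<lambda>l. a (m, 0, l))) \<and> finite I \<and>
    (\<nexists>z. \<forall>i\<in>I. P (case_option z (\<lambda>l. a (m, i, l))))"
    for s s' :: "nat \<times> 'a" and m P I
  have "\<exists>s. \<forall>n. eqv B (sel (snd (s n)) a (\<lambda>_. 0)) (sel x a (\<lambda>_. 0)) \<and>
      (\<exists>m P I. step (s n) (s (Suc n)) m P I)"
  proof (rule dependent_nat_choice)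
    show "\<exists>s :: nat \<times> 'a. eqv B (sel (snd s) a (\<lambda>_. 0)) (sel x a (\<lambda>_. 0))"
      by (rule exI[of _ "(0, x)"]) (simp add: eqv_refl)
  next
    fix s :: "nat \<times> 'a" and n :: nat
    assume s: "eqv B (sel (snd s) a (\<lambda>_. 0)) (sel x a (\<lambda>_. 0))"
    obtain m N' x' P I where *: "fst s \<le> m" "m < N'"
      "eqv (rows_below B a (fst s)) (sel x' a (\<lambda>_. 0)) (sel (snd s) a (\<lambda>_. 0))"
      "Def (B \<union> a ` {(\<beta>, i, l). \<beta> < N' \<and> \<beta> \<noteq> m}) P"
      "P (case_option x' (\<lambda>l. a (m, 0, l)))" "finite I"
      "\<nexists>z. \<forall>i\<in>I. P (case_option z (\<lambda>l. a (m, i, l)))"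
      using nex[OF s, of "fst s"] by (rule obstructing_row[OF B])
    from * have "step s (N', x') m P I" unfolding step_def fst_conv snd_conv by (intro conjI)
    moreover have "eqv B (sel x' a (\<lambda>_. 0)) (sel x a (\<lambda>_. 0))"
      using eqv_trans[OF eqv_mono[OF *(3) base_subset_rows_below] s] .
    ultimately show "\<exists>s'. eqv B (sel (snd s') a (\<lambda>_. 0)) (sel x a (\<lambda>_. 0)) \<and> (\<exists>m P I. step s s' m P I)"
      by (intro exI[of _ "(N', x')"] conjI exI[of _ m] exI[of _ P] exI[of _ I]) (simp_all only: snd_conv)
  qed
  then obtain s where "\<forall>n. eqv B (sel (snd (s n)) a (\<lambda>_. 0)) (sel x a (\<lambda>_. 0)) \<and>
      (\<exists>m P I. step (s n) (s (Suc n)) m P I)" ..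
  then have "\<forall>n. \<exists>m P I. step (s n) (s (Suc n)) m P I" by simp
  then obtain m P I where step: "\<forall>n. step (s n) (s (Suc n)) (m n) (P n) (I n)"
    unfolding choice_iff by (elim exE)
  define N X where "N n = fst (s n)" and "X n = snd (s n)" for n
  note step = step[unfolded step_def, rule_format, folded N_def X_def]
  have step1: "N k \<le> m k" "m k < N (Suc k)" and
    step3: "eqv (rows_below B a (N k)) (sel (X (Suc k)) a (\<lambda>_. 0)) (sel (X k) a (\<lambda>_. 0))" and
    step4: "Def (B \<union> a ` {(\<beta>, i, l). \<beta> < N (Suc k) \<and> \<beta> \<noteq> m k}) (P k)" and
    step5: "P k (case_option (X (Suc k)) (\<lambda>l. a (m k, 0, l)))" and
    step6: "\<nexists>z. \<forall>i\<in>I k. P k (case_option z (\<lambda>l. a (m k, i, l)))" for k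
    using step[of k] by (simp_all only: not_False_eq_True simp_thms)
  have N_mono: "j \<le> k \<Longrightarrow> N j \<le> N k" for j k
    by (rule lift_Suc_mono_le[of N]) (use step1 less_imp_le le_trans in blast)
  have m_less: "m j < m k" if "j < k" for j k
    using step1(2)[of j] N_mono[of "Suc j" k] step1(1)[of k] that by simp
  then have "inj m" by (metis injI linorder_neqE_nat less_irrefl)
  have X_eqv: "eqv (rows_below B a (N j)) (sel (X (j + d)) a (\<lambda>_. 0)) (sel (X j) a (\<lambda>_. 0))" for j d
  proof (induction d)
    case (Suc d)
    have "eqv (rows_below B a (N j)) (sel (X (Suc (j + d))) a (\<lambda>_. 0)) (sel (X (j + d)) a (\<lambda>_. 0))"
      by (rule eqv_mono[OF step3 rows_below_mono[OF N_mono]]) simp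
    from eqv_trans[OF this Suc] show ?case by simp
  qed (simp add: eqv_refl)
  \<comment> \<open>Later changes of the conjugate preserve its type over the rows below
    \<open>N (Suc k)\<close>, and \<open>P k\<close> speaks only about those rows.\<close>
  have P_X: "P k (case_option (X j) (\<lambda>l. a (m k, 0, l)))" if "k < j" for k j
  proof -
    let ?g = "map_option (\<lambda>l :: nat. (m k, l))"
    have "B \<union> a ` {(\<beta>, i, l). \<beta> < N (Suc k) \<and> \<beta> \<noteq> m k} \<subseteq> rows_below B a (N (Suc k))"
      by (auto simp: rows_below_def)
    from Def_mono[OF step4 this]
    have D: "Def (rows_below B a (N (Suc k))) (\<lambda>e. P k (\<lambda>w. e (?g w)))" by (rule Def_reindex)
    have sel: "(\<lambda>w. sel z a (\<lambda>_. 0) (?g w)) = case_option z (\<lambda>l. a (m k, 0, l))" for z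
      by (auto simp: fun_eq_iff split: option.splits)
    from that obtain d where "j = Suc k + d" using less_iff_Suc_add by auto
    then have "eqv (rows_below B a (N (Suc k))) (sel (X j) a (\<lambda>_. 0)) (sel (X (Suc k)) a (\<lambda>_. 0))"
      using X_eqv by blast
    from eqv_iff[OF this D] step5 show ?thesis unfolding sel by blast
  qed
  \<comment> \<open>\<open>R k\<close> collects the entries of the earlier rows of the pattern.
    Parameters of \<open>P k\<close> found there go to \<open>bs\<close>, as the definition of a
    pattern allows; all others go to \<open>cs\<close> and are appended to the tuples of row
    \<open>k\<close>.\<close>
  define R where "R k = a ` {(\<beta>, i, l). \<beta> \<in> m ` {..<k}}" for k
  have "\<exists>q. lmax < fst q \<and> set (fst (snd q)) \<subseteq> B \<union> a ` {(\<beta>, i, l). \<beta> \<notin> range m} \<and>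
      set (fst (snd (snd q))) \<subseteq> R k \<and>
      is_formula L (1 + (fst q + length (fst (snd q))) + length (fst (snd (snd q)))) (snd (snd (snd q))) \<and>
      (\<forall>z i. P k (case_option z (\<lambda>l. a (m k, i, l))) \<longleftrightarrow>
        sat M ([z] @ (map (\<lambda>l. a (m k, i, l)) [0..<fst q] @ fst (snd q)) @ fst (snd (snd q))) (snd (snd (snd q))))"
    for k
  proof -
    from Def_formula[OF step4[of k]] obtain V C where VC: "finite V" "finite C"
      "C \<subseteq> B \<union> a ` {(\<beta>, i, l). \<beta> < N (Suc k) \<and> \<beta> \<noteq> m k}"
      "\<forall>vs ps. V \<subseteq> set vs \<longrightarrow> C \<subseteq> set ps \<longrightarrow>
        (\<exists>\<phi>. is_formula L (length vs + length ps) \<phi> \<and> (\<forall>e. P k e \<longleftrightarrow> sat M (map e vs @ ps) \<phi>))"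
      by (elim exE conjE)
    \<comment> \<open>Tuples are made longer than \<open>lmax\<close> so that they contain every
      entry of their place; this puts the parameters \<open>bs\<close> of later rows among
      them.\<close>
    have "finite (insert lmax (the ` V))" using VC(1) by simp
    then obtain n where n: "\<And>l. l \<in> insert lmax (the ` V) \<Longrightarrow> l < n"
      unfolding finite_nat_set_iff_bounded by auto
    have V: "V \<subseteq> set (None # map Some [0..<n])"
    proof
      fix v assume "v \<in> V"
      then have "the v < n" by (intro n) blast
      then show "v \<in> set (None # map Some [0..<n])" by (cases v) auto
    qed
    obtain cs bs where cs: "set cs = C - R k" and bs: "set bs = C \<inter> R k"
      using finite_list[of "C - R k"] finite_list[of "C \<inter> R k"] VC(2) by auto
    obtain \<phi> where \<phi>: "is_formula L (length (None # map Some [0..<n]) + length (cs @ bs)) \<phi>"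
      "\<forall>e. P k e \<longleftrightarrow> sat M (map e (None # map Some [0..<n]) @ cs @ bs) \<phi>"
      using VC(4)[rule_format, OF V, of "cs @ bs"] cs bs by auto
    \<comment> \<open>The pattern rows below \<open>N (Suc k)\<close> are \<open>m 0\<close> up to
      \<open>m k\<close>, since the next one is at least \<open>N (Suc k)\<close>. Any other row
      below this bound lies outside the pattern.\<close>
    have "C - R k \<subseteq> B \<union> a ` {(\<beta>, i, l). \<beta> \<notin> range m}"
    proof
      fix c assume c: "c \<in> C - R k"
      show "c \<in> B \<union> a ` {(\<beta>, i, l). \<beta> \<notin> range m}"
      proof (cases "c \<in> B")
        case False
        with c VC(3) obtain \<beta> i l where \<beta>: "c = a (\<beta>, i, l)" "\<beta> < N (Suc k)" "\<beta> \<noteq> m k" by auto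
        have "\<beta> \<notin> range m"
        proof
          assume "\<beta> \<in> range m"
          then obtain j where j: "\<beta> = m j" by blast
          then have "j < k"
            using \<beta>(2,3) step1(1)[of j] N_mono[of "Suc k" j] by (metis le_trans linorder_neqE_nat not_less not_less_eq_eq leD less_le_trans Suc_leI)
          with j have "c \<in> R k" unfolding R_def \<beta>(1) by blast
          with c show False by blast
        qed
        with \<beta>(1) show ?thesis by blast
      qed simp
    qed
    with n[of lmax] cs bs \<phi> show ?thesis
      by (intro exI[of _ "(n, cs, bs, \<phi>)"]) (simp add: comp_def add.assoc)
  qed
  then obtain q where q: "\<And>k. lmax < fst (q k)"
    "\<And>k. set (fst (snd (q k))) \<subseteq> B \<union> a ` {(\<beta>, i, l). \<beta> \<notin> range m}"
    "\<And>k. set (fst (snd (snd (q k)))) \<subseteq> R k"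
    "\<And>k. is_formula L (1 + (fst (q k) + length (fst (snd (q k)))) + length (fst (snd (snd (q k))))) (snd (snd (snd (q k))))"
    "\<And>k z i. P k (case_option z (\<lambda>l. a (m k, i, l))) \<longleftrightarrow>
        sat M ([z] @ (map (\<lambda>l. a (m k, i, l)) [0..<fst (q k)] @ fst (snd (q k))) @ fst (snd (snd (q k)))) (snd (snd (snd (q k))))"
    by metis
  define len' cs bs \<phi> where "len' k = fst (q k)" and "cs k = fst (snd (q k))"
    and "bs k = fst (snd (snd (q k)))" and "\<phi> k = snd (snd (snd (q k)))" for k
  note q = q[folded len'_def cs_def bs_def \<phi>_def]
  define row where "row k i = map (\<lambda>l. a (m k, i, l)) [0..<len' k] @ cs k" for k i
  have "inp2_pattern L M 1 row bs \<phi>"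
    unfolding inp2_pattern_def
  proof (intro conjI allI)
    show "is_formula L (1 + length (row k 0) + length (bs k)) (\<phi> k)" for k
      using q(4)[of k] by (simp add: row_def)
    show "set (bs k) \<subseteq> (\<Union>j\<in>{..<k}. \<Union>i. set (row j i))" for k
    proof
      fix c assume "c \<in> set (bs k)"
      with q(3) obtain j i l where j: "j < k" "c = a (m j, i, l)" unfolding R_def by blast
      have "c = a (m j, i, min l lmax)" using j(2) len by simp
      moreover have "min l lmax < len' j" using q(1)[of j] by simp
      ultimately have "c \<in> set (row j i)" by (auto simp: row_def)
      with j(1) show "c \<in> (\<Union>j\<in>{..<k}. \<Union>i. set (row j i))" by blast
    qed
    show "mutually_indiscernible L M row"
      using mutually_indiscernible_rows[OF a \<open>inj m\<close> q(2), of len'] by (simp add: row_def[abs_def])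
    have P_row: "[z] \<in> solutions M 1 (\<phi> k) (row k i @ bs k) \<longleftrightarrow> P k (case_option z (\<lambda>l. a (m k, i, l)))"
      for k z i by (simp add: solutions_def row_def q(5))
    show "\<not> consistent M 1 (range (\<lambda>i. (\<phi> k, row k i @ bs k)))" for k
    proof
      assume "consistent M 1 (range (\<lambda>i. (\<phi> k, row k i @ bs k)))"
      moreover have "finite ((\<lambda>i. (\<phi> k, row k i @ bs k)) ` I k)"
        using step[of k] by blast
      ultimately obtain xs where "length xs = 1" "\<forall>i\<in>I k. xs \<in> solutions M 1 (\<phi> k) (row k i @ bs k)"
        unfolding consistent_def by (metis (no_types, lifting) case_prodD image_eqI image_mono subset_UNIV)
      moreover from this obtain z where "xs = [z]" by (metis One_nat_def length_0_conv length_Suc_conv)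
      ultimately show False using step6[of k] P_row by blast
    qed
    show "consistent M 1 (range (\<lambda>k. (\<phi> k, row k 0 @ bs k)))"
      unfolding consistent_def
    proof (intro allI impI)
      fix F assume F: "F \<subseteq> range (\<lambda>k. (\<phi> k, row k 0 @ bs k))" "finite F"
      from finite_subset_image[OF F(2,1)] obtain J where
        J: "finite J" "F = (\<lambda>k. (\<phi> k, row k 0 @ bs k)) ` J" by blast
      from J(1) obtain j where j: "\<And>k. k \<in> J \<Longrightarrow> k < j"
        unfolding finite_nat_set_iff_bounded by blast
      have "[X j] \<in> solutions M 1 (\<phi> k) (row k 0 @ bs k)" if "k \<in> J" for k
        unfolding P_row by (rule P_X[OF j[OF that]])
      then show "\<exists>xs. length xs = 1 \<and> (\<forall>(\<phi>, ps)\<in>F. xs \<in> solutions M 1 \<phi> ps)"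
        unfolding J(2) by (intro exI[of _ "[X j]"]) auto
    qed
  qed
  with assms(1) show False unfolding strong2_def by blast
qed

end

subsection \<open>Patterns in several variables\<close>

context countably_saturated
begin

text \<open>By compactness, \<open>blocked B a d \<alpha>\<close> means that row \<open>\<alpha>\<close> carries a formula, with parameters in \<open>B\<close>
  and the first column, that is true of \<open>d\<close> at column \<open>0\<close> and inconsistent along the row.\<close>

definition blocked :: "'a set \<Rightarrow> (nat \<times> nat \<times> nat \<Rightarrow> 'a) \<Rightarrow> (nat \<Rightarrow> 'a) \<Rightarrow> nat \<Rightarrow> bool" where
  "blocked B a d \<alpha> \<longleftrightarrow> (\<nexists>d'. \<forall>i. eqv (B \<union> a ` {(\<beta>, i, l). \<beta> < \<alpha> \<and> i = 0})
     (case_sum d (\<lambda>l. a (\<alpha>, 0, l))) (case_sum d' (\<lambda>l. a (\<alpha>, i, l))))"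

text \<open>Coordinates of \<open>d\<close> above \<open>n\<close> already lie in the base. Now a
  movable conjugate \<open>y\<close> of coordinate \<open>n\<close> joins the base, the array is
  replaced by one indiscernible over \<open>y\<close>, and the remaining coordinates are carried
  along by \<open>eqv_extend\<close>.\<close>

lemma fix_coordinate:
  fixes d :: "nat \<Rightarrow> 'a"
  assumes strong: "strong2 L M" and B: "countable B" and a: "mut_indisc B a"
    and blocked: "\<And>\<alpha>. blocked B a d \<alpha>"
    and len: "\<And>\<alpha> i l. a (\<alpha>, i, l) = a (\<alpha>, i, min l lmax)"
    and d: "\<And>j. n < j \<Longrightarrow> d j \<in> B"
  obtains B' a' d' where "countable B'" "mut_indisc B' a'" "\<And>\<alpha>. blocked B' a' d' \<alpha>"
    "\<And>\<alpha> i l. a' (\<alpha>, i, l) = a' (\<alpha>, i, min l lmax)" "\<And>j. n \<le> j \<Longrightarrow> d' j \<in> B'"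
proof -
  obtain N x' y where x': "eqv B (sel x' a (\<lambda>_. 0)) (sel (d n) a (\<lambda>_. 0))"
    and y: "\<forall>\<eta>. (\<forall>\<beta><N. \<eta> \<beta> = 0) \<longrightarrow> eqv (rows_below B a N) (sel y a \<eta>) (sel x' a (\<lambda>_. 0))"
    by (rule ex_movable[OF strong B a len])
  define b where "b = (\<lambda>(\<alpha>, i, l). a (N + \<alpha>, i, l))"
  let ?BN = "rows_below B a N"
  let ?B0 = "B \<union> a ` {(\<beta>, i, l). \<beta> < N \<and> i = 0}"
  have B0_BN: "?B0 \<subseteq> ?BN" by (auto simp: rows_below_def)
  have b: "mut_indisc ?BN b" unfolding b_def by (rule mut_indisc_shift[OF a])
  have countable_By: "countable (insert y ?BN)" using countable_rows_below[OF B] by simp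
  \<comment> \<open>Extraction over the larger base makes the rows indiscernible over
    \<open>y\<close> as well. The type over \<open>?BN\<close> is kept, since \<open>b\<close> was
    already indiscernible there.\<close>
  obtain b' where b': "mut_indisc (insert y ?BN) b'"
    and em0: "\<forall>P. Def (insert y ?BN) P \<longrightarrow> (\<forall>F. (\<forall>\<alpha>. strict_mono (F \<alpha>)) \<longrightarrow> P (thin F b)) \<longrightarrow> P b'"
    using extract_mut_indisc[OF countable_By, of b] by (elim exE conjE)
  have em: "P b'" if "Def (insert y ?BN) P" "\<And>F. (\<And>\<alpha>. strict_mono (F \<alpha>)) \<Longrightarrow> P (thin F b)" for P
    by (rule em0[THEN spec, THEN mp, THEN mp], rule that(1)) (use that(2) in simp)
  have b_b': "eqv ?BN b b'"
  proof (rule eqvI)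
    fix P assume P: "Def ?BN P" "P b"
    show "P b'"
    proof (rule em)
      show "Def (insert y ?BN) P" by (rule Def_mono[OF P(1)]) blast
      show "P (thin F b)" if "\<And>\<alpha>. strict_mono (F \<alpha>)" for F
        using eqv_iff[of ?BN "thin F b" b P] b that P unfolding mut_indisc_def by simp
    qed
  qed
  define shift where "shift = map_option (\<lambda>(\<alpha>, l :: nat). (N + \<alpha>, l))"
  have sel_shift: "(\<lambda>w. sel z a (\<lambda>_. 0) (shift w)) = sel z b (\<lambda>_. 0)" for z
    by (rule sel_eqI) (auto simp: shift_def b_def)
  \<comment> \<open>In every thinning of \<open>b\<close> the first column is a path through the
    rows from \<open>N\<close> on, and \<open>y\<close> has the required type with each such
    path.\<close>
  have sel_y: "eqv ?BN (sel x' b (\<lambda>_. 0)) (sel y b' (\<lambda>_. 0))"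
  proof (rule eqvI)
    fix P assume P: "Def ?BN P" "P (sel x' b (\<lambda>_. 0))"
    let ?g = "case_option (Inr y) (\<lambda>(\<alpha>, l). Inl (\<alpha>, 0 :: nat, l))"
    have g: "(\<lambda>w. case_sum E id (?g w)) = sel y E (\<lambda>_. 0)" for E
      by (rule sel_eqI) auto
    have "Def (insert y ?BN) (\<lambda>E. P (\<lambda>w. case_sum E id (?g w)))"
      by (rule Def_subst[OF P(1)]) (auto split: option.splits)
    then have D: "Def (insert y ?BN) (\<lambda>E. P (sel y E (\<lambda>_. 0)))" unfolding g .
    from D show "P (sel y b' (\<lambda>_. 0))"
    proof (rule em)
      fix F :: "nat \<Rightarrow> nat \<Rightarrow> nat"
      let ?\<eta> = "\<lambda>\<beta>. if \<beta> < N then 0 else F (\<beta> - N) 0"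
      have "eqv ?BN (sel y a ?\<eta>) (sel x' a (\<lambda>_. 0))" by (rule y[rule_format]) simp
      from eqv_reindex[OF this, of shift]
      have "eqv ?BN (\<lambda>w. sel y a ?\<eta> (shift w)) (sel x' b (\<lambda>_. 0))" unfolding sel_shift .
      moreover have "(\<lambda>w. sel y a ?\<eta> (shift w)) = sel y (thin F b) (\<lambda>_. 0)"
        by (rule sel_eqI) (auto simp: shift_def b_def)
      ultimately have "eqv ?BN (sel y (thin F b) (\<lambda>_. 0)) (sel x' b (\<lambda>_. 0))" by (simp only:)
      from eqv_iff[OF this P(1)] P(2) show "P (sel y (thin F b) (\<lambda>_. 0))" by blast
    qed
  qed
  \<comment> \<open>The choice of \<open>x'\<close> compares it with \<open>d n\<close> along the
    whole first column, so the part of that column below row \<open>N\<close> can be moved into the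
    parameters.\<close>
  have sel_d: "eqv ?B0 (sel (d n) b (\<lambda>_. 0)) (sel x' b (\<lambda>_. 0))"
  proof (rule eqvI)
    fix P assume P: "Def ?B0 P" "P (sel (d n) b (\<lambda>_. 0))"
    let ?W = "{Some (\<beta>, l) | \<beta> l. \<beta> < N}"
    have "a ` {(\<beta>, i, l). \<beta> < N \<and> i = 0} \<subseteq> sel (d n) a (\<lambda>_. 0) ` ?W"
    proof
      fix c assume "c \<in> a ` {(\<beta>, i, l). \<beta> < N \<and> i = 0}"
      then obtain \<beta> l where "\<beta> < N" "c = sel (d n) a (\<lambda>_. 0) (Some (\<beta>, l))" by auto
      then show "c \<in> sel (d n) a (\<lambda>_. 0) ` ?W" by blast
    qed
    from Def_abstract[OF P(1) this] obtain P' where P': "Def B P'"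
      "\<forall>e u'. (\<forall>w\<in>?W. u' w = sel (d n) a (\<lambda>_. 0) w) \<longrightarrow> P' (case_sum e u') = P e"
      by (elim exE conjE)
    have *: "P' (\<lambda>w. sel z a (\<lambda>_. 0) (case_sum shift id w)) = P (sel z b (\<lambda>_. 0))" for z
    proof -
      have "(\<lambda>w. sel z a (\<lambda>_. 0) (case_sum shift id w)) = case_sum (sel z b (\<lambda>_. 0)) (sel z a (\<lambda>_. 0))"
        unfolding sel_shift[symmetric] by (auto split: sum.splits)
      moreover have "P' (case_sum (sel z b (\<lambda>_. 0)) (sel z a (\<lambda>_. 0))) = P (sel z b (\<lambda>_. 0))"
        by (rule P'(2)[rule_format]) auto
      ultimately show ?thesis by (simp only:)
    qed
    have "Def B (\<lambda>E. P' (\<lambda>w. E (case_sum shift id w)))" by (rule Def_reindex[OF P'(1)])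
    from eqv_iff[OF x' this] P(2) show "P (sel x' b (\<lambda>_. 0))" unfolding * by blast
  qed
  have "eqv ?B0 (sel y b' (\<lambda>_. 0)) (sel (d n) b (\<lambda>_. 0))"
    by (rule eqv_sym, rule eqv_trans[OF sel_d eqv_mono[OF sel_y B0_BN]])
  moreover have countable_B0: "countable ?B0" using B by simp
  ultimately obtain d' where d': "eqv ?B0 (case_sum (sel y b' (\<lambda>_. 0)) d') (case_sum (sel (d n) b (\<lambda>_. 0)) d)"
    using eqv_extend by blast
  \<comment> \<open>Equality with the \<open>None\<close> entry and with constants of
    \<open>B\<close> belongs to the type, so coordinate \<open>n\<close> becomes \<open>y\<close>
    and the coordinates above it stay.\<close>
  have "d' n = y"
    using eqv_iff[OF d' Def_eq[of ?B0 "Inl None" "Inr n"]] by simp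
  have "d' j = d j" if "n < j" for j
    using eqv_iff[OF d' Def_eq_const[of "d j" ?B0 "Inr j"]] d[OF that] by simp
  moreover have "d j \<in> ?BN" if "n < j" for j
    using d[OF that] base_subset_rows_below by blast
  ultimately have d'_B: "d' j \<in> insert y ?BN" if "n \<le> j" for j
    using that \<open>d' n = y\<close> by (cases "j = n") auto
  have len': "b' (\<alpha>, i, l) = b' (\<alpha>, i, min l lmax)" for \<alpha> i l
    by (rule em[OF Def_eq]) (use len in \<open>simp add: b_def\<close>)
  \<comment> \<open>If \<open>d''\<close> unblocked row \<open>\<alpha>\<close> of
    \<open>b'\<close>, compactness would give an \<open>e\<close> unblocking row
    \<open>N + \<alpha>\<close> of \<open>a\<close>: solvability of each finite part is a condition
    \<open>\<Phi>\<close> on the array that passes from \<open>b'\<close> to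
    \<open>b\<close>.\<close>
  have "blocked (insert y ?BN) b' d' \<alpha>" for \<alpha>
    unfolding blocked_def
  proof
    let ?E = "?B0 \<union> b ` {(\<beta>, i, l). \<beta> < \<alpha> \<and> i = 0}"
    let ?E' = "insert y ?BN \<union> b' ` {(\<beta>, i, l). \<beta> < \<alpha> \<and> i = 0}"
    assume "\<exists>d''. \<forall>i. eqv ?E' (case_sum d' (\<lambda>l. b' (\<alpha>, 0, l))) (case_sum d'' (\<lambda>l. b' (\<alpha>, i, l)))"
    then obtain d'' where d'': "\<And>i. eqv ?E' (case_sum d' (\<lambda>l. b' (\<alpha>, 0, l))) (case_sum d'' (\<lambda>l. b' (\<alpha>, i, l)))"
      by blast
    define K where "K = {(P, i :: nat). Def ?E P \<and> P (case_sum d (\<lambda>l. b (\<alpha>, 0, l)))}"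
    define f where "f = (\<lambda>(P, i) (e :: nat \<Rightarrow> 'a). P (case_sum e (\<lambda>l :: nat. b (\<alpha>, i, l))) :: bool)"
    have "countable (?E \<union> range b)" using countable_B0 by simp
    then obtain e where e: "\<forall>Q\<in>f ` K. Q e"
    proof (rule realize)
      fix Q assume "Q \<in> f ` K"
      then show "Def (?E \<union> range b) Q" by (auto simp: f_def K_def intro: Def_fixed_right)
    next
      fix G assume G: "finite G" "G \<subseteq> f ` K"
      from finite_subset_image[OF G] obtain K' where K': "K' \<subseteq> K" "finite K'" "G = f ` K'" by blast
      let ?W = "{(\<beta> :: nat, l :: nat). \<beta> < \<alpha>}"
      let ?fc = "\<lambda>E (\<beta>, l). E (\<beta>, 0 :: nat, l)"
      \<comment> \<open>Parameters in the first column of \<open>b\<close> become variables, so that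
        the conditions \<open>T k\<close> have parameters in \<open>?B0\<close> alone and can be
        compared at \<open>b\<close> and \<open>b'\<close>.\<close>
      have "\<forall>k\<in>K'. \<exists>P'. Def ?B0 P' \<and>
        (\<forall>e u. (\<forall>w\<in>?W. u w = ?fc b w) \<longrightarrow> P' (case_sum e u) = fst k e) \<and>
        (\<forall>e u1 u2. (\<forall>w\<in>?W. u1 w = u2 w) \<longrightarrow> P' (case_sum e u1) = P' (case_sum e u2))"
      proof
        fix k assume "k \<in> K'"
        with K'(1) have "Def ?E (fst k)" by (auto simp: K_def)
        moreover have "b ` {(\<beta>, i, l). \<beta> < \<alpha> \<and> i = 0} \<subseteq> ?fc b ` ?W" by force
        ultimately show "\<exists>P'. Def ?B0 P' \<and>
          (\<forall>e u. (\<forall>w\<in>?W. u w = ?fc b w) \<longrightarrow> P' (case_sum e u) = fst k e) \<and>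
          (\<forall>e u1 u2. (\<forall>w\<in>?W. u1 w = u2 w) \<longrightarrow> P' (case_sum e u1) = P' (case_sum e u2))"
          by (rule Def_abstract)
      qed
      then obtain T where T: "\<forall>k\<in>K'. Def ?B0 (T k) \<and>
        (\<forall>e u. (\<forall>w\<in>?W. u w = ?fc b w) \<longrightarrow> T k (case_sum e u) = fst k e) \<and>
        (\<forall>e u1 u2. (\<forall>w\<in>?W. u1 w = u2 w) \<longrightarrow> T k (case_sum e u1) = T k (case_sum e u2))"
        by (rule bchoice[THEN exE])
      have T1: "Def ?B0 (T k)" and T2: "T k (case_sum e (?fc b)) = fst k e"
        and T3: "\<And>u1 u2. (\<forall>w\<in>?W. u1 w = u2 w) \<Longrightarrow> T k (case_sum e u1) = T k (case_sum e u2)"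
        if "k \<in> K'" for k e
        using T[rule_format, OF that] by auto
      define \<Phi> where "\<Phi> E \<longleftrightarrow> (\<exists>z :: nat \<Rightarrow> 'a. \<forall>k\<in>K'.
        T k (case_sum (case_sum z (\<lambda>l. E (\<alpha>, snd k, l))) (?fc E)))" for E
      have "Def ?B0 \<Phi>"
      proof -
        let ?g = "\<lambda>k :: _ \<times> nat. case_sum (case_sum (Inr :: nat \<Rightarrow> (nat \<times> nat \<times> nat) + nat) (\<lambda>l. Inl (\<alpha>, snd k, l)))
          (\<lambda>(\<beta>, l). Inl (\<beta>, 0, l))"
        have "Def ?B0 (\<lambda>E. \<forall>k\<in>K'. T k (\<lambda>w. E (?g k w)))"
          using K'(2) by (rule Def_ball) (rule Def_reindex[OF T1])
        then have "Def ?B0 (\<lambda>E. \<exists>z. \<forall>k\<in>K'. T k (\<lambda>w. case_sum E z (?g k w)))"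
          by (rule Def_ex)
        moreover have "(\<lambda>w. case_sum E z (?g k w)) =
            case_sum (case_sum z (\<lambda>l. E (\<alpha>, snd k, l))) (?fc E)"
          for E and z :: "nat \<Rightarrow> 'a" and k :: "((nat + nat \<Rightarrow> 'a) \<Rightarrow> bool) \<times> nat"
          by (auto split: sum.splits)
        ultimately show ?thesis by (simp only: \<Phi>_def[abs_def])
      qed
      moreover have "\<Phi> b'"
        unfolding \<Phi>_def
      proof (intro exI ballI)
        fix k assume k: "k \<in> K'"
        obtain P i where [simp]: "k = (P, i)" by (cases k)
        have "T k (case_sum (case_sum d (\<lambda>l. b (\<alpha>, 0, l))) (?fc b))"
          unfolding T2[OF k] using K'(1) k by (auto simp: K_def)
        moreover
        let ?h = "case_sum (case_sum Inr (\<lambda>l. Inl (Some (\<alpha>, l)))) (\<lambda>(\<beta>, l). Inl (Some (\<beta>, l)))"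
        have h: "(\<lambda>w. case_sum (sel z E (\<lambda>_. 0)) e (?h w)) = case_sum (case_sum e (\<lambda>l. E (\<alpha>, 0, l))) (?fc E)"
          for z :: 'a and E and e :: "nat \<Rightarrow> 'a"
          by (auto split: sum.splits)
        from eqv_iff[OF d' Def_reindex[OF T1[OF k], of ?h]]
        have "T k (case_sum (case_sum d' (\<lambda>l. b' (\<alpha>, 0, l))) (?fc b')) \<longleftrightarrow>
          T k (case_sum (case_sum d (\<lambda>l. b (\<alpha>, 0, l))) (?fc b))" unfolding h .
        ultimately have 1: "T k (case_sum (case_sum d' (\<lambda>l. b' (\<alpha>, 0, l))) (?fc b'))" by blast
        \<comment> \<open>Entries outside \<open>?W\<close> are not read by \<open>T k\<close>;
          setting them to \<open>y\<close> keeps all parameters in \<open>?E'\<close>.\<close>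
        let ?u = "\<lambda>w. if w \<in> ?W then ?fc b' w else y"
        have u: "T k (case_sum e (?fc b')) = T k (case_sum e ?u)" for e
          by (rule T3[OF k]) auto
        have "range ?u \<subseteq> ?E'" by (auto simp: image_iff split: if_splits)
        then have "Def ?E' (\<lambda>e. T k (case_sum e ?u))"
          using B0_BN by (intro Def_fixed_right[OF T1[OF k]]) auto
        from eqv_iff[OF d''[of i] this] 1
        show "T k (case_sum (case_sum d'' (\<lambda>l. b' (\<alpha>, snd k, l))) (?fc b'))"
          unfolding u by simp
      qed
      ultimately have "\<Phi> b" using eqv_iff[OF eqv_mono[OF b_b' B0_BN]] by blast
      then obtain z where "\<forall>k\<in>K'. T k (case_sum (case_sum z (\<lambda>l. b (\<alpha>, snd k, l))) (?fc b))"
        unfolding \<Phi>_def by blast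
      then have "\<forall>k\<in>K'. fst k (case_sum z (\<lambda>l. b (\<alpha>, snd k, l)))" using T2 by simp
      then show "\<exists>e. \<forall>Q\<in>G. Q e"
        unfolding K'(3) by (intro exI[of _ z]) (simp add: f_def case_prod_unfold)
    qed
    have eqv_E: "eqv ?E (case_sum d (\<lambda>l. b (\<alpha>, 0, l))) (case_sum e (\<lambda>l. b (\<alpha>, i, l)))" for i
    proof (rule eqvI)
      fix P assume "Def ?E P" "P (case_sum d (\<lambda>l. b (\<alpha>, 0, l)))"
      then have "(P, i) \<in> K" by (simp add: K_def)
      with e have "f (P, i) e" by blast
      then show "P (case_sum e (\<lambda>l. b (\<alpha>, i, l)))" by (simp add: f_def)
    qed
    have sub: "B \<union> a ` {(\<beta>, i, l). \<beta> < N + \<alpha> \<and> i = 0} \<subseteq> ?E"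
    proof -
      have "a (\<beta>, 0, l) \<in> b ` {(\<beta>, i, l). \<beta> < \<alpha> \<and> i = 0}" if "\<beta> < N + \<alpha>" "\<not> \<beta> < N" for \<beta> l
        by (rule image_eqI[of _ _ "(\<beta> - N, 0, l)"]) (use that in \<open>auto simp: b_def\<close>)
      then show ?thesis by blast
    qed
    have b_apply: "b (\<alpha>, i, l) = a (N + \<alpha>, i, l)" for i l by (simp add: b_def)
    have "eqv (B \<union> a ` {(\<beta>, i, l). \<beta> < N + \<alpha> \<and> i = 0})
      (case_sum d (\<lambda>l. a (N + \<alpha>, 0, l))) (case_sum e (\<lambda>l. a (N + \<alpha>, i, l)))" for i
      using eqv_mono[OF eqv_E[of i] sub] by (simp only: b_apply)
    with blocked[of "N + \<alpha>"] show False unfolding blocked_def by blast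
  qed
  from countable_By b' this len' d'_B show ?thesis by (rule that)
qed

text \<open>Induction on the number of coordinates outside the base. With none left, row
  \<open>0\<close> cannot be blocked: it is indiscernible over a base containing \<open>d\<close>,
  so \<open>d\<close> itself serves for every column.\<close>

theorem no_blocked_array:
  fixes d :: "nat \<Rightarrow> 'a"
  assumes strong: "strong2 L M"
  shows "countable B \<Longrightarrow> mut_indisc B a \<Longrightarrow> (\<And>\<alpha>. blocked B a d \<alpha>) \<Longrightarrow>
    (\<And>\<alpha> i l. a (\<alpha>, i, l) = a (\<alpha>, i, min l lmax)) \<Longrightarrow> (\<And>j. n \<le> j \<Longrightarrow> d j \<in> B) \<Longrightarrow> False"
proof (induction n arbitrary: B a d)
  case 0
  have "eqv (B \<union> a ` {(\<beta>, i, l). \<beta> < 0 \<and> i = 0})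
     (case_sum d (\<lambda>l. a (0, 0, l))) (case_sum d (\<lambda>l. a (0, i, l)))" for i
  proof (rule eqvI)
    fix P assume P: "Def (B \<union> a ` {(\<beta>, i, l). \<beta> < 0 \<and> i = 0}) P" "P (case_sum d (\<lambda>l. a (0, 0, l)))"
    then have "Def (B \<union> a ` {}) (\<lambda>e. P (case_sum d e))"
      using "0.prems"(5) by (intro Def_fixed_left[OF P(1)]) auto
    \<comment> \<open>The thinning by \<open>t + i\<close> carries column \<open>0\<close> to column
      \<open>i\<close>.\<close>
    from mut_indisc_params[OF "0.prems"(2) _ this, of "\<lambda>_ t. t + i" "\<lambda>l. (0, 0, l)"] P(2)
    show "P (case_sum d (\<lambda>l. a (0, i, l)))" by (simp add: strict_mono_def)
  qed
  with "0.prems"(3)[of 0] show False unfolding blocked_def by blast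
next
  case (Suc n)
  obtain B' a' d' where "countable B'" "mut_indisc B' a'" "\<And>\<alpha>. blocked B' a' d' \<alpha>"
    "\<And>\<alpha> i l. a' (\<alpha>, i, l) = a' (\<alpha>, i, min l lmax)" "\<And>j. n \<le> j \<Longrightarrow> d' j \<in> B'"
    using fix_coordinate[OF strong Suc.prems(1-4), of n] Suc.prems(5) Suc_leI by metis
  then show False by (rule Suc.IH)
qed

end

section \<open>Paths through an array, and patterns whose parameters follow a path\<close>

definition path :: "(nat \<times> nat \<times> nat \<Rightarrow> 'a) \<Rightarrow> (nat \<Rightarrow> nat) \<Rightarrow> nat \<times> nat \<Rightarrow> 'a" where
  "path a \<eta> = (\<lambda>(\<beta>, l). a (\<beta>, \<eta> \<beta>, l))"

lemma path_apply: "path a \<eta> (\<beta>, l) = a (\<beta>, \<eta> \<beta>, l)"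
  by (simp add: path_def)

lemma path_thin: "path (thin F a) \<eta> = path a (\<lambda>\<beta>. F \<beta> (\<eta> \<beta>))"
  by (auto simp: fun_eq_iff path_apply)

context countably_saturated
begin

lemma Def_ex_path:
  fixes w :: "'i \<Rightarrow> (nat + nat \<times> nat \<Rightarrow> 'a) \<Rightarrow> bool"
  assumes "finite I" and "\<And>i. i \<in> I \<Longrightarrow> Def B (w i)"
  shows "Def B (\<lambda>E. \<exists>x. \<forall>i\<in>I. w i (case_sum x (path E (\<eta> i))))"
proof -
  let ?g = "\<lambda>i. case_sum Inr (\<lambda>(\<beta>, l). Inl (\<beta>, \<eta> i \<beta>, l))"
  have "Def B (\<lambda>E. \<forall>i\<in>I. w i (\<lambda>v. E (?g i v)))"
    using assms(1) by (rule Def_ball) (rule Def_reindex[OF assms(2)])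
  then have "Def B (\<lambda>E. \<exists>x. \<forall>i\<in>I. w i (\<lambda>v. case_sum E x (?g i v)))"
    by (rule Def_ex)
  moreover have "(\<lambda>v. case_sum E x (?g i v)) = case_sum x (path E (\<eta> i))"
    for E :: "nat \<times> nat \<times> nat \<Rightarrow> 'a" and x :: "nat \<Rightarrow> 'a" and i
    by (auto simp: path_apply split: sum.splits)
  ultimately show ?thesis by (simp only:)
qed

text \<open>The hypotheses hold for coset patterns without any indiscernibility; in contrast to
  \<^const>\<open>inp2_pattern\<close> the parameters \<open>b\<^sub>\<alpha>\<close> follow the path \<open>\<eta>\<close> through the earlier rows.\<close>

theorem no_path_pattern:
  fixes w :: "nat \<Rightarrow> (nat + nat \<times> nat \<Rightarrow> 'a) \<Rightarrow> bool"
  assumes strong: "strong2 L M" and B: "countable B" and b0: "b0 \<in> B"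
    and w: "\<And>\<alpha>. Def B (w \<alpha>)"
    and rows: "\<And>\<alpha>. depends (Inl ` {..<n} \<union> Inr ` {(\<beta>, l). \<beta> \<le> \<alpha>}) (w \<alpha>)"
    and len: "\<And>\<alpha> i l. a (\<alpha>, i, l) = a (\<alpha>, i, min l lmax)"
    and consistent: "\<And>\<eta> K. \<exists>x. \<forall>\<alpha><K. w \<alpha> (case_sum x (path a \<eta>))"
    and inconsistent: "\<And>\<alpha> \<eta> i j. i \<noteq> j \<Longrightarrow>
      \<nexists>x. w \<alpha> (case_sum x (path a (\<eta>(\<alpha> := i)))) \<and> w \<alpha> (case_sum x (path a (\<eta>(\<alpha> := j))))"
  shows False
proof -
  obtain a' where a': "mut_indisc B a'"
    and em0: "\<forall>P. Def B P \<longrightarrow> (\<forall>F. (\<forall>\<alpha>. strict_mono (F \<alpha>)) \<longrightarrow> P (thin F a)) \<longrightarrow> P a'"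
    using extract_mut_indisc[OF B, of a] by (elim exE conjE)
  have em: "P a'" if "Def B P" "\<And>F. (\<And>\<alpha>. strict_mono (F \<alpha>)) \<Longrightarrow> P (thin F a)" for P
    by (rule em0[THEN spec, THEN mp, THEN mp], rule that(1)) (use that(2) in simp)
  have len': "a' (\<alpha>, i, l) = a' (\<alpha>, i, min l lmax)" for \<alpha> i l
    by (rule em[OF Def_eq]) (use len in simp)
  have consistent': "\<exists>x. \<forall>\<alpha>\<in>{..<K}. w \<alpha> (case_sum x (path a' (\<lambda>_. 0)))" for K
  proof (rule em)
    show "Def B (\<lambda>E. \<exists>x. \<forall>\<alpha>\<in>{..<K}. w \<alpha> (case_sum x (path E (\<lambda>_. 0))))"
      by (intro Def_ex_path w) simp
    show "\<exists>x. \<forall>\<alpha>\<in>{..<K}. w \<alpha> (case_sum x (path (thin F a) (\<lambda>_. 0)))" for F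
      using consistent[of K "\<lambda>\<beta>. F \<beta> 0"] unfolding path_thin by (simp add: Ball_def)
  qed
  \<comment> \<open>Columns \<open>0\<close> and \<open>1\<close> suffice: any two distinct columns
    of \<open>a\<close> are incompatible, and strictly increasing thinnings keep columns
    distinct.\<close>
  have inconsistent': "\<nexists>x. \<forall>i\<in>{0, 1}. w \<alpha> (case_sum x (path a' ((\<lambda>_. 0)(\<alpha> := i))))" for \<alpha>
  proof (rule em)
    show "Def B (\<lambda>E. \<nexists>x. \<forall>i\<in>{0, 1}. w \<alpha> (case_sum x (path E ((\<lambda>_. 0)(\<alpha> := i)))))"
      by (intro Def_not Def_ex_path w) simp
    fix F :: "nat \<Rightarrow> nat \<Rightarrow> nat" assume F: "\<And>\<alpha>. strict_mono (F \<alpha>)"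
    have "F \<alpha> 0 \<noteq> F \<alpha> 1" using F[of \<alpha>] by (simp add: strict_mono_eq)
    moreover have "path (thin F a) ((\<lambda>_. 0)(\<alpha> := i)) = path a ((\<lambda>\<beta>. F \<beta> 0)(\<alpha> := F \<alpha> i))" for i
      by (auto simp: fun_eq_iff path_apply)
    ultimately show "\<nexists>x. \<forall>i\<in>{0, 1}. w \<alpha> (case_sum x (path (thin F a) ((\<lambda>_. 0)(\<alpha> := i))))"
      using inconsistent[of "F \<alpha> 0" "F \<alpha> 1" \<alpha> "\<lambda>\<beta>. F \<beta> 0"] by simp
  qed
  define f where "f \<alpha> e = w \<alpha> (case_sum e (path a' (\<lambda>_. 0)))" for \<alpha> e
  \<comment> \<open>The conditions read only the first \<open>n\<close> coordinates. Setting the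
    others to the base element \<open>b0\<close> lets the induction on coordinates start at
    \<open>n\<close>.\<close>
  define h where "h j e \<longleftrightarrow> e j = b0" for j :: nat and e :: "nat \<Rightarrow> 'a"
  have f_Def: "Def (B \<union> range a') (f \<alpha>)" for \<alpha>
    unfolding f_def[abs_def] by (rule Def_fixed_right[OF w]) (auto simp: path_apply)
  have h_Def: "Def (B \<union> range a') (h j)" for j
    unfolding h_def[abs_def] by (rule Def_eq_const) (use b0 in simp)
  have "countable (B \<union> range a')" using B by simp
  then obtain d where d: "\<forall>P\<in>range f \<union> h ` {n..}. P d"
  proof (rule realize)
    show "Def (B \<union> range a') P" if "P \<in> range f \<union> h ` {n..}" for P
      using that f_Def h_Def by auto
  next
    fix F assume F: "finite F" "F \<subseteq> range f \<union> h ` {n..}"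
    then have "finite (F \<inter> range f)" by simp
    from finite_subset_image[OF this, of f UNIV] obtain J where J: "finite J" "F \<inter> range f = f ` J" by blast
    from J(1) obtain K where K: "J \<subseteq> {..<K}"
      unfolding finite_nat_set_iff_bounded by blast
    from consistent'[of K] obtain x where x: "\<forall>\<alpha>\<in>{..<K}. w \<alpha> (case_sum x (path a' (\<lambda>_. 0)))" ..
    let ?x = "\<lambda>j. if j < n then x j else b0"
    have "f \<alpha> ?x" if "\<alpha> \<in> J" for \<alpha>
    proof -
      have "f \<alpha> ?x = w \<alpha> (case_sum x (path a' (\<lambda>_. 0)))"
        unfolding f_def by (rule dependsD[OF rows]) auto
      with x K that show ?thesis by blast
    qed
    moreover have "h j ?x" if "n \<le> j" for j using that by (simp add: h_def)
    moreover have "F \<subseteq> f ` J \<union> h ` {n..}" using F(2) J(2) by blast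
    ultimately show "\<exists>e. \<forall>P\<in>F. P e" by (intro exI[of _ ?x]) blast
  qed
  have d_w: "w \<alpha> (case_sum d (path a' (\<lambda>_. 0)))" for \<alpha>
    using bspec[OF d UnI1[OF rangeI[of f \<alpha>]]] by (simp only: f_def)
  have d_b0: "d j = b0" if "n \<le> j" for j
    using bspec[OF d UnI2[OF imageI[of j "{n..}" h]]] that by (simp add: h_def)
  have "blocked B a' d \<alpha>" for \<alpha>
    unfolding blocked_def
  proof
    let ?E = "B \<union> a' ` {(\<beta>, i, l). \<beta> < \<alpha> \<and> i = 0}"
    assume "\<exists>d'. \<forall>i. eqv ?E (case_sum d (\<lambda>l. a' (\<alpha>, 0, l))) (case_sum d' (\<lambda>l. a' (\<alpha>, i, l)))"
    then obtain d' where d': "\<And>i. eqv ?E (case_sum d (\<lambda>l. a' (\<alpha>, 0, l))) (case_sum d' (\<lambda>l. a' (\<alpha>, i, l)))"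
      by blast
    \<comment> \<open>Earlier rows enter as parameters in column \<open>0\<close> and row
      \<open>\<alpha>\<close> stays variable; later rows are not read by \<open>w \<alpha>\<close>
      and get the dummy value \<open>b0\<close>.\<close>
    let ?g = "case_sum (\<lambda>j. Inl (Inl j)) (\<lambda>(\<beta>, l). if \<beta> < \<alpha> then Inr (a' (\<beta>, 0, l)) else if \<beta> = \<alpha> then Inl (Inr l) else Inr b0)"
    have D: "Def ?E (\<lambda>e. w \<alpha> (\<lambda>v. case_sum e id (?g v)))"
      by (rule Def_subst[OF w]) (use b0 in \<open>auto split: sum.splits if_splits\<close>)
    have g: "w \<alpha> (\<lambda>v. case_sum (case_sum x (\<lambda>l. a' (\<alpha>, i, l))) id (?g v)) = w \<alpha> (case_sum x (path a' ((\<lambda>_. 0)(\<alpha> := i))))"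
      for x i by (rule dependsD[OF rows]) (auto simp: path_apply)
    have "w \<alpha> (case_sum d' (path a' ((\<lambda>_. 0)(\<alpha> := i))))" for i
    proof -
      have "(\<lambda>_. 0)(\<alpha> := 0) = (\<lambda>_ :: nat. 0 :: nat)" by auto
      with d_w[of \<alpha>] have "w \<alpha> (case_sum d (path a' ((\<lambda>_. 0)(\<alpha> := 0))))" by (simp only:)
      with eqv_iff[OF d'[of i] D] show ?thesis unfolding g by blast
    qed
    with inconsistent'[of \<alpha>] show False by blast
  qed
  from no_blocked_array[OF strong B a' this len', of n] d_b0 b0 show False by simp
qed

end

subsection \<open>Chains of cosets in a definable group\<close>

text \<open>Finitely many conditions that hold eventually along the approximations
  \<open>A K\<close> hold together at some \<open>K\<close>, so compactness yields an exact
  solution.\<close>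

lemma (in countably_saturated) realize_eventually:
  fixes A :: "nat \<Rightarrow> 'v::countable \<Rightarrow> 'a"
  assumes "countable B" and "\<And>P. P \<in> \<P> \<Longrightarrow> Def B P"
    and ev: "\<And>P. P \<in> \<P> \<Longrightarrow> \<forall>\<^sub>F K in sequentially. P (A K)"
  obtains e where "\<forall>P\<in>\<P>. P e"
proof -
  obtain e where "\<forall>P\<in>\<P>. P e"
  proof (rule realize[OF assms(1,2)])
    fix F assume F: "finite F" "F \<subseteq> \<P>"
    have "\<forall>\<^sub>F K in sequentially. \<forall>P\<in>F. P (A K)"
      using F(1) by (rule eventually_ball_finite) (use ev F(2) in auto)
    then obtain K where "\<forall>P\<in>F. P (A K)"
      unfolding eventually_sequentially by auto
    then show "\<exists>e. \<forall>P\<in>F. P e" by (rule exI[where x = "A K"])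
  qed
  then show ?thesis by (rule that)
qed

locale definable_group_in = countably_saturated L M + group G
  for L :: "('f, 'r) language" and M :: "('f, 'r, 'a) struct" and G :: "'a list monoid" (structure) +
  fixes n m :: nat and \<phi> \<mu> :: "('f, 'r) fm" and ms :: "'a list"
  assumes length_carrier: "x \<in> carrier G \<Longrightarrow> length x = n"
    and \<mu>: "is_formula L (n + n + n + length ms) \<mu>"
    and graph: "{x @ y @ (x \<otimes> y) | x y. x \<in> carrier G \<and> y \<in> carrier G} = solutions M (n + n + n) \<mu> ms"
    and \<phi>: "is_formula L (n + m) \<phi>"
begin

abbreviation tup :: "(nat \<Rightarrow> 'a) \<Rightarrow> 'a list" where
  "tup z \<equiv> map z [0..<n]"

text \<open>Layout of a row: the first \<open>n\<close> entries form a group element, the next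
  \<open>m\<close> the parameter of a subgroup.\<close>

abbreviation elt :: "(nat \<times> nat \<Rightarrow> 'a) \<Rightarrow> nat \<Rightarrow> 'a list" where
  "elt p \<alpha> \<equiv> map (\<lambda>l. p (\<alpha>, l)) [0..<n]"

abbreviation sbg :: "(nat \<times> nat \<Rightarrow> 'a) \<Rightarrow> nat \<Rightarrow> 'a list set" where
  "sbg p \<alpha> \<equiv> solutions M n \<phi> (map (\<lambda>l. p (\<alpha>, n + l)) [0..<m])"

lemma tup_nth: "length xs = n \<Longrightarrow> tup ((!) xs) = xs"
  using map_nth[of xs] by simp

lemma graph_iff:
  assumes "length x = n" "length y = n"
  shows "x @ y @ z \<in> solutions M (n + n + n) \<mu> ms \<longleftrightarrow> x \<in> carrier G \<and> y \<in> carrier G \<and> z = x \<otimes> y"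
proof
  assume "x @ y @ z \<in> solutions M (n + n + n) \<mu> ms"
  then obtain x' y' where *: "x @ y @ z = x' @ y' @ (x' \<otimes> y')" "x' \<in> carrier G" "y' \<in> carrier G"
    unfolding graph[symmetric] by blast
  moreover have "length x = length x'" "length y = length y'"
    using assms *(2,3) length_carrier by simp_all
  ultimately show "x \<in> carrier G \<and> y \<in> carrier G \<and> z = x \<otimes> y" by simp
qed (use graph in blast)

text \<open>New factors are multiplied on the left because right cosets are used: factors from rows
  after \<open>\<alpha>\<close> can then be absorbed into the subgroup of row
  \<open>\<alpha>\<close>.\<close>

primrec chain :: "(nat \<times> nat \<Rightarrow> 'a) \<Rightarrow> nat \<Rightarrow> 'a list" where
  "chain p 0 = \<one>"
| "chain p (Suc \<alpha>) = elt p \<alpha> \<otimes> chain p \<alpha>"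

text \<open>Definable form of \<open>chain\<close>: the left part of the assignment is the path, the
  right part the product, and each previous partial product is quantified by means of the graph of
  multiplication.\<close>

primrec is_chain :: "nat \<Rightarrow> ((nat \<times> nat) + nat \<Rightarrow> 'a) \<Rightarrow> bool" where
  "is_chain 0 = (\<lambda>e. \<forall>l\<in>{..<n}. e (Inr l) = \<one> ! l)"
| "is_chain (Suc \<alpha>) = (\<lambda>e. \<exists>q. is_chain \<alpha> (case_sum (\<lambda>v. e (Inl v)) q) \<and>
    map (\<lambda>l. e (Inl (\<alpha>, l))) [0..<n] @ tup q @ map (\<lambda>l. e (Inr l)) [0..<n] \<in> solutions M (n + n + n) \<mu> ms)"

lemma chain_closed: "(\<And>\<beta>. \<beta> < \<alpha> \<Longrightarrow> elt p \<beta> \<in> carrier G) \<Longrightarrow> chain p \<alpha> \<in> carrier G"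
  by (induction \<alpha>) auto

lemma chain_cong: "(\<And>\<beta>. \<beta> < \<alpha> \<Longrightarrow> elt p \<beta> = elt p' \<beta>) \<Longrightarrow> chain p \<alpha> = chain p' \<alpha>"
proof (induction \<alpha>)
  case (Suc \<alpha>)
  have "chain p \<alpha> = chain p' \<alpha>" by (rule Suc.IH) (rule Suc.prems, simp)
  moreover have "elt p \<alpha> = elt p' \<alpha>" by (rule Suc.prems) simp
  ultimately show ?case by (simp only: chain.simps)
qed simp

lemma is_chain_iff:
  "(\<And>\<beta>. \<beta> < \<alpha> \<Longrightarrow> elt p \<beta> \<in> carrier G) \<Longrightarrow> is_chain \<alpha> (case_sum p z) \<longleftrightarrow> tup z = chain p \<alpha>"
proof (induction \<alpha> arbitrary: z)
  case 0
  show ?case using length_carrier[OF one_closed] by (auto simp: list_eq_iff_nth_eq)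
next
  case (Suc \<alpha>)
  then have IH: "is_chain \<alpha> (case_sum p q) \<longleftrightarrow> tup q = chain p \<alpha>" for q by simp
  have closed: "chain p \<alpha> \<in> carrier G" "elt p \<alpha> \<in> carrier G" using Suc.prems by (auto intro: chain_closed)
  have "(\<exists>q. tup q = chain p \<alpha> \<and> elt p \<alpha> @ tup q @ tup z \<in> solutions M (n + n + n) \<mu> ms) \<longleftrightarrow>
      tup z = chain p (Suc \<alpha>)"
  proof
    assume "tup z = chain p (Suc \<alpha>)"
    with closed show "\<exists>q. tup q = chain p \<alpha> \<and> elt p \<alpha> @ tup q @ tup z \<in> solutions M (n + n + n) \<mu> ms"
      by (intro exI[of _ "(!) (chain p \<alpha>)"]) (simp add: tup_nth length_carrier graph_iff)
  next
    assume "\<exists>q. tup q = chain p \<alpha> \<and> elt p \<alpha> @ tup q @ tup z \<in> solutions M (n + n + n) \<mu> ms"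
    then show "tup z = chain p (Suc \<alpha>)" by (auto simp: graph_iff)
  qed
  then show ?case by (simp add: IH)
qed

lemma depends_is_chain: "depends (Inl ` {(\<beta>, l). \<beta> < \<alpha>} \<union> Inr ` {..<n}) (is_chain \<alpha>)"
proof (induction \<alpha>)
  case 0
  show ?case by (auto simp: depends_def)
next
  case (Suc \<alpha>)
  show ?case
    unfolding depends_def
  proof (intro allI impI)
    fix e e' :: "(nat \<times> nat) + nat \<Rightarrow> 'a"
    assume e: "\<forall>v\<in>Inl ` {(\<beta>, l). \<beta> < Suc \<alpha>} \<union> Inr ` {..<n}. e v = e' v"
    have "is_chain \<alpha> (case_sum (\<lambda>v. e (Inl v)) q) = is_chain \<alpha> (case_sum (\<lambda>v. e' (Inl v)) q)" for q
      by (rule dependsD[OF Suc]) (use e in auto)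
    moreover have "map (\<lambda>l. e (Inl (\<alpha>, l))) [0..<n] = map (\<lambda>l. e' (Inl (\<alpha>, l))) [0..<n]"
      "map (\<lambda>l. e (Inr l)) [0..<n] = map (\<lambda>l. e' (Inr l)) [0..<n]" using e by auto
    ultimately show "is_chain (Suc \<alpha>) e = is_chain (Suc \<alpha>) e'" by (simp only: is_chain.simps)
  qed
qed

text \<open>\<open>x\<close> lies in the coset \<open>H\<^sub>\<alpha> c\<^sub>\<alpha> \<cdots> c\<^sub>0\<close>, where \<open>H\<^sub>\<alpha>\<close> and the \<open>c\<^sub>\<beta>\<close> are read off a path.\<close>

definition in_coset :: "nat \<Rightarrow> (nat + nat \<times> nat \<Rightarrow> 'a) \<Rightarrow> bool" where
  "in_coset \<alpha> e \<longleftrightarrow> (\<exists>z. is_chain (Suc \<alpha>) (case_sum (\<lambda>v. e (Inr v)) (\<lambda>l. z (Inr l))) \<and>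
    tup (\<lambda>l. z (Inl l)) \<in> sbg (\<lambda>v. e (Inr v)) \<alpha> \<and>
    tup (\<lambda>l. z (Inl l)) @ tup (\<lambda>l. z (Inr l)) @ tup (\<lambda>l. e (Inl l)) \<in> solutions M (n + n + n) \<mu> ms)"

lemma in_coset_iff:
  assumes "\<And>\<beta>. \<beta> \<le> \<alpha> \<Longrightarrow> elt p \<beta> \<in> carrier G" "sbg p \<alpha> \<subseteq> carrier G"
  shows "in_coset \<alpha> (case_sum x p) \<longleftrightarrow> (\<exists>h\<in>sbg p \<alpha>. tup x = h \<otimes> chain p (Suc \<alpha>))"
proof -
  have chain: "is_chain (Suc \<alpha>) (case_sum p z) \<longleftrightarrow> tup z = chain p (Suc \<alpha>)" for z
    by (rule is_chain_iff) (use assms(1) in auto)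
  have closed: "chain p (Suc \<alpha>) \<in> carrier G" by (rule chain_closed) (use assms(1) in auto)
  show ?thesis
  proof
    assume "in_coset \<alpha> (case_sum x p)"
    then obtain z where "tup (\<lambda>l. z (Inr l)) = chain p (Suc \<alpha>)" "tup (\<lambda>l. z (Inl l)) \<in> sbg p \<alpha>"
      "tup (\<lambda>l. z (Inl l)) @ tup (\<lambda>l. z (Inr l)) @ tup x \<in> solutions M (n + n + n) \<mu> ms"
      unfolding in_coset_def sum.case chain by blast
    then show "\<exists>h\<in>sbg p \<alpha>. tup x = h \<otimes> chain p (Suc \<alpha>)"
      by (intro bexI[of _ "tup (\<lambda>l. z (Inl l))"])
        (simp_all add: graph_iff length_carrier[OF closed] del: chain.simps)
  next
    assume "\<exists>h\<in>sbg p \<alpha>. tup x = h \<otimes> chain p (Suc \<alpha>)"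
    then obtain h where h: "h \<in> sbg p \<alpha>" "tup x = h \<otimes> chain p (Suc \<alpha>)" by blast
    moreover from h(1) assms(2) have "h \<in> carrier G" by blast
    ultimately show "in_coset \<alpha> (case_sum x p)"
      unfolding in_coset_def sum.case chain
      using closed by (intro exI[of _ "case_sum ((!) h) ((!) (chain p (Suc \<alpha>)))"])
        (simp add: tup_nth length_carrier graph_iff del: chain.simps)
  qed
qed

lemma depends_in_coset: "depends (Inl ` {..<n} \<union> Inr ` {(\<beta>, l). \<beta> \<le> \<alpha>}) (in_coset \<alpha>)"
  unfolding depends_def
proof (intro allI impI)
  fix e e' :: "nat + nat \<times> nat \<Rightarrow> 'a"
  assume e: "\<forall>v\<in>Inl ` {..<n} \<union> Inr ` {(\<beta>, l). \<beta> \<le> \<alpha>}. e v = e' v"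
  have "is_chain (Suc \<alpha>) (case_sum (\<lambda>v. e (Inr v)) q) = is_chain (Suc \<alpha>) (case_sum (\<lambda>v. e' (Inr v)) q)" for q
    by (rule dependsD[OF depends_is_chain]) (use e in auto)
  moreover have "map (\<lambda>l. e (Inr (\<alpha>, n + l))) [0..<m] = map (\<lambda>l. e' (Inr (\<alpha>, n + l))) [0..<m]"
    "tup (\<lambda>l. e (Inl l)) = tup (\<lambda>l. e' (Inl l))" using e by auto
  ultimately show "in_coset \<alpha> e = in_coset \<alpha> e'" by (simp only: in_coset_def)
qed

lemma Def_graph:
  assumes "length vs = n + n + n" "set ms \<subseteq> B"
  shows "Def B (\<lambda>e. map e vs \<in> solutions M (n + n + n) \<mu> ms)"
  using Def_sat[of vs ms \<mu> B] assms \<mu> by (simp add: solutions_def)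

lemma Def_is_chain:
  assumes B: "set ms \<subseteq> B" "set \<one> \<subseteq> B"
  shows "Def B (is_chain \<alpha>)"
proof (induction \<alpha>)
  case 0
  have "Def B (\<lambda>e :: (nat \<times> nat) + nat \<Rightarrow> 'a. \<forall>l\<in>{..<n}. e (Inr l) = \<one> ! l)"
    using B(2) length_carrier[OF one_closed] by (intro Def_ball Def_eq_const) auto
  then show ?case by simp
next
  case (Suc \<alpha>)
  let ?vs = "map (\<lambda>l. Inl (Inl (\<alpha>, l))) [0..<n] @ map Inr [0..<n] @ map (\<lambda>l. Inl (Inr l)) [0..<n]
    :: (((nat \<times> nat) + nat) + nat) list"
  have "Def B (\<lambda>E. is_chain \<alpha> (\<lambda>v. E (case_sum (\<lambda>v. Inl (Inl v)) Inr v)) \<and>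
      map E ?vs \<in> solutions M (n + n + n) \<mu> ms)"
    by (intro Def_and Def_reindex[OF Suc] Def_graph) (use B in auto)
  from Def_ex[OF this]
  have "Def B (\<lambda>e. \<exists>q. is_chain \<alpha> (\<lambda>v. case_sum e q (case_sum (\<lambda>v. Inl (Inl v)) Inr v)) \<and>
      map (case_sum e q) ?vs \<in> solutions M (n + n + n) \<mu> ms)" .
  moreover have "(\<lambda>v. case_sum e q (case_sum (\<lambda>v. Inl (Inl v)) Inr v)) = case_sum (\<lambda>v. e (Inl v)) q"
    for e :: "(nat \<times> nat) + nat \<Rightarrow> 'a" and q :: "nat \<Rightarrow> 'a"
    by (auto split: sum.splits)
  moreover have "map (case_sum e q) ?vs =
      map (\<lambda>l. e (Inl (\<alpha>, l))) [0..<n] @ tup q @ map (\<lambda>l. e (Inr l)) [0..<n]"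
    for e :: "(nat \<times> nat) + nat \<Rightarrow> 'a" and q :: "nat \<Rightarrow> 'a"
    by simp
  ultimately show ?case by (simp only: is_chain.simps)
qed

lemma Def_in_coset:
  assumes B: "set ms \<subseteq> B" "set \<one> \<subseteq> B"
  shows "Def B (in_coset \<alpha>)"
proof -
  let ?g = "case_sum (\<lambda>v. Inl (Inr v)) (\<lambda>l. Inr (Inr l)) :: _ \<Rightarrow> (nat + nat \<times> nat) + (nat + nat)"
  let ?h = "map (\<lambda>l. Inr (Inl l)) [0..<n] :: ((nat + nat \<times> nat) + (nat + nat)) list"
  let ?ys = "map (\<lambda>l. Inl (Inr (\<alpha>, n + l))) [0..<m] :: ((nat + nat \<times> nat) + (nat + nat)) list"
  let ?vs = "?h @ map (\<lambda>l. Inr (Inr l)) [0..<n] @ map (\<lambda>l. Inl (Inl l)) [0..<n]"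
  have "Def B (\<lambda>E. sat M (map E (?h @ ?ys) @ []) \<phi>)"
    by (rule Def_sat) (use \<phi> in auto)
  then have "Def B (\<lambda>E. map E ?h \<in> solutions M n \<phi> (map E ?ys))"
    by (simp add: solutions_def)
  then have "Def B (\<lambda>E. is_chain (Suc \<alpha>) (\<lambda>v. E (?g v)) \<and>
      map E ?h \<in> solutions M n \<phi> (map E ?ys) \<and> map E ?vs \<in> solutions M (n + n + n) \<mu> ms)"
    by (intro Def_and Def_reindex[OF Def_is_chain] Def_graph) (use B in auto)
  from Def_ex[OF this]
  have "Def B (\<lambda>e. \<exists>z. is_chain (Suc \<alpha>) (\<lambda>v. case_sum e z (?g v)) \<and>
      map (case_sum e z) ?h \<in> solutions M n \<phi> (map (case_sum e z) ?ys) \<and>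
      map (case_sum e z) ?vs \<in> solutions M (n + n + n) \<mu> ms)" .
  moreover have "(\<lambda>v. case_sum e z (?g v)) = case_sum (\<lambda>v. e (Inr v)) (\<lambda>l. z (Inr l))"
    for e :: "nat + nat \<times> nat \<Rightarrow> 'a" and z :: "nat + nat \<Rightarrow> 'a"
    by (auto split: sum.splits)
  moreover have "map (case_sum e z) ?h = tup (\<lambda>l. z (Inl l))"
    "map (case_sum e z) ?ys = map (\<lambda>l. e (Inr (\<alpha>, n + l))) [0..<m]"
    "map (case_sum e z) ?vs = tup (\<lambda>l. z (Inl l)) @ tup (\<lambda>l. z (Inr l)) @ tup (\<lambda>l. e (Inl l))"
    for e :: "nat + nat \<times> nat \<Rightarrow> 'a" and z :: "nat + nat \<Rightarrow> 'a"
    by simp_all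
  ultimately show ?thesis by (simp only: in_coset_def[abs_def])
qed

section \<open>Arrays of independent cosets\<close>

definition independent_cosets :: "nat \<Rightarrow> (nat \<Rightarrow> 'a list) \<Rightarrow> (nat \<Rightarrow> nat \<Rightarrow> 'a list) \<Rightarrow> bool" where
  "independent_cosets K y c \<longleftrightarrow>
     (\<forall>\<alpha><K. length (y \<alpha>) = m \<and> subgroup (solutions M n \<phi> (y \<alpha>)) G \<and>
       (\<forall>i. c \<alpha> i \<in> carrier G \<and> (\<forall>\<beta><K. \<beta> \<noteq> \<alpha> \<longrightarrow> c \<alpha> i \<in> solutions M n \<phi> (y \<beta>))) \<and>
       (\<forall>i j. i \<noteq> j \<longrightarrow> c \<alpha> i \<otimes> inv (c \<alpha> j) \<notin> solutions M n \<phi> (y \<alpha>)))"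

text \<open>Every place of an array has infinitely many entries; the constant padding from index
  \<open>n + m\<close> on expresses that its tuples are finite, with \<open>n + m\<close> as
  \<open>lmax\<close>.\<close>

definition coset_array :: "(nat \<Rightarrow> 'a list) \<Rightarrow> (nat \<Rightarrow> nat \<Rightarrow> 'a list) \<Rightarrow> nat \<times> nat \<times> nat \<Rightarrow> 'a" where
  "coset_array y c = (\<lambda>(\<alpha>, i, l). if l < n then c \<alpha> i ! l else if l < n + m then y \<alpha> ! (l - n) else undefined)"

lemma coset_array_min: "coset_array y c (\<alpha>, i, l) = coset_array y c (\<alpha>, i, min l (n + m))"
  by (simp add: coset_array_def min_def)

context
  fixes K y c
  assumes ic: "independent_cosets K y c"
begin

lemma elt_coset_array: "\<alpha> < K \<Longrightarrow> elt (path (coset_array y c) \<eta>) \<alpha> = c \<alpha> (\<eta> \<alpha>)"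
  using ic length_carrier unfolding independent_cosets_def
  by (intro nth_equalityI) (auto simp: coset_array_def path_apply)

lemma sbg_coset_array: "\<alpha> < K \<Longrightarrow> sbg (path (coset_array y c) \<eta>) \<alpha> = solutions M n \<phi> (y \<alpha>)"
proof -
  assume "\<alpha> < K"
  then have "map (\<lambda>l. path (coset_array y c) \<eta> (\<alpha>, n + l)) [0..<m] = y \<alpha>"
    using ic unfolding independent_cosets_def
    by (intro nth_equalityI) (auto simp: coset_array_def path_apply)
  then show ?thesis by simp
qed

lemma in_coset_array:
  assumes "\<alpha> < K"
  shows "in_coset \<alpha> (case_sum x (path (coset_array y c) \<eta>)) \<longleftrightarrow>
    (\<exists>h\<in>solutions M n \<phi> (y \<alpha>). tup x = h \<otimes> (c \<alpha> (\<eta> \<alpha>) \<otimes> chain (path (coset_array y c) \<eta>) \<alpha>))"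
proof -
  have "in_coset \<alpha> (case_sum x (path (coset_array y c) \<eta>)) \<longleftrightarrow>
    (\<exists>h\<in>sbg (path (coset_array y c) \<eta>) \<alpha>. tup x = h \<otimes> chain (path (coset_array y c) \<eta>) (Suc \<alpha>))"
  proof (rule in_coset_iff)
    show "elt (path (coset_array y c) \<eta>) \<beta> \<in> carrier G" if "\<beta> \<le> \<alpha>" for \<beta>
      using that assms ic elt_coset_array[of \<beta> \<eta>] unfolding independent_cosets_def by simp
    show "sbg (path (coset_array y c) \<eta>) \<alpha> \<subseteq> carrier G"
      unfolding sbg_coset_array[OF assms]
      using assms ic unfolding independent_cosets_def by (simp add: subgroup.subset)
  qed
  then show ?thesis by (simp only: sbg_coset_array[OF assms] chain.simps elt_coset_array[OF assms])
qed

lemma chain_coset_array_closed: "\<alpha> \<le> K \<Longrightarrow> chain (path (coset_array y c) \<eta>) \<alpha> \<in> carrier G"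
  by (rule chain_closed) (use ic in \<open>auto simp: elt_coset_array independent_cosets_def\<close>)

text \<open>The solution is the product of all chosen elements. Its factors to the left of
  \<open>c \<alpha> (\<eta> \<alpha>)\<close> come from other rows and lie in the subgroup of row
  \<open>\<alpha>\<close>, so it is in the required coset for every \<open>\<alpha>\<close>.\<close>

lemma coset_array_consistent:
  assumes "K' \<le> K"
  shows "\<exists>x. \<forall>\<alpha><K'. in_coset \<alpha> (case_sum x (path (coset_array y c) \<eta>))"
proof -
  let ?p = "path (coset_array y c) \<eta>"
  have ex: "\<exists>h\<in>solutions M n \<phi> (y \<alpha>). chain ?p k = h \<otimes> chain ?p (Suc \<alpha>)"
    if "\<alpha> < K" "Suc \<alpha> \<le> k" "k \<le> K" for \<alpha> k
    using that(2,3)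
  proof (induction k rule: dec_induct)
    case base
    interpret H: subgroup "solutions M n \<phi> (y \<alpha>)" G
      using ic \<open>\<alpha> < K\<close> unfolding independent_cosets_def by blast
    show ?case using chain_coset_array_closed[of "Suc \<alpha>" \<eta>] that(1)
      by (intro bexI[of _ \<one>]) (simp_all del: chain.simps)
  next
    case (step k)
    interpret H: subgroup "solutions M n \<phi> (y \<alpha>)" G
      using ic \<open>\<alpha> < K\<close> unfolding independent_cosets_def by blast
    from step obtain h where h: "h \<in> solutions M n \<phi> (y \<alpha>)" "chain ?p k = h \<otimes> chain ?p (Suc \<alpha>)" by auto
    have c: "c k (\<eta> k) \<in> solutions M n \<phi> (y \<alpha>)"
      using ic step \<open>\<alpha> < K\<close> unfolding independent_cosets_def by auto
    have "chain ?p (Suc k) = c k (\<eta> k) \<otimes> chain ?p k" using step elt_coset_array by simp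
    also have "\<dots> = (c k (\<eta> k) \<otimes> h) \<otimes> chain ?p (Suc \<alpha>)"
      unfolding h(2) using h(1) c chain_coset_array_closed[of "Suc \<alpha>" \<eta>] that(1)
      by (simp add: m_assoc H.mem_carrier del: chain.simps)
    finally show ?case using h(1) c by (intro bexI[of _ "c k (\<eta> k) \<otimes> h"]) auto
  qed
  let ?x = "(!) (chain ?p K')"
  have "tup ?x = chain ?p K'"
    by (rule tup_nth) (rule length_carrier, rule chain_coset_array_closed, rule assms)
  then have "in_coset \<alpha> (case_sum ?x ?p)" if "\<alpha> < K'" for \<alpha>
    using ex[of \<alpha> K'] that assms in_coset_array[of \<alpha> ?x \<eta>] elt_coset_array[of \<alpha> \<eta>]
    by (simp del: map_eq_conv)
  then show ?thesis by blast
qed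

text \<open>The product over the rows before \<open>\<alpha>\<close> is the same on both paths and
  cancels, which would put \<open>c \<alpha> i\<close> and \<open>c \<alpha> j\<close> into one
  right coset.\<close>

lemma coset_array_inconsistent:
  assumes \<alpha>: "\<alpha> < K" and "i \<noteq> j"
  shows "\<nexists>x. in_coset \<alpha> (case_sum x (path (coset_array y c) (\<eta>(\<alpha> := i)))) \<and>
    in_coset \<alpha> (case_sum x (path (coset_array y c) (\<eta>(\<alpha> := j))))"
proof
  let ?H = "solutions M n \<phi> (y \<alpha>)" and ?q = "\<lambda>i. chain (path (coset_array y c) (\<eta>(\<alpha> := i))) \<alpha>"
  interpret H: subgroup ?H G using ic \<alpha> unfolding independent_cosets_def by blast
  assume "\<exists>x. in_coset \<alpha> (case_sum x (path (coset_array y c) (\<eta>(\<alpha> := i)))) \<and>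
    in_coset \<alpha> (case_sum x (path (coset_array y c) (\<eta>(\<alpha> := j))))"
  then obtain h h' where h: "h \<in> ?H" "h' \<in> ?H" "h \<otimes> (c \<alpha> i \<otimes> ?q i) = h' \<otimes> (c \<alpha> j \<otimes> ?q j)"
    unfolding in_coset_array[OF \<alpha>] by auto
  have "?q j = ?q i"
    by (rule chain_cong) (use \<alpha> elt_coset_array in simp)
  then have q: "?q j = ?q i" "?q i \<in> carrier G" using chain_coset_array_closed \<alpha> by auto
  have c: "c \<alpha> i \<in> carrier G" "c \<alpha> j \<in> carrier G" using ic \<alpha> unfolding independent_cosets_def by auto
  note carr = H.mem_carrier[OF h(1)] H.mem_carrier[OF h(2)] c q(2)
  have "(h \<otimes> c \<alpha> i) \<otimes> ?q i = (h' \<otimes> c \<alpha> j) \<otimes> ?q i"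
    using h(3) carr unfolding q(1) by (simp add: m_assoc)
  then have "h \<otimes> c \<alpha> i = h' \<otimes> c \<alpha> j" using carr by (simp add: right_cancel)
  then have "h' = (h \<otimes> c \<alpha> i) \<otimes> inv (c \<alpha> j)" using carr by (simp add: m_assoc)
  then have "inv h \<otimes> h' = (inv h \<otimes> h) \<otimes> (c \<alpha> i \<otimes> inv (c \<alpha> j))"
    using carr by (simp only: m_assoc inv_closed m_closed)
  then have "c \<alpha> i \<otimes> inv (c \<alpha> j) = inv h \<otimes> h'" using carr by simp
  moreover have "inv h \<otimes> h' \<in> ?H" using h(1,2) by (intro H.m_closed H.m_inv_closed)
  moreover have "c \<alpha> i \<otimes> inv (c \<alpha> j) \<notin> ?H"
    using ic \<alpha> \<open>i \<noteq> j\<close> unfolding independent_cosets_def by blast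
  ultimately show False by simp
qed

end

text \<open>Compactness turns arbitrarily large finite families into one infinite array. What passes
  to the limit are the hypotheses of \<open>no_path_pattern\<close>: consistency along paths,
  incompatibility of columns and the padding.\<close>

theorem bounded_independent_cosets:
  assumes "strong2 L M"
  shows "\<exists>K. \<nexists>y c. independent_cosets K y c"
proof (rule ccontr)
  assume "\<not> ?thesis"
  then have "\<forall>K. \<exists>y c. independent_cosets K y c" by blast
  then obtain y c where ic: "\<And>K. independent_cosets K (y K) (c K)" by metis
  let ?A = "\<lambda>K. coset_array (y K) (c K)"
  let ?B = "insert undefined (set ms \<union> set \<one>)"
  define cons where "cons = (\<lambda>(K :: nat, \<eta>) E. \<exists>x. \<forall>\<alpha>\<in>{..<K}. in_coset \<alpha> (case_sum x (path E \<eta>)))"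
  define incons where "incons = (\<lambda>(\<alpha>, \<eta>, i, j) E.
    \<nexists>x. \<forall>k\<in>{i, j}. in_coset \<alpha> (case_sum x (path E (\<eta>(\<alpha> := k)))))"
  define short where "short = (\<lambda>(\<alpha>, i, l) (E :: nat \<times> nat \<times> nat \<Rightarrow> 'a). E (\<alpha>, i, l) = E (\<alpha>, i, min l (n + m)))"
  have Def_w: "Def ?B (in_coset \<alpha>)" for \<alpha> by (rule Def_in_coset) auto
  have "countable ?B" by (simp add: countable_finite)
  then obtain a where a: "\<forall>P\<in>range cons \<union> incons ` {(\<alpha>, \<eta>, i, j). i \<noteq> j} \<union> range short. P a"
  proof (rule realize_eventually)
    fix P assume "P \<in> range cons \<union> incons ` {(\<alpha>, \<eta>, i, j). i \<noteq> j} \<union> range short"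
    then consider k where "P = cons k" | k where "P = incons k" | k where "P = short k" by blast
    then show "Def ?B P"
    proof cases
      case 1
      obtain K \<eta> where k: "k = (K, \<eta>)" by (cases k)
      show ?thesis unfolding 1 k cons_def prod.case by (intro Def_ex_path Def_w) simp
    next
      case 2
      obtain \<alpha> \<eta> i j where k: "k = (\<alpha>, \<eta>, i, j)" by (cases k)
      show ?thesis unfolding 2 k incons_def prod.case by (intro Def_not Def_ex_path Def_w) simp
    next
      case 3
      obtain \<alpha> i l where k: "k = (\<alpha>, i, l)" by (cases k)
      show ?thesis unfolding 3 k short_def prod.case by (rule Def_eq)
    qed
  next
    fix P assume "P \<in> range cons \<union> incons ` {(\<alpha>, \<eta>, i, j). i \<noteq> j} \<union> range short"
    then consider K \<eta> where "P = cons (K, \<eta>)" | \<alpha> \<eta> i j where "P = incons (\<alpha>, \<eta>, i, j)" "i \<noteq> j"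
      | \<alpha> i l where "P = short (\<alpha>, i, l)" by auto
    \<comment> \<open>Each condition involves finitely many rows, so it holds for all arrays built
      from sufficiently many subgroups.\<close>
    then show "\<forall>\<^sub>F K in sequentially. P (?A K)"
    proof cases
      case (1 K0 \<eta>)
      have "P (?A K)" if "K0 \<le> K" for K
        unfolding 1 cons_def using coset_array_consistent[OF ic that] by (simp add: Ball_def)
      then show ?thesis by (rule eventually_sequentiallyI)
    next
      case (2 \<alpha> \<eta> i j)
      have "P (?A K)" if "Suc \<alpha> \<le> K" for K
        unfolding 2 incons_def using coset_array_inconsistent[OF ic _ 2(2), of \<alpha> K \<eta>] that by simp
      then show ?thesis by (rule eventually_sequentiallyI)
    next
      case (3 \<alpha> i l)
      have "P (?A K)" for K
        unfolding 3 short_def prod.case by (rule coset_array_min)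
      then show ?thesis by (intro always_eventually allI)
    qed
  qed
  have cons: "cons k a" for k by (rule bspec[OF a UnI1[OF UnI1[OF rangeI]]])
  have incons: "incons k a" if "k \<in> {(\<alpha>, \<eta>, i, j). i \<noteq> j}" for k
    by (rule bspec[OF a UnI1[OF UnI2[OF imageI[OF that]]]])
  have short: "short k a" for k by (rule bspec[OF a UnI2[OF rangeI]])
  show False
  proof (rule no_path_pattern[OF assms, where w = in_coset and B = ?B and ?b0.0 = undefined and n = n and lmax = "n + m" and a = a])
    show "Def ?B (in_coset \<alpha>)" for \<alpha> by (rule Def_w)
    show "depends (Inl ` {..<n} \<union> Inr ` {(\<beta>, l). \<beta> \<le> \<alpha>}) (in_coset \<alpha>)" for \<alpha>
      by (rule depends_in_coset)
    show "a (\<alpha>, i, l) = a (\<alpha>, i, min l (n + m))" for \<alpha> i l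
      using short[of "(\<alpha>, i, l)"] unfolding short_def prod.case .
    show "\<exists>x. \<forall>\<alpha><K. in_coset \<alpha> (case_sum x (path a \<eta>))" for \<eta> K
      using cons[of "(K, \<eta>)"] unfolding cons_def prod.case by (simp add: Ball_def)
    show "\<nexists>x. in_coset \<alpha> (case_sum x (path a (\<eta>(\<alpha> := i)))) \<and> in_coset \<alpha> (case_sum x (path a (\<eta>(\<alpha> := j))))"
      if "i \<noteq> j" for \<alpha> \<eta> i j
      using incons[of "(\<alpha>, \<eta>, i, j)"] that unfolding incons_def prod.case by simp
  qed (simp_all add: countable_finite)
qed

end

subsection \<open>Finite index\<close>

text \<open>\<^const>\<open>finite_index\<close> is only declared for groups whose record has no extra fields.\<close>

locale plain_group = group G for G :: "'a monoid" (structure)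
begin

lemma rcos_eq_iff:
  assumes "subgroup J G" "x \<in> carrier G" "y \<in> carrier G"
  shows "J #> x = J #> y \<longleftrightarrow> x \<otimes> inv y \<in> J"
proof -
  interpret J: subgroup J G by fact
  have "J #> x = J #> y \<longleftrightarrow> x \<in> J #> y"
    using repr_independence[of x J y] rcos_self[of x J] assms by auto
  then show ?thesis using J.rcos_module[OF is_group assms(3,2)] by simp
qed

lemma finite_index_iff:
  "finite_index G H J \<longleftrightarrow> finite ((\<lambda>x. J #> x) ` H)"
proof -
  have "rcosets\<^bsub>G\<lparr>carrier := H\<rparr>\<^esub> J = (\<lambda>x. J #> x) ` H"
    by (auto simp: RCOSETS_def r_coset_def)
  then show ?thesis by (simp add: finite_index_def)
qed

lemma finite_index_iff_transversal:
  assumes "subgroup J G" "H \<subseteq> carrier G"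
  shows "finite_index G H J \<longleftrightarrow> (\<exists>T. finite T \<and> T \<subseteq> H \<and> (\<forall>x\<in>H. \<exists>t\<in>T. x \<otimes> inv t \<in> J))"
proof
  assume "finite_index G H J"
  then have "finite ((\<lambda>x. J #> x) ` H)" by (simp add: finite_index_iff)
  from finite_subset_image[OF this subset_refl] obtain T where
    T: "T \<subseteq> H" "finite T" "(\<lambda>x. J #> x) ` H = (\<lambda>x. J #> x) ` T" by blast
  have "\<exists>t\<in>T. x \<otimes> inv t \<in> J" if "x \<in> H" for x
  proof -
    from that T(3) obtain t where "t \<in> T" "J #> x = J #> t" by blast
    with rcos_eq_iff[OF assms(1), of x t] that T(1) assms(2) show ?thesis by blast
  qed
  with T(1,2) show "\<exists>T. finite T \<and> T \<subseteq> H \<and> (\<forall>x\<in>H. \<exists>t\<in>T. x \<otimes> inv t \<in> J)"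
    by (intro exI[of _ T]) simp
next
  assume "\<exists>T. finite T \<and> T \<subseteq> H \<and> (\<forall>x\<in>H. \<exists>t\<in>T. x \<otimes> inv t \<in> J)"
  then obtain T where T: "finite T" "T \<subseteq> H" "\<forall>x\<in>H. \<exists>t\<in>T. x \<otimes> inv t \<in> J" by blast
  have "(\<lambda>x. J #> x) ` H \<subseteq> (\<lambda>x. J #> x) ` T"
  proof
    fix X assume "X \<in> (\<lambda>x. J #> x) ` H"
    then obtain x where x: "x \<in> H" "X = J #> x" by blast
    with T(3) obtain t where "t \<in> T" "x \<otimes> inv t \<in> J" by blast
    with rcos_eq_iff[OF assms(1), of x t] x T(2) assms(2) show "X \<in> (\<lambda>x. J #> x) ` T" by blast
  qed
  with T(1) show "finite_index G H J" by (simp add: finite_index_iff finite_subset)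
qed

lemma finite_index_refl:
  assumes "subgroup J G"
  shows "finite_index G J J"
proof -
  have "J #> x = J" if "x \<in> J" for x
    by (rule coset_join2[OF subgroup.mem_carrier[OF assms that] assms that])
  then have "(\<lambda>x. J #> x) ` J \<subseteq> {J}" by auto
  then show ?thesis unfolding finite_index_iff by (rule finite_subset) simp
qed

text \<open>Products of representatives for the two steps of the tower represent all cosets of the
  smallest group.\<close>

lemma finite_index_trans:
  assumes "subgroup I G" "subgroup J G" "H \<subseteq> carrier G" "I \<subseteq> H"
    and mult: "\<And>x y. x \<in> H \<Longrightarrow> y \<in> H \<Longrightarrow> x \<otimes> y \<in> H"
    and "finite_index G H I" "finite_index G I J"
  shows "finite_index G H J"
proof -
  have "I \<subseteq> carrier G" using assms(1) by (rule subgroup.subset)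
  from assms(6) obtain T where T: "finite T" "T \<subseteq> H" "\<forall>x\<in>H. \<exists>t\<in>T. x \<otimes> inv t \<in> I"
    using finite_index_iff_transversal[OF assms(1,3)] by blast
  from assms(7) obtain S where S: "finite S" "S \<subseteq> I" "\<forall>x\<in>I. \<exists>s\<in>S. x \<otimes> inv s \<in> J"
    using finite_index_iff_transversal[OF assms(2) \<open>I \<subseteq> carrier G\<close>] by blast
  let ?U = "(\<lambda>(s, t). s \<otimes> t) ` (S \<times> T)"
  have "finite ?U" using S(1) T(1) by simp
  moreover have "s \<otimes> t \<in> H" if "s \<in> S" "t \<in> T" for s t
    using that S(2) T(2) assms(4) by (intro mult) blast+
  then have "?U \<subseteq> H" by auto
  moreover have "\<exists>u\<in>?U. x \<otimes> inv u \<in> J" if x: "x \<in> H" for x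
  proof -
    from T(3) x obtain t where t: "t \<in> T" "x \<otimes> inv t \<in> I" by blast
    with S(3) obtain s where s: "s \<in> S" "x \<otimes> inv t \<otimes> inv s \<in> J" by blast
    have "x \<in> carrier G" "t \<in> carrier G" "s \<in> carrier G"
      using x t(1) s(1) T(2) S(2) assms(3) \<open>I \<subseteq> carrier G\<close> by blast+
    then have "x \<otimes> inv (s \<otimes> t) = x \<otimes> inv t \<otimes> inv s" by (simp add: inv_mult_group m_assoc)
    with s t(1) show ?thesis by (intro bexI[of _ "s \<otimes> t"]) auto
  qed
  ultimately show ?thesis
    unfolding finite_index_iff_transversal[OF assms(2,3)] by (intro exI[of _ ?U] conjI ballI)
qed

lemma infinite_index_sequence:
  assumes "subgroup J G" "H \<subseteq> carrier G" "\<not> finite_index G H J"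
  shows "\<exists>g :: nat \<Rightarrow> 'a. (\<forall>i. g i \<in> H) \<and> (\<forall>i j. i \<noteq> j \<longrightarrow> g i \<otimes> inv (g j) \<notin> J)"
proof -
  from assms(3) have "infinite ((\<lambda>x. J #> x) ` H)" by (simp add: finite_index_iff)
  then obtain f :: "nat \<Rightarrow> 'a set" where f: "inj f" "range f \<subseteq> (\<lambda>x. J #> x) ` H"
    using infinite_countable_subset by blast
  then have "\<forall>i. \<exists>x\<in>H. f i = J #> x" by blast
  then obtain g where g: "\<And>i. g i \<in> H" "\<And>i. f i = J #> g i" by metis
  have "g i \<otimes> inv (g j) \<notin> J" if "i \<noteq> j" for i j
    using rcos_eq_iff[OF assms(1), of "g i" "g j"] g assms(2) f(1) that by (metis injD subsetD)
  with g(1) show ?thesis by blast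
qed

lemma subgroup_inter_in:
  assumes "\<And>i. i \<in> I \<Longrightarrow> subgroup (H i) G"
  shows "subgroup (inter_in G H I) G"
proof (rule subgroupI)
  show "inter_in G H I \<subseteq> carrier G" by (simp add: inter_in_def)
  have "\<one> \<in> inter_in G H I" using subgroup.one_closed[OF assms] by (simp add: inter_in_def)
  then show "inter_in G H I \<noteq> {}" by blast
  show "inv x \<in> inter_in G H I" if "x \<in> inter_in G H I" for x
    using that subgroup.m_inv_closed[OF assms] by (simp add: inter_in_def)
  show "x \<otimes> y \<in> inter_in G H I" if "x \<in> inter_in G H I" "y \<in> inter_in G H I" for x y
    using that subgroup.m_closed[OF assms] by (simp add: inter_in_def)
qed

text \<open>A qualifying subfamily of least size cannot lose a member at finite index, since by
  transitivity the smaller subfamily would still qualify.\<close>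

lemma ex_irredundant_subfamily:
  assumes "finite C" and H: "\<And>i. i \<in> C \<Longrightarrow> subgroup (H i) G"
  obtains C0 where "C0 \<subseteq> C" "finite_index G (inter_in G H C0) (inter_in G H C)"
    "\<And>c. c \<in> C0 \<Longrightarrow> \<not> finite_index G (inter_in G H (C0 - {c})) (inter_in G H C0)"
proof -
  let ?P = "\<lambda>D. D \<subseteq> C \<and> finite_index G (inter_in G H D) (inter_in G H C)"
  have sub: "subgroup (inter_in G H D) G" if "D \<subseteq> C" for D
    using that H by (intro subgroup_inter_in) blast
  have "?P C" using finite_index_refl[OF sub] by simp
  then obtain C0 where C0: "?P C0" "\<And>D. ?P D \<Longrightarrow> card C0 \<le> card D"
    using ex_has_least_nat[of ?P C card] by blast
  have "\<not> finite_index G (inter_in G H (C0 - {c})) (inter_in G H C0)" if c: "c \<in> C0" for c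
  proof
    assume *: "finite_index G (inter_in G H (C0 - {c})) (inter_in G H C0)"
    have D: "C0 - {c} \<subseteq> C" using C0(1) by blast
    interpret D: subgroup "inter_in G H (C0 - {c})" G by (rule sub[OF D])
    have "finite_index G (inter_in G H (C0 - {c})) (inter_in G H C)"
    proof (rule finite_index_trans)
      show "subgroup (inter_in G H C0) G" "subgroup (inter_in G H C) G" using C0(1) sub by blast+
      show "inter_in G H C0 \<subseteq> inter_in G H (C0 - {c})" by (auto simp: inter_in_def)
      show "finite_index G (inter_in G H C0) (inter_in G H C)" using C0(1) by blast
    qed (use D.subset D.m_closed * in blast)+
    with D have "card C0 \<le> card (C0 - {c})" by (intro C0(2)) blast
    moreover have "finite C0" using C0(1) assms(1) finite_subset by blast
    ultimately show False using c by (meson card_Diff1_less not_less)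
  qed
  with C0(1) show ?thesis using that by blast
qed

end

text \<open>In any language the formulas \<open>Eq (Var i) (Var i)\<close> are infinitely many, so
  every countable set is smaller than \<open>\<kappa>\<close>.\<close>

lemma monster_countably_saturated:
  fixes \<CC> :: "('f, 'r, 'a) struct" and \<kappa> :: "'k rel"
  assumes "monster_model L T \<kappa> \<CC>"
  shows "countably_saturated L \<CC>"
proof
  fix A :: "'a set" and P assume "countable A" and P: "P \<subseteq> pformulas L 1 A" "consistent \<CC> 1 P"
  let ?F = "{\<phi> :: ('f, 'r) fm. \<exists>k. is_formula L k \<phi>}"
  have "range (\<lambda>i. Eq (Var i) (Var i)) \<subseteq> ?F" by auto
  moreover have "infinite (range (\<lambda>i. Eq (Var i) (Var i) :: ('f, 'r) fm))"
    by (rule range_inj_infinite) (simp add: inj_def)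
  ultimately have "infinite ?F" using infinite_super by blast
  then have "|UNIV :: nat set| \<le>o |?F|" using infinite_iff_card_of_nat by blast
  moreover from \<open>countable A\<close> obtain f :: "'a \<Rightarrow> nat" where "inj_on f A"
    by (rule countableE)
  then have "|A| \<le>o |UNIV :: nat set|" using card_of_ordLeq by blast
  ultimately have "|A| \<le>o |?F|" using ordLeq_transitive by blast
  moreover have "|?F| <o \<kappa>" using assms by (simp add: monster_model_def)
  ultimately have "|A| <o \<kappa>" by (rule ordLeq_ordLess_trans)
  moreover have "saturated L \<CC> \<kappa>" using assms by (simp add: monster_model_def)
  ultimately show "\<exists>x. \<forall>(\<phi>, ps)\<in>P. [x] \<in> solutions \<CC> 1 \<phi> ps"
    using P unfolding saturated_def by blast
qed

theorem theorem4p12: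
  fixes L :: "('f, 'r) language"
    and T :: "('f, 'r) fm set"
    and \<kappa> :: "'k rel"
    and \<CC> :: "('f, 'r, 'a) struct"
    and G :: "'a list monoid"
    and \<phi> :: "('f, 'r) fm"
    and C :: "'a list set"
    and n m :: nat
  assumes "complete_theory L T"
    and "monster_model L T \<kappa> \<CC>"
    and "strong2 L \<CC>"
    and "definable_group L \<CC> n G"
    and "is_formula L (n + m) \<phi>"
    and "\<forall>a\<in>C. length a = m"
    and "\<forall>a\<in>C. subgroup (solutions \<CC> n \<phi> a) G"
  shows "\<exists>k::nat. \<forall>C'. finite C' \<and> C' \<subseteq> C \<longrightarrow>
           (\<exists>C\<^sub>0\<subseteq>C'. card C\<^sub>0 \<le> k \<and>
              finite_index G (inter_in G (solutions \<CC> n \<phi>) C\<^sub>0) (inter_in G (solutions \<CC> n \<phi>) C'))"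
proof -
  interpret countably_saturated L \<CC> by (rule monster_countably_saturated[OF assms(2)])
  from assms(4) have "group G" and carrier: "definable L \<CC> n (carrier G)"
    and mult: "definable L \<CC> (n + n + n)
      {x @ y @ (x \<otimes>\<^bsub>G\<^esub> y) | x y. x \<in> carrier G \<and> y \<in> carrier G}"
    by (simp_all add: definable_group_def)
  from mult obtain \<mu> ms where \<mu>: "is_formula L (n + n + n + length ms) \<mu>"
    "{x @ y @ (x \<otimes>\<^bsub>G\<^esub> y) | x y. x \<in> carrier G \<and> y \<in> carrier G} = solutions \<CC> (n + n + n) \<mu> ms"
    unfolding definable_def pformulas_def by auto
  interpret G: plain_group G using \<open>group G\<close> by (rule plain_group.intro)
  interpret definable_group_in L \<CC> G n m \<phi> \<mu> ms
  proof
    show "length x = n" if "x \<in> carrier G" for x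
      using carrier that by (auto simp: definable_def solutions_def)
  qed (use \<mu> assms(5) in auto)
  let ?H = "solutions \<CC> n \<phi>"
  obtain K where K: "\<nexists>y c. independent_cosets K y c" using bounded_independent_cosets[OF assms(3)] ..
  show ?thesis
  proof (intro exI[of _ K] allI impI)
    fix C' assume C': "finite C' \<and> C' \<subseteq> C"
    then obtain C0 where C0: "C0 \<subseteq> C'" "finite_index G (inter_in G ?H C0) (inter_in G ?H C')"
      "\<And>c. c \<in> C0 \<Longrightarrow> \<not> finite_index G (inter_in G ?H (C0 - {c})) (inter_in G ?H C0)"
      using G.ex_irredundant_subfamily[of C' ?H] assms(7) by blast
    \<comment> \<open>Otherwise \<open>K\<close> members could be selected. By irredundancy the
      intersection of \<open>C0\<close> has infinite index in that of \<open>C0 - {c}\<close> for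
      each of them, which supplies independent cosets.\<close>
    have "card C0 \<le> K"
    proof (rule ccontr)
      assume "\<not> card C0 \<le> K"
      have "finite C0" using C0(1) C' finite_subset by blast
      then obtain y where y: "bij_betw y {0..<card C0} C0" using ex_bij_betw_nat_finite by blast
      have yC0: "y \<alpha> \<in> C0" if "\<alpha> < K" for \<alpha>
        using bij_betwE[OF y] that \<open>\<not> card C0 \<le> K\<close> by auto
      have y_neq: "y \<alpha> \<noteq> y \<beta>" if "\<alpha> < K" "\<beta> < K" "\<alpha> \<noteq> \<beta>" for \<alpha> \<beta>
        using inj_onD[OF bij_betw_imp_inj_on[OF y], of \<alpha> \<beta>] that \<open>\<not> card C0 \<le> K\<close> by auto
      have C0_sub: "c \<in> C" if "c \<in> C0" for c using that C0(1) C' by blast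
      have sub: "subgroup (inter_in G ?H D) G" if "D \<subseteq> C0" for D
        using that assms(7) C0_sub by (intro G.subgroup_inter_in) blast
      have "\<forall>c\<in>C0. \<exists>g :: nat \<Rightarrow> 'a list. (\<forall>i. g i \<in> inter_in G ?H (C0 - {c})) \<and>
          (\<forall>i j. i \<noteq> j \<longrightarrow> g i \<otimes>\<^bsub>G\<^esub> inv\<^bsub>G\<^esub> g j \<notin> inter_in G ?H C0)"
        using G.infinite_index_sequence[OF sub[OF subset_refl] _ C0(3)] by (simp add: inter_in_def)
      from bchoice[OF this] obtain g :: "'a list \<Rightarrow> nat \<Rightarrow> 'a list" where
        "\<forall>c\<in>C0. (\<forall>i. g c i \<in> inter_in G ?H (C0 - {c})) \<and>
          (\<forall>i j. i \<noteq> j \<longrightarrow> g c i \<otimes>\<^bsub>G\<^esub> inv\<^bsub>G\<^esub> g c j \<notin> inter_in G ?H C0)" ..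
      then have g: "g c i \<in> inter_in G ?H (C0 - {c})"
        "i \<noteq> j \<Longrightarrow> g c i \<otimes>\<^bsub>G\<^esub> inv\<^bsub>G\<^esub> g c j \<notin> inter_in G ?H C0" if "c \<in> C0" for c i j
        using that by simp_all
      \<comment> \<open>The quotient lies in the intersection of the other members, so avoiding the
        full intersection forces it out of \<open>?H c\<close>.\<close>
      have g_notin: "g c i \<otimes>\<^bsub>G\<^esub> inv\<^bsub>G\<^esub> g c j \<notin> ?H c" if c: "c \<in> C0" and "i \<noteq> j" for c i j
      proof
        assume "g c i \<otimes>\<^bsub>G\<^esub> inv\<^bsub>G\<^esub> g c j \<in> ?H c"
        interpret D: subgroup "inter_in G ?H (C0 - {c})" G by (rule sub) blast
        have "g c i \<otimes>\<^bsub>G\<^esub> inv\<^bsub>G\<^esub> g c j \<in> inter_in G ?H (C0 - {c})"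
          using g(1)[OF c] by (intro D.m_closed D.m_inv_closed)
        with \<open>_ \<in> ?H c\<close> have "g c i \<otimes>\<^bsub>G\<^esub> inv\<^bsub>G\<^esub> g c j \<in> inter_in G ?H C0"
          by (auto simp: inter_in_def)
        with g(2)[OF that] show False by contradiction
      qed
      have "independent_cosets K y (\<lambda>\<alpha>. g (y \<alpha>))"
        unfolding independent_cosets_def
      proof (intro allI impI conjI)
        fix \<alpha> assume \<alpha>: "\<alpha> < K"
        show "length (y \<alpha>) = m" "subgroup (?H (y \<alpha>)) G"
          using yC0[OF \<alpha>] C0_sub assms(6,7) by blast+
        show "g (y \<alpha>) i \<in> carrier G" for i using g(1)[OF yC0[OF \<alpha>]] by (simp add: inter_in_def)
        show "g (y \<alpha>) i \<in> ?H (y \<beta>)" if "\<beta> < K" "\<beta> \<noteq> \<alpha>" for i \<beta>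
          using g(1)[OF yC0[OF \<alpha>], of i] yC0[OF that(1)] y_neq[OF that(1) \<alpha> that(2)]
          by (simp add: inter_in_def)
        show "g (y \<alpha>) i \<otimes>\<^bsub>G\<^esub> inv\<^bsub>G\<^esub> g (y \<alpha>) j \<notin> ?H (y \<alpha>)" if "i \<noteq> j" for i j
          by (rule g_notin[OF yC0[OF \<alpha>] that])
      qed
      with K show False by blast
    qed
    with C0(1,2) show "\<exists>C\<^sub>0\<subseteq>C'. card C\<^sub>0 \<le> K \<and>
        finite_index G (inter_in G ?H C\<^sub>0) (inter_in G ?H C')" by blast
  qed
qed

end
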